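(* There exists a sufficient family consisting of $64$ maps: there exist factorization maps $f_1,\dots,f_{64}\colon\mathbb{R}^3\to SL(2,\mathbb{R})$ such that for every $g\in SL(2,\mathbb{R})$ there exist $k\in\{1,\dots,64\}$ and $r,s,t\ge 0$ such that $f_k(r,s,t)$ provides an optimal factorization of $g$.
   Context: $P=\begin{pmatrix}0&1\\0&0\end{pmatrix}$, $Q=\begin{pmatrix}0&0\\1&0\end{pmatrix}$, and $\exp$ is the matrix exponential. The factorization cost of $g\in SL(2,\mathbb{R})$ is $$\mathcal{T}(g)=\inf\Big\{\sum_{i=1}^k|t_i| : g=\exp(t_1A_1)\cdots\exp(t_kA_k),\ k\in\mathbb{N},\ t_i\in\mathbb{R},\ A_i\in\{P,Q\}\Big\}.$$ A factor $\exp(tP)$ or $\exp(tQ)$ has cost $|t|$; a factor $\exp(t(P+Q))$ has cost $2|t|$. The cost of a product of such factors is the sum of the costs of its factors; a factorization of $g$ is optimal if its cost equals $\mathcal{T}(g)$. A factorization map is a map $f\colon\mathbb{R}^3\to SL(2,\mathbb{R})$ given by a fixed expression $f(r,s,t)=\exp(a_1(r,s,t)A_1)\cdots\exp(a_m(r,s,t)A_m)$ with fixed $m\in\mathbb{N}$, fixed $A_i\in\{P,Q,P+Q\}$ and fixed affine functions $a_i\colon\mathbb{R}^3\to\mathbb{R}$. One says that $f(r,s,t)$ provides an optimal factorization of $g$ if $f(r,s,t)=g$ and the cost of the product $\exp(a_1(r,s,t)A_1)\cdots\exp(a_m(r,s,t)A_m)$ equals $\mathcal{T}(g)$. *)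

theory Defs
  imports "HOL-Analysis.Analysis"
begin

primrec matrix_power :: "real^'n^'n \<Rightarrow> nat \<Rightarrow> real^'n^'n" where
  "matrix_power A 0 = mat 1"
| "matrix_power A (Suc n) = A ** matrix_power A n"

(* The library exponential is not applicable: real^'n^'n is not an instance of
   the class real_normed_algebra_1. *)
definition matrix_exp :: "real^'n^'n \<Rightarrow> real^'n^'n" where
  "matrix_exp A = (\<Sum>n. matrix_power A n /\<^sub>R fact n)"

definition SL2 :: "(real^2^2) set" where
  "SL2 = {g. det g = 1}"

definition P :: "real^2^2" where
  "P = vector [vector [0, 1], vector [0, 0]]"

definition Q :: "real^2^2" where
  "Q = vector [vector [0, 0], vector [1, 0]]"

(* A product exp(t_1 A_1) ... exp(t_k A_k) is encoded by [(t_1, A_1), ..., (t_k, A_k)].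
   The cost belongs to this formal product, not to the matrix it evaluates to. *)
definition exp_product :: "(real \<times> (real^2^2)) list \<Rightarrow> real^2^2" where
  "exp_product w = foldr (\<lambda>(t, A) g. matrix_exp (t *\<^sub>R A) ** g) w (mat 1)"

(* Intended for matrices in {P, Q, P + Q} only. *)
definition product_cost :: "(real \<times> (real^2^2)) list \<Rightarrow> real" where
  "product_cost w = (\<Sum>(t, A)\<leftarrow>w. if A = P + Q then 2 * \<bar>t\<bar> else \<bar>t\<bar>)"

definition factorization_cost :: "real^2^2 \<Rightarrow> real" where
  "factorization_cost g =
     Inf {(\<Sum>(t, A)\<leftarrow>w. \<bar>t\<bar>) | w. snd ` set w \<subseteq> {P, Q} \<and> g = exp_product w}"

definition affine_function :: "(real^3 \<Rightarrow> real) \<Rightarrow> bool" where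
  "affine_function a \<longleftrightarrow> (\<exists>l c. linear l \<and> a = (\<lambda>x. l x + c))"

(* A factorization map is represented by its defining expression, since the cost of
   f(r, s, t) depends on the expression. *)
type_synonym expression = "((real^3 \<Rightarrow> real) \<times> (real^2^2)) list"

definition factorization_expression :: "expression \<Rightarrow> bool" where
  "factorization_expression f \<longleftrightarrow> (\<forall>(a, A)\<in>set f. affine_function a \<and> A \<in> {P, Q, P + Q})"

definition product_at :: "expression \<Rightarrow> real^3 \<Rightarrow> (real \<times> (real^2^2)) list" where
  "product_at f x = map (\<lambda>(a, A). (a x, A)) f"

definition factorization_map :: "expression \<Rightarrow> real^3 \<Rightarrow> real^2^2" where
  "factorization_map f x = exp_product (product_at f x)"

definition provides_optimal_factorization :: "expression \<Rightarrow> real^3 \<Rightarrow> real^2^2 \<Rightarrow> bool" where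
  "provides_optimal_factorization f x g \<longleftrightarrow>
     factorization_map f x = g \<and> product_cost (product_at f x) = factorization_cost g"

lemma sums_matrix2:
  fixes F :: "nat \<Rightarrow> real^2^2"
  assumes "\<And>i j. (\<lambda>n. F n $ i $ j) sums (G $ i $ j)"
  shows "F sums G"
  unfolding sums_def
  by (intro vec_tendstoI) (use assms in \<open>simp add: sums_def\<close>)

lemma matrix_exp_P: "matrix_exp (t *\<^sub>R P) = vector [vector [1, t], vector [0, 1]]"
proof -
  have z: "matrix_power (t *\<^sub>R P) (Suc (Suc n)) = 0" for n
    by (simp add: matrix_mul_assoc)
      (simp add: P_def vec_eq_iff matrix_matrix_mult_def forall_2 sum_2)
  have "(\<lambda>n. matrix_power (t *\<^sub>R P) n /\<^sub>R fact n) sums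
      (\<Sum>n\<in>{0, 1}. matrix_power (t *\<^sub>R P) n /\<^sub>R fact n)"
  proof (rule sums_finite)
    fix n :: nat
    assume "n \<notin> {0, 1}"
    then obtain m where "n = Suc (Suc m)"
      by (cases n; cases "n - 1") auto
    then show "matrix_power (t *\<^sub>R P) n /\<^sub>R fact n = 0"
      using z by simp
  qed simp
  then have "matrix_exp (t *\<^sub>R P) = (\<Sum>n\<in>{0, 1}. matrix_power (t *\<^sub>R P) n /\<^sub>R fact n)"
    unfolding matrix_exp_def by (rule sums_unique[symmetric])
  then have "matrix_exp (t *\<^sub>R P) = mat 1 + t *\<^sub>R P"
    by simp
  then show ?thesis
    by (simp add: P_def vec_eq_iff forall_2 mat_def)
qed

lemma matrix_exp_Q: "matrix_exp (t *\<^sub>R Q) = vector [vector [1, 0], vector [t, 1]]"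
proof -
  have z: "matrix_power (t *\<^sub>R Q) (Suc (Suc n)) = 0" for n
    by (simp add: matrix_mul_assoc)
      (simp add: Q_def vec_eq_iff matrix_matrix_mult_def forall_2 sum_2)
  have "(\<lambda>n. matrix_power (t *\<^sub>R Q) n /\<^sub>R fact n) sums
      (\<Sum>n\<in>{0, 1}. matrix_power (t *\<^sub>R Q) n /\<^sub>R fact n)"
  proof (rule sums_finite)
    fix n :: nat
    assume "n \<notin> {0, 1}"
    then obtain m where "n = Suc (Suc m)"
      by (cases n; cases "n - 1") auto
    then show "matrix_power (t *\<^sub>R Q) n /\<^sub>R fact n = 0"
      using z by simp
  qed simp
  then have "matrix_exp (t *\<^sub>R Q) = (\<Sum>n\<in>{0, 1}. matrix_power (t *\<^sub>R Q) n /\<^sub>R fact n)"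
    unfolding matrix_exp_def by (rule sums_unique[symmetric])
  then have "matrix_exp (t *\<^sub>R Q) = mat 1 + t *\<^sub>R Q"
    by simp
  then show ?thesis
    by (simp add: Q_def vec_eq_iff forall_2 mat_def)
qed

lemma matrix_exp_P_plus_Q:
  "matrix_exp (t *\<^sub>R (P + Q)) = vector [vector [cosh t, sinh t], vector [sinh t, cosh t]]"
proof -
  have pow: "matrix_power (t *\<^sub>R (P + Q)) n =
      vector [vector [if even n then t ^ n else 0, if even n then 0 else t ^ n],
              vector [if even n then 0 else t ^ n, if even n then t ^ n else 0]]" for n
    by (induction n)
      (simp_all add: P_def Q_def mat_def vec_eq_iff matrix_matrix_mult_def forall_2 sum_2)
  have s: "(\<lambda>n. (if even n then 0 else t ^ n) / fact n) sums sinh t"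
    using sinh_converges[of t]
    by (rule back_subst[where P = "\<lambda>f. f sums sinh t"]) (auto simp: field_simps)
  have c: "(\<lambda>n. (if even n then t ^ n else 0) / fact n) sums cosh t"
    using cosh_converges[of t]
    by (rule back_subst[where P = "\<lambda>f. f sums cosh t"]) (auto simp: field_simps)
  have "(\<lambda>n. matrix_power (t *\<^sub>R (P + Q)) n /\<^sub>R fact n) sums
      vector [vector [cosh t, sinh t], vector [sinh t, cosh t]]"
  proof (rule sums_matrix2)
    fix i j :: 2
    show "(\<lambda>n. (matrix_power (t *\<^sub>R (P + Q)) n /\<^sub>R fact n) $ i $ j) sums
        ((vector [vector [cosh t, sinh t], vector [sinh t, cosh t]] :: real^2^2) $ i $ j)"
      using s c exhaust_2[of i] exhaust_2[of j]
      by (auto simp: pow divide_inverse mult.commute)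
  qed
  then show ?thesis
    unfolding matrix_exp_def by (rule sums_unique[symmetric])
qed

lemma factorization_map_in_SL2:
  assumes "factorization_expression f"
  shows "factorization_map f x \<in> SL2"
  using assms
proof (induction f)
  case Nil
  then show ?case
    by (simp add: factorization_map_def exp_product_def product_at_def SL2_def)
next
  case (Cons p f)
  obtain a A where p: "p = (a, A)"
    by (cases p)
  have "det (matrix_exp (a x *\<^sub>R A)) = 1"
    using Cons.prems p cosh_square_eq[of "a x"]
    by (auto simp: factorization_expression_def matrix_exp_P matrix_exp_Q
        matrix_exp_P_plus_Q det_2 power2_eq_square)
  moreover have "det (factorization_map f x) = 1"
    using Cons by (auto simp: factorization_expression_def SL2_def)
  ultimately show ?case
    by (simp add: p factorization_map_def exp_product_def product_at_def SL2_def det_mul)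
qed

end

theory Submission
  imports Defs "HOL-Library.Sublist"
begin

text \<open>
A factorization is encoded as a word: a list of real exponents attached to the letters P, Q and
W, where W stands for P + Q and is charged twice its exponent. Since
exp(tW) = exp(zP) exp(sinh t Q) exp(zP) with z = tanh(t/2), and since 2z + sinh t = 2t + O(t^3),
cutting a factor exp(tW) into many pieces shows that words in P and Q come arbitrarily close to its
cost 2t (\<open>approximate_W\<close>). So the factorization cost of a matrix is the infimum of the costs of all
words for it, and a word attaining this infimum is an optimal factorization.

Optimal words exist and are short. Split a word into maximal blocks of equal sign. A product of
nonnegative factors has the form X^u W^s Y^v with X, Y among P and Q, at no larger cost than the
product itself (\<open>nonneg_normal_form\<close>): the cost of this form is given by explicit functions of the
matrix entries that grow at most at rate one along P and Q. Hence words with at most n blocks can be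
replaced by words with at most 3n letters, and by compactness there is a cheapest word with at most
n blocks for each matrix, and a shortest one among the cheapest (\<open>irreducible_word_exists\<close>).

Such an irreducible word is rigid. Every factor of it is again optimal under all changes that do not
create new blocks, so every deformation of a factor with a fixed product gives a condition. Four
letters in P and Q can be deformed along the curve on which the product of the two inner exponents
is constant (\<open>irr_window\<close>); this forces inner exponents of equal length. A letter between W and a
change of sign must have exponent sqrt 2 (\<open>irr_WQP\<close>). Second-order variations and explicit
replacements exclude longer words (\<open>irr_PQpqP\<close>, \<open>irr_PqPqPq\<close>, \<open>irr_PQp\<close>), and the
matrix K = exp(sqrt 2 Q) exp(- sqrt 2 P), which conjugates exp(sW) to exp(- sW), moves factors
exp(sW) through a word (\<open>K_intertwines\<close>). These are the conditions of the Pontryagin maximum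
principle for the underlying control problem, with W as its singular arc, obtained by hand.

The conditions exclude twelve sign patterns up to symmetry. A finite enumeration then shows that an
irreducible word has one of 32 patterns, up to changing all signs and exchanging P and Q, and none of
them has more than five blocks. So six blocks can always be reduced to five, by induction every word
can be reduced to five blocks, and a cheapest word among all words exists. The equations between its
exponents leave at most three free parameters and place it in one of 16 families; with the four
symmetries this makes 64.

In the names of facts about factors, a capital letter stands for a positive and a small letter for a
negative exponent, so that PQpq is the pattern of exp(aP) exp(bQ) exp(- cP) exp(- dQ) with a, b, c, d > 0.
\<close>

section \<open>Words in the one-parameter subgroups\<close>

datatype letter = LP | LQ | LW

type_synonym word = "(real \<times> letter) list"

definition mat22 :: "real \<Rightarrow> real \<Rightarrow> real \<Rightarrow> real \<Rightarrow> real^2^2" where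
  "mat22 a b c d = vector [vector [a, b], vector [c, d]]"

lemma mat22_nth [simp]:
  "mat22 a b c d $ 1 $ 1 = a" "mat22 a b c d $ 1 $ 2 = b"
  "mat22 a b c d $ 2 $ 1 = c" "mat22 a b c d $ 2 $ 2 = d"
  by (simp_all add: mat22_def)

lemma mat22_eq_iff [simp]:
  "mat22 a b c d = mat22 a' b' c' d' \<longleftrightarrow> a = a' \<and> b = b' \<and> c = c' \<and> d = d'"
  by (auto simp: vec_eq_iff forall_2)

lemma mat22_mult [simp]:
  "mat22 a b c d ** mat22 a' b' c' d'
    = mat22 (a * a' + b * c') (a * b' + b * d') (c * a' + d * c') (c * b' + d * d')"
  by (simp add: vec_eq_iff forall_2 matrix_matrix_mult_def sum_2)

lemma mat22_one: "mat 1 = mat22 1 0 0 1"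
  by (simp add: vec_eq_iff forall_2 mat_def)

lemma mat22_entries: "g = mat22 (g $ 1 $ 1) (g $ 1 $ 2) (g $ 2 $ 1) (g $ 2 $ 2)"
  by (simp add: vec_eq_iff forall_2)

lemma det_mat22 [simp]: "det (mat22 a b c d) = a * d - b * c"
  by (simp add: det_2)

fun gen :: "letter \<Rightarrow> real^2^2" where
  "gen LP = P" | "gen LQ = Q" | "gen LW = P + Q"

fun flow :: "letter \<Rightarrow> real \<Rightarrow> real^2^2" where
  "flow LP t = mat22 1 t 0 1"
| "flow LQ t = mat22 1 0 t 1"
| "flow LW t = mat22 (cosh t) (sinh t) (sinh t) (cosh t)"

lemma matrix_exp_gen: "matrix_exp (t *\<^sub>R gen L) = flow L t"
  by (cases L) (simp_all add: matrix_exp_P matrix_exp_Q matrix_exp_P_plus_Q mat22_def)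

fun rate :: "letter \<Rightarrow> real" where
  "rate LP = 1" | "rate LQ = 1" | "rate LW = 2"

lemma rate_pos: "0 < rate L"
  by (cases L) auto

fun wmat :: "word \<Rightarrow> real^2^2" where
  "wmat [] = mat22 1 0 0 1"
| "wmat ((t, L) # w) = flow L t ** wmat w"

fun cost :: "word \<Rightarrow> real" where
  "cost [] = 0"
| "cost ((t, L) # w) = rate L * \<bar>t\<bar> + cost w"

lemma one_mat22 [simp]: "mat22 1 0 0 1 ** g = g" "g ** mat22 1 0 0 1 = g"
  by (simp_all flip: mat22_one)

lemma wmat_append [simp]: "wmat (l @ r) = wmat l ** wmat r"
  by (induction l rule: wmat.induct) (simp_all add: matrix_mul_assoc)

lemma cost_append [simp]: "cost (l @ r) = cost l + cost r"
  by (induction l rule: cost.induct) simp_all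

lemma cost_nonneg: "0 \<le> cost w"
  by (induction w rule: cost.induct) (simp_all add: less_imp_le[OF rate_pos])

lemma det_wmat: "det (wmat w) = 1"
proof (induction w rule: wmat.induct)
  case (2 t L w)
  have "det (flow L t) = 1"
    using cosh_square_eq[of t] by (cases L) (simp_all add: power2_eq_square)
  then show ?case
    using 2 by (simp add: det_mul)
qed simp

lemma flow_zero: "flow L 0 = mat22 1 0 0 1"
  by (cases L) auto

lemma flow_add: "flow L s ** flow L t = flow L (s + t)"
  by (cases L) (simp_all add: cosh_add sinh_add algebra_simps)

section \<open>Sign profiles and irreducible words\<close>

definition signs :: "word \<Rightarrow> bool list" where
  "signs w = map (\<lambda>(t, L). 0 < t) (filter (\<lambda>(t, L). t \<noteq> 0) w)"

text \<open>
The signs of the maximal blocks of equal sign; its length is the number of blocks.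
\<close>

definition profile :: "word \<Rightarrow> bool list" where
  "profile w = remdups_adj (signs w)"

definition profile_le :: "word \<Rightarrow> word \<Rightarrow> bool" where
  "profile_le w' w \<longleftrightarrow> subseq (profile w') (profile w)"

text \<open>
Optimality is required only against words whose blocks form a subsequence of the blocks at hand.
With this restriction it passes to factors, and it can be achieved by minimizing over words with a
bounded number of blocks, before it is known that a cheapest word exists at all.
\<close>

definition irreducible :: "word \<Rightarrow> bool" where
  "irreducible w \<longleftrightarrow> (\<forall>w'. wmat w' = wmat w \<and> profile_le w' w \<longrightarrow>
     cost w < cost w' \<or> (cost w = cost w' \<and> length w \<le> length w'))"

lemma signs_simps [simp]:
  "signs [] = []"
  "signs ((t, L) # w) = (if t = 0 then signs w else (0 < t) # signs w)"
  "signs (l @ r) = signs l @ signs r"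
  by (simp_all add: signs_def)

lemma profile_le_refl [simp]: "profile_le w w"
  by (simp add: profile_le_def)

lemma profile_le_trans: "profile_le u v \<Longrightarrow> profile_le v w \<Longrightarrow> profile_le u w"
  by (auto simp: profile_le_def intro: subseq_order.trans)

lemma subseq_remdups_adj_self: "subseq (remdups_adj xs) xs"
  by (induction xs rule: remdups_adj.induct) auto

text \<open>
Adjacent entries of \<open>zs\<close> differ, so they are matched in different runs of \<open>ys\<close>.
\<close>

lemma subseq_distinct_adj_remdups_adj:
  assumes "subseq zs ys" "distinct_adj zs"
  shows "subseq zs (remdups_adj ys)"
  using assms
proof (induction ys arbitrary: zs rule: remdups_adj.induct)
  case (3 a b r)
  show ?case
  proof (cases "a = b")
    case True
    have "subseq zs (b # r)"
    proof (cases zs)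
      case (Cons z zs')
      show ?thesis
      proof (cases "z = a")
        case True
        with Cons "3.prems" \<open>a = b\<close> have zs': "subseq zs' (a # r)"
          by simp
        have "subseq zs' r"
        proof (cases zs')
          case (Cons z' zs'')
          with \<open>zs = z # zs'\<close> "3.prems" True have "z' \<noteq> a"
            by auto
          with zs' Cons show ?thesis
            by auto
        qed simp
        with Cons True \<open>a = b\<close> show ?thesis
          by simp
      next
        case False
        with Cons "3.prems" \<open>a = b\<close> show ?thesis
          by auto
      qed
    qed simp
    with 3 True show ?thesis
      by simp
  next
    case False
    show ?thesis
    proof (cases zs)
      case (Cons z zs')
      have "distinct_adj zs'"
        using "3.prems" Cons by (cases zs') auto
      with False 3 Cons show ?thesis
        by (cases "z = a") auto
    qed simp
  qed
qed (auto simp: list_emb_Nil2)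

lemma subseq_remdups_adj:
  "subseq xs ys \<Longrightarrow> subseq (remdups_adj xs) (remdups_adj ys)"
  by (rule subseq_distinct_adj_remdups_adj)
    (auto intro: subseq_order.trans[OF subseq_remdups_adj_self])

lemma remdups_adj_hd: "remdups_adj (x # xs) = (if xs \<noteq> [] \<and> hd xs = x then remdups_adj xs else x # remdups_adj xs)"
  by (cases xs) auto

lemma remdups_adj_absorb: "remdups_adj (xs @ remdups_adj ys) = remdups_adj (xs @ ys)"
proof (induction xs)
  case (Cons x xs)
  then show ?case
    by (cases "xs = []") (auto simp: remdups_adj_hd hd_append split: if_splits)
qed (simp flip: distinct_adj_altdef)

lemma remdups_adj_absorb_middle:
  "remdups_adj (xs @ remdups_adj ys @ zs) = remdups_adj (xs @ ys @ zs)"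
proof -
  have 1: "remdups_adj (remdups_adj ys @ zs) = remdups_adj (ys @ zs)"
    using remdups_adj_absorb[of "rev zs" "rev ys"]
    by (metis remdups_adj_rev rev_append rev_rev_ident)
  show ?thesis
    by (metis 1 remdups_adj_absorb)
qed

lemma profile_le_context:
  assumes "profile_le m' m"
  shows "profile_le (l @ m' @ r) (l @ m @ r)"
proof -
  have "subseq (signs l @ profile m' @ signs r) (signs l @ profile m @ signs r)"
    using assms by (intro list_emb_append_mono) (auto simp: profile_le_def)
  from subseq_remdups_adj[OF this] show ?thesis
    unfolding profile_le_def profile_def by (simp add: remdups_adj_absorb_middle)
qed

lemma irr_factor:
  assumes "irreducible (l @ m @ r)"
  shows "irreducible m"
  unfolding irreducible_def
proof (intro allI impI)
  fix m'
  assume "wmat m' = wmat m \<and> profile_le m' m"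
  then have "wmat (l @ m' @ r) = wmat (l @ m @ r)" "profile_le (l @ m' @ r) (l @ m @ r)"
    by (simp_all add: profile_le_context)
  with assms show "cost m < cost m' \<or> cost m = cost m' \<and> length m \<le> length m'"
    unfolding irreducible_def by fastforce
qed

lemma irr_cost:
  "irreducible w \<Longrightarrow> wmat w' = wmat w \<Longrightarrow> profile_le w' w \<Longrightarrow> cost w \<le> cost w'"
  unfolding irreducible_def by fastforce

lemma irr_length:
  "irreducible w \<Longrightarrow> wmat w' = wmat w \<Longrightarrow> profile_le w' w \<Longrightarrow> cost w' = cost w \<Longrightarrow> length w \<le> length w'"
  unfolding irreducible_def by fastforce

section \<open>Symmetries\<close>

definition negate :: "word \<Rightarrow> word" where
  "negate = map (\<lambda>(t, L). (- t, L))"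

fun swapL :: "letter \<Rightarrow> letter" where
  "swapL LP = LQ" | "swapL LQ = LP" | "swapL LW = LW"

definition swap :: "word \<Rightarrow> word" where
  "swap = map (\<lambda>(t, L). (t, swapL L))"

lemma negate_simps [simp]:
  "negate [] = []" "negate ((t, L) # w) = (- t, L) # negate w" "negate (l @ r) = negate l @ negate r"
  "negate (negate w) = w" "length (negate w) = length w" "negate (rev w) = rev (negate w)"
  by (auto simp: negate_def rev_map comp_def case_prod_unfold)

lemma swapL_swapL [simp]: "swapL (swapL L) = L"
  by (cases L) auto

lemma swap_simps [simp]:
  "swap [] = []" "swap ((t, L) # w) = (t, swapL L) # swap w" "swap (l @ r) = swap l @ swap r"
  "swap (swap w) = w" "length (swap w) = length w" "swap (rev w) = rev (swap w)"
  by (auto simp: swap_def rev_map comp_def case_prod_unfold)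

text \<open>
Conjugation by diag(1, - 1), which maps P and Q to - P and - Q.
\<close>

definition negM :: "real^2^2 \<Rightarrow> real^2^2" where
  "negM g = mat22 (g $ 1 $ 1) (- g $ 1 $ 2) (- g $ 2 $ 1) (g $ 2 $ 2)"

text \<open>
Conjugation by the permutation matrix, which exchanges P and Q.
\<close>

definition swapM :: "real^2^2 \<Rightarrow> real^2^2" where
  "swapM g = mat22 (g $ 2 $ 2) (g $ 2 $ 1) (g $ 1 $ 2) (g $ 1 $ 1)"

text \<open>
The antiautomorphism that fixes P and Q, and therefore reverses words.
\<close>

definition revM :: "real^2^2 \<Rightarrow> real^2^2" where
  "revM g = mat22 (g $ 2 $ 2) (g $ 1 $ 2) (g $ 2 $ 1) (g $ 1 $ 1)"

lemma mult_entry: "(g ** h) $ i $ j = g $ i $ 1 * h $ 1 $ j + g $ i $ 2 * h $ 2 $ j"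
  for g h :: "real^2^2"
  by (simp add: matrix_matrix_mult_def sum_2)

lemma negM_mult: "negM (g ** h) = negM g ** negM h"
  by (simp add: negM_def mult_entry)

lemma swapM_mult: "swapM (g ** h) = swapM g ** swapM h"
  by (simp add: swapM_def mult_entry algebra_simps)

lemma revM_mult: "revM (g ** h) = revM h ** revM g"
  by (simp add: revM_def mult_entry algebra_simps)

lemma wmat_negate [simp]: "wmat (negate w) = negM (wmat w)"
proof (induction w rule: wmat.induct)
  case (2 t L w)
  have "flow L (- t) = negM (flow L t)"
    by (cases L) (simp_all add: negM_def)
  with 2 show ?case
    by (simp add: negM_mult)
qed (simp add: negM_def)

lemma wmat_swap [simp]: "wmat (swap w) = swapM (wmat w)"
proof (induction w rule: wmat.induct)
  case (2 t L w)
  have "flow (swapL L) t = swapM (flow L t)"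
    by (cases L) (simp_all add: swapM_def)
  with 2 show ?case
    by (simp add: swapM_mult)
qed (simp add: swapM_def)

lemma wmat_rev [simp]: "wmat (rev w) = revM (wmat w)"
proof (induction w rule: wmat.induct)
  case (2 t L w)
  have "flow L t = revM (flow L t)"
    by (cases L) (simp_all add: revM_def)
  with 2 show ?case
    by (simp add: revM_mult)
qed (simp add: revM_def)

lemma negM_negM [simp]: "negM (negM g) = g"
  by (subst (3) mat22_entries) (simp add: negM_def)

lemma swapM_swapM [simp]: "swapM (swapM g) = g"
  by (subst (3) mat22_entries) (simp add: swapM_def)

lemma revM_revM [simp]: "revM (revM g) = g"
  by (subst (3) mat22_entries) (simp add: revM_def)

lemma cost_negate [simp]: "cost (negate w) = cost w"
  by (induction w rule: cost.induct) simp_all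

lemma cost_swap [simp]: "cost (swap w) = cost w"
proof (induction w rule: cost.induct)
  case (2 t L w)
  then show ?case
    by (cases L) simp_all
qed simp

lemma cost_rev [simp]: "cost (rev w) = cost w"
  by (induction w rule: cost.induct) simp_all

lemma signs_negate: "signs (negate w) = map Not (signs w)"
  by (induction w) auto

lemma signs_swap: "signs (swap w) = signs w"
  by (induction w) auto

lemma signs_rev: "signs (rev w) = rev (signs w)"
  by (simp add: signs_def rev_map rev_filter)

lemma subseq_map_Not: "subseq xs ys \<Longrightarrow> subseq (map Not xs) (map Not ys)"
  by (rule subseq_map)

lemma profile_le_negate: "profile_le u v \<Longrightarrow> profile_le (negate u) (negate v)"
  unfolding profile_le_def profile_def signs_negate
  by (simp add: remdups_adj_map_injective inj_on_def subseq_map_Not)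

lemma profile_le_swap: "profile_le u v \<Longrightarrow> profile_le (swap u) (swap v)"
  unfolding profile_le_def profile_def signs_swap .

lemma subseq_rev: "subseq xs ys \<Longrightarrow> subseq (rev xs) (rev ys)"
proof (induction rule: list_emb.induct)
  case (list_emb_Cons2 x y xs ys)
  then show ?case
    by (simp add: list_emb_append_mono)
qed (auto intro: subseq_rev_drop_many)

lemma profile_le_rev: "profile_le u v \<Longrightarrow> profile_le (rev u) (rev v)"
  unfolding profile_le_def profile_def signs_rev by (simp add: remdups_adj_rev subseq_rev)

lemma irr_neg: "irreducible w \<Longrightarrow> irreducible (negate w)"
  unfolding irreducible_def
  by (metis cost_negate profile_le_negate negM_negM negate_simps(4,5) wmat_negate)

lemma irr_swap: "irreducible w \<Longrightarrow> irreducible (swap w)"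
  unfolding irreducible_def
  by (metis cost_swap profile_le_swap swapM_swapM swap_simps(4,5) wmat_swap)

lemma irr_rev: "irreducible w \<Longrightarrow> irreducible (rev w)"
  unfolding irreducible_def
  by (metis cost_rev profile_le_rev revM_revM rev_rev_ident length_rev wmat_rev)

section \<open>Variations\<close>

lemma mat22_eq_pivot21:
  assumes "det g = det h" "g $ 2 $ 1 = h $ 2 $ 1" "h $ 2 $ 1 \<noteq> 0"
    "g $ 1 $ 1 = h $ 1 $ 1" "g $ 2 $ 2 = h $ 2 $ 2"
  shows "(g :: real^2^2) = h"
proof -
  have "h $ 1 $ 2 * h $ 2 $ 1 = g $ 1 $ 2 * h $ 2 $ 1"
    using assms by (simp add: det_2)
  with assms show ?thesis
    by (simp add: vec_eq_iff forall_2)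
qed

lemma mat22_eq_pivot22:
  assumes "det g = det h" "g $ 2 $ 2 = h $ 2 $ 2" "h $ 2 $ 2 \<noteq> 0"
    "g $ 1 $ 2 = h $ 1 $ 2" "g $ 2 $ 1 = h $ 2 $ 1"
  shows "(g :: real^2^2) = h"
proof -
  have "h $ 1 $ 1 * h $ 2 $ 2 = g $ 1 $ 1 * h $ 2 $ 2"
    using assms by (simp add: det_2)
  with assms show ?thesis
    by (simp add: vec_eq_iff forall_2)
qed

lemma mat22_eq_pivot11:
  assumes "det g = det h" "g $ 1 $ 1 = h $ 1 $ 1" "h $ 1 $ 1 \<noteq> 0"
    "g $ 1 $ 2 = h $ 1 $ 2" "g $ 2 $ 1 = h $ 2 $ 1"
  shows "(g :: real^2^2) = h"
proof -
  have "h $ 1 $ 1 * h $ 2 $ 2 = h $ 1 $ 1 * g $ 2 $ 2"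
    using assms by (simp add: det_2)
  with assms show ?thesis
    by (simp add: vec_eq_iff forall_2)
qed

lemma mat22_eq_pivot12:
  assumes "det g = det h" "g $ 1 $ 2 = h $ 1 $ 2" "h $ 1 $ 2 \<noteq> 0"
    "g $ 1 $ 1 = h $ 1 $ 1" "g $ 2 $ 2 = h $ 2 $ 2"
  shows "(g :: real^2^2) = h"
proof -
  have "h $ 1 $ 2 * h $ 2 $ 1 = h $ 1 $ 2 * g $ 2 $ 1"
    using assms by (simp add: det_2)
  with assms show ?thesis
    by (simp add: vec_eq_iff forall_2)
qed

lemma ev_pos: "isCont f x \<Longrightarrow> 0 < f x \<Longrightarrow> \<forall>\<^sub>F y in nhds x. 0 < (f y :: real)"
  for x :: real
  using order_tendstoD(1)[of f "f x" "nhds x" 0]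
  by (simp add: isCont_def tendsto_at_iff_tendsto_nhds)

lemma stationary:
  fixes F :: "real \<Rightarrow> real"
  assumes "(F has_real_derivative D) (at x)" "\<forall>\<^sub>F y in nhds x. F x \<le> F y"
  shows "D = 0"
proof -
  obtain d where "d > 0" "\<forall>y. dist y x < d \<longrightarrow> F x \<le> F y"
    using assms(2) by (auto simp: eventually_nhds_metric)
  with DERIV_local_min[OF assms(1), of d] show ?thesis
    by (auto simp: dist_real_def abs_minus_commute)
qed

lemma ev_less_right:
  fixes F :: "real \<Rightarrow> real"
  assumes "(F has_real_derivative D) (at x)" "D < 0"
  shows "\<forall>\<^sub>F y in at_right x. F y < F x"
proof -
  obtain d where d: "d > 0" "\<And>h. 0 < h \<Longrightarrow> h < d \<Longrightarrow> F (x + h) < F x"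
    using DERIV_neg_dec_right[OF assms] by blast
  have "F y < F x" if "x < y" "y < x + d" for y
    using d(2)[of "y - x"] that by simp
  with d(1) show ?thesis
    by (auto simp: eventually_at_right_field intro!: exI[of _ "x + d"])
qed

lemma ev_at_right: "\<forall>\<^sub>F y in nhds x. R y \<Longrightarrow> \<forall>\<^sub>F y in at_right (x::real). R y"
  by (auto simp: eventually_at_filter elim: eventually_mono)

lemma pos_mult_sign:
  fixes s x :: real
  assumes "0 < s * x" "\<bar>s\<bar> = 1"
  shows "x \<noteq> 0" "0 < x \<longleftrightarrow> 0 < s" "\<bar>x\<bar> = s * x"
  using assms by (auto simp: zero_less_mult_iff abs_if split: if_splits)

lemma profile_le_signs: "signs w' = signs w \<Longrightarrow> profile_le w' w"
  by (simp add: profile_le_def profile_def)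

section \<open>First-order conditions on short factors\<close>

lemma irr_cancel:
  assumes "irreducible [(a, L), (b, L)]"
  shows "\<not> a * b < 0"
proof
  assume ab: "a * b < 0"
  have "cost [(a, L), (b, L)] \<le> cost [(a + b, L)]"
  proof (rule irr_cost[OF assms])
    show "wmat [(a + b, L)] = wmat [(a, L), (b, L)]"
      using flow_add[of L a b] by (simp add: matrix_mul_assoc)
    show "profile_le [(a + b, L)] [(a, L), (b, L)]"
      using ab by (auto simp: profile_le_def profile_def mult_less_0_iff)
  qed
  then have "rate L * (\<bar>a\<bar> + \<bar>b\<bar>) \<le> rate L * \<bar>a + b\<bar>"
    by (simp add: algebra_simps)
  with rate_pos[of L] have "\<bar>a\<bar> + \<bar>b\<bar> \<le> \<bar>a + b\<bar>"
    by simp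
  with ab show False
    by (auto simp: mult_less_0_iff)
qed

lemma tanh_half:
  fixes t :: real
  shows "tanh (t / 2) * sinh t = cosh t - 1" "tanh (t / 2) * (1 + cosh t) = sinh t"
proof -
  have c: "cosh t = 2 * cosh (t / 2) ^ 2 - 1" "sinh t = 2 * sinh (t / 2) * cosh (t / 2)"
    using cosh_double_cosh[of "t / 2"] sinh_double[of "t / 2"] by simp_all
  have p: "cosh (t / 2) \<noteq> 0"
    by simp
  show "tanh (t / 2) * sinh t = cosh t - 1"
    using p cosh_square_eq[of "t / 2"] by (simp add: c tanh_def field_simps power2_eq_square)
  show "tanh (t / 2) * (1 + cosh t) = sinh t"
    using p by (simp add: c tanh_def field_simps power2_eq_square)
qed

lemma W_as_PQP: "flow LP (tanh (t / 2)) ** (flow LQ (sinh t) ** flow LP (tanh (t / 2))) = flow LW t"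
  using tanh_half[of t] by (simp add: algebra_simps)

text \<open>
A small piece exp(hW) before exp(- bP) can be written as exp(zP) exp(sinh h Q) exp(zP). Its last factor
cancels against exp(- bP), which leaves the cost sinh h instead of 2h.
\<close>

lemma irr_WP_opposite:
  assumes "irreducible [(s, LW), (- b, LP)]" "0 < s" "0 < b"
  shows False
proof -
  have "((\<lambda>h. sinh h - 2 * h) has_real_derivative (cosh 0 - 2)) (at 0)"
    by (auto intro!: derivative_eq_intros)
  from ev_less_right[OF this] have 1: "\<forall>\<^sub>F h in at_right 0. sinh h < 2 * (h::real)"
    by simp
  have 2: "\<forall>\<^sub>F h in at_right 0. 0 < b - tanh (h / 2)"
    by (rule ev_at_right, rule ev_pos) (use assms in \<open>auto intro!: continuous_intros\<close>)
  have 3: "\<forall>\<^sub>F h in at_right 0. 0 < s - h"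
    by (rule ev_at_right, rule ev_pos) (use assms in \<open>auto intro!: continuous_intros\<close>)
  have 4: "\<forall>\<^sub>F h in at_right 0. 0 < (h::real)"
    by (simp add: eventually_at_right_less)
  have "\<forall>\<^sub>F h in at_right 0. sinh h < 2 * h \<and> 0 < b - tanh (h / 2) \<and> 0 < s - h \<and> 0 < (h::real)"
    using 1 2 3 4 by eventually_elim auto
  from eventually_happens'[OF trivial_limit_at_right_real this]
  obtain h where h: "sinh h < 2 * h" "tanh (h / 2) < b" "h < s" "0 < h"
    by auto
  define z where "z = tanh (h / 2)"
  have z: "0 < z"
    using h by (simp add: z_def)
  let ?w = "[(s - h, LW), (z, LP), (sinh h, LQ), (z - b, LP)]"
  have "wmat ?w = flow LW (s - h) ** (flow LP z ** (flow LQ (sinh h) ** flow LP z)) ** flow LP (- b)"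
    unfolding wmat.simps one_mat22 matrix_mul_assoc[symmetric] flow_add by simp
  also have "\<dots> = wmat [(s, LW), (- b, LP)]"
    unfolding z_def W_as_PQP flow_add by simp
  finally have "cost [(s, LW), (- b, LP)] \<le> cost ?w"
    using assms h z by (intro irr_cost[OF assms(1)]) (auto simp: profile_le_def profile_def z_def)
  then show False
    using assms h z by (simp add: z_def)
qed

text \<open>
The variation behind \<open>irr_WQP\<close>. With p = cosh, q = sinh and k = 1 the three equations say that
exp(al P) exp(tW) exp(v' Q) = exp(sW) exp(vQ) exp(ta P); with p = sinh, q = cosh and k = - 1 they say this
with exp(al Q) in place of exp(al P). They determine v', al and ta from t, and the derivative of
al + 2 t + v' + ta at t = s is q s (2 - v^2) / (q s + p s v). So the cost decreases as t moves from s in the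
direction of - k, and this is also the direction in which al becomes positive.
\<close>

lemma WQP_descent:
  fixes p q :: "real \<Rightarrow> real" and s v b k :: real
  assumes p': "\<And>t. (p has_real_derivative q t) (at t)" and q': "\<And>t. (q has_real_derivative p t) (at t)"
    and pq: "\<And>t. p t * p t = k + q t * q t" and k: "k * k = 1" "0 < k * (2 - v * v)"
    and pos: "0 < s" "0 < p s" "0 < q s" "0 < v" "0 < b"
  shows "\<exists>t al v' ta. 0 < al \<and> 0 < t \<and> 0 < v' \<and> 0 < b + ta \<and> al + 2 * t + v' + ta < 2 * s + v
    \<and> q t + p t * v' = q s + p s * v \<and> al * (q s + p s * v) = p s + q s * v - (p t + q t * v')
    \<and> (q s + p s * v) * ta = p t - p s"
proof -
  define r where "r = q s + p s * v"
  have r: "0 < r"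
    using pos by (simp add: r_def add_pos_pos)
  define V where "V e = (r - q (s - k * e)) / p (s - k * e)" for e
  define al where "al e = (p s + q s * v - (p (s - k * e) + q (s - k * e) * V e)) / r" for e
  define ta where "ta e = (p (s - k * e) - p s) / r" for e
  define F where "F e = al e + 2 * (s - k * e) + V e + ta e" for e
  have at_0: "V 0 = v" "al 0 = 0" "ta 0 = 0"
    using r pos by (simp_all add: V_def al_def ta_def) (simp_all add: r_def)
  have dP: "((\<lambda>e. p (s - k * e)) has_real_derivative - k * q s) (at 0)"
    by (rule DERIV_chain'[OF _ p', THEN DERIV_cong]) (auto intro!: derivative_eq_intros)
  have dQ: "((\<lambda>e. q (s - k * e)) has_real_derivative - k * p s) (at 0)"
    by (rule DERIV_chain'[OF _ q', THEN DERIV_cong]) (auto intro!: derivative_eq_intros)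
  have dV: "(V has_real_derivative k * (p s + q s * v) / p s) (at 0)"
    unfolding V_def by (rule DERIV_divide[OF DERIV_diff[OF DERIV_const dQ] dP, THEN DERIV_cong])
      (use pos in \<open>simp_all add: r_def field_simps\<close>)
  have "(al has_real_derivative (k * q s + k * p s * v - q s * (k * (p s + q s * v) / p s)) / r) (at 0)"
    unfolding al_def
    by (rule DERIV_cdivide[OF DERIV_diff[OF DERIV_const DERIV_add[OF dP DERIV_mult[OF dQ dV]]], THEN DERIV_cong])
      (simp add: at_0)
  moreover have "k * q s + k * p s * v - q s * (k * (p s + q s * v) / p s) = v / p s"
  proof -
    have "(k * q s + k * p s * v) * p s - q s * (k * (p s + q s * v)) = v"
      using pq[of s] k(1) by algebra
    then show ?thesis
      using pos by (simp add: field_simps)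
  qed
  ultimately have dal: "(al has_real_derivative v / p s / r) (at 0)"
    by simp
  have dta: "(ta has_real_derivative - k * q s / r) (at 0)"
    unfolding ta_def by (rule DERIV_cdivide[OF DERIV_diff[OF dP DERIV_const], THEN DERIV_cong]) simp
  have "(F has_real_derivative v / p s / r + - 2 * k + k * (p s + q s * v) / p s + - k * q s / r) (at 0)"
    unfolding F_def by (rule derivative_eq_intros dal dV dta refl)+ simp
  moreover have "v / p s / r + - 2 * k + k * (p s + q s * v) / p s + - k * q s / r = - (k * (2 - v * v)) * (q s / r)"
  proof -
    have "v - 2 * k * p s * r + k * (p s + q s * v) * r - k * q s * p s = - (k * (2 - v * v)) * q s * p s"
      using pq[of s] k(1) r_def by algebra
    moreover have "v / p s / r + - 2 * k + k * (p s + q s * v) / p s + - k * q s / r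
        = (v - 2 * k * p s * r + k * (p s + q s * v) * r - k * q s * p s) / (p s * r)"
      using pos r by (simp add: field_simps)
    ultimately show ?thesis
      using pos r by simp
  qed
  ultimately have dF: "(F has_real_derivative - (k * (2 - v * v)) * (q s / r)) (at 0)"
    by simp
  have "- (k * (2 - v * v)) * (q s / r) < 0"
    using k pos r by (simp add: mult_neg_pos)
  then have 1: "\<forall>\<^sub>F e in at_right 0. F e < F 0"
    by (rule ev_less_right[OF dF])
  have 2: "\<forall>\<^sub>F e in at_right 0. 0 < al e"
    using ev_less_right[OF DERIV_minus[OF dal]] pos r at_0 by simp
  have 3: "\<forall>\<^sub>F e in at_right 0. 0 < V e"
    by (rule ev_at_right, rule ev_pos) (use DERIV_isCont[OF dV] at_0 pos in auto)
  have 4: "\<forall>\<^sub>F e in at_right 0. 0 < s - k * e"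
    by (rule ev_at_right, rule ev_pos) (use pos in auto)
  have 5: "\<forall>\<^sub>F e in at_right 0. 0 < b + ta e"
    by (rule ev_at_right, rule ev_pos) (use DERIV_isCont[OF dta] at_0 pos in \<open>auto intro!: continuous_intros\<close>)
  have 6: "\<forall>\<^sub>F e in at_right 0. 0 < p (s - k * e)"
    by (rule ev_at_right, rule ev_pos) (use DERIV_isCont[OF dP] pos in auto)
  have "\<forall>\<^sub>F e in at_right 0. F e < F 0 \<and> 0 < al e \<and> 0 < V e \<and> 0 < s - k * e \<and> 0 < b + ta e \<and> 0 < p (s - k * e)"
    using 1 2 3 4 5 6 by eventually_elim auto
  from eventually_happens'[OF trivial_limit_at_right_real this]
  obtain e where e: "F e < F 0" "0 < al e" "0 < V e" "0 < s - k * e" "0 < b + ta e" "0 < p (s - k * e)"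
    by auto
  have "q (s - k * e) + p (s - k * e) * V e = r" "al e * r = p s + q s * v - (p (s - k * e) + q (s - k * e) * V e)"
    "r * ta e = p (s - k * e) - p s"
    using e(6) r by (simp_all add: V_def al_def ta_def)
  with e show ?thesis
    unfolding r_def[symmetric]
    by (intro exI[of _ "s - k * e"] exI[of _ "al e"] exI[of _ "V e"] exI[of _ "ta e"]) (simp add: F_def at_0)
qed

text \<open>
If v is not sqrt 2, the cost is lowered by changing s and inserting a new letter on the left: P if
v < sqrt 2 and Q if v > sqrt 2.
\<close>

lemma irr_WQP:
  assumes irreducible: "irreducible [(s, LW), (v, LQ), (- b, LP)]" and pos: "0 < s" "0 < v" "0 < b"
  shows "v = sqrt 2"
proof (rule ccontr)
  assume "v \<noteq> sqrt 2"
  let ?w = "[(s, LW), (v, LQ), (- b, LP)]"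
  have CS: "cosh t * cosh t = 1 + sinh t * sinh t" for t :: real
    using cosh_square_eq[of t] by (simp add: power2_eq_square)
  have S: "0 < sinh s"
    using pos by simp
  have d: "(cosh has_real_derivative sinh t) (at t)" "(sinh has_real_derivative cosh t) (at t)" for t :: real
    by (auto intro!: derivative_eq_intros)
  have *: False
    if t: "0 < al" "0 < t" "0 < v'" "0 < b + ta" "al + 2 * t + v' + ta < 2 * s + v" "L \<in> {LP, LQ}"
      and m: "wmat [(al, L), (t, LW), (v', LQ)] = wmat [(s, LW), (v, LQ), (ta, LP)]" for t al v' ta L
  proof -
    have "wmat ([(al, L), (t, LW), (v', LQ)] @ [(- (b + ta), LP)])
        = wmat ([(s, LW), (v, LQ), (ta, LP)] @ [(- (b + ta), LP)])"
      unfolding wmat_append m ..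
    moreover have "ta + - (b + ta) = - b"
      by simp
    ultimately have "wmat [(al, L), (t, LW), (v', LQ), (- (b + ta), LP)] = wmat ?w"
      by (simp only: append.simps wmat.simps one_mat22 flow_add)
    then have "cost ?w \<le> cost [(al, L), (t, LW), (v', LQ), (- (b + ta), LP)]"
      by (rule irr_cost[OF irreducible]) (use t pos in \<open>auto simp: profile_le_def profile_def\<close>)
    with t pos show False
      by auto
  qed
  consider "v < sqrt 2" | "sqrt 2 < v"
    using \<open>v \<noteq> sqrt 2\<close> by linarith
  then show False
  proof cases
    case 1
    then have "0 < 1 * (2 - v * v)"
      using pos mult_strict_mono[of v "sqrt 2" v "sqrt 2"] by simp
    from WQP_descent[of cosh sinh 1 v s b, OF d CS _ this] S pos obtain t al v' ta
      where t: "0 < al" "0 < t" "0 < v'" "0 < b + ta" "al + 2 * t + v' + ta < 2 * s + v"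
        "sinh t + cosh t * v' = sinh s + cosh s * v"
        "al * (sinh s + cosh s * v) = cosh s + sinh s * v - (cosh t + sinh t * v')"
        "(sinh s + cosh s * v) * ta = cosh t - cosh s"
      by auto
    have "0 < sinh s + cosh s * v"
      using S pos by (simp add: add_pos_pos)
    then show False
      by (intro *[OF t(1-5), of LP] mat22_eq_pivot21, simp_all only: det_wmat)
        (use t(6-8) in \<open>simp_all add: algebra_simps\<close>)
  next
    case 2
    then have "0 < - 1 * (2 - v * v)"
      using pos mult_strict_mono[of "sqrt 2" v "sqrt 2" v] by simp
    from WQP_descent[of sinh cosh "- 1" v s b, OF d(2,1) _ _ this] S pos obtain t al v' ta
      where t: "0 < al" "0 < t" "0 < v'" "0 < b + ta" "al + 2 * t + v' + ta < 2 * s + v"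
        "cosh t + sinh t * v' = cosh s + sinh s * v"
        "al * (cosh s + sinh s * v) = sinh s + cosh s * v - (sinh t + cosh t * v')"
        "(cosh s + sinh s * v) * ta = sinh t - sinh s"
      by (auto simp: CS)
    have "0 < cosh s + sinh s * v"
      using S pos by (simp add: add_pos_pos)
    then show False
      by (intro *[OF t(1-5), of LQ] mat22_eq_pivot11, simp_all only: det_wmat)
        (use t(6-8) in \<open>simp_all add: algebra_simps\<close>)
  qed
qed

text \<open>
The product exp(al P) exp(xi Q) exp(et P) exp(be Q) has lower right entry d = 1 + xi et. For d \<noteq> 0 it
does not change when xi is multiplied by l, et is divided by l, and al + et / d and be + xi / d are kept;
the condition says that the cost is stationary at l = 1.
\<close>

lemma irr_window:
  assumes irreducible: "irreducible [(al, LP), (xi, LQ), (et, LP), (be, LQ)]"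
    and sa: "\<bar>sa\<bar> = 1" "0 < sa * al" and sb: "\<bar>sb\<bar> = 1" "0 < sb * be"
    and nz: "xi \<noteq> 0" "et \<noteq> 0" and d: "1 + xi * et \<noteq> 0"
  shows "(1 + xi * et) * (\<bar>xi\<bar> - \<bar>et\<bar>) + sa * et - sb * xi = 0"
proof -
  define d where "d = 1 + xi * et"
  define a' where "a' l = al + (et - et / l) / d" for l
  define b' where "b' l = be + (xi - xi * l) / d" for l
  define F where "F l = sa * a' l + \<bar>xi\<bar> * l + \<bar>et\<bar> / l + sb * b' l" for l
  have d0: "d \<noteq> 0"
    using d by (simp add: d_def)
  have "(F has_real_derivative (\<bar>xi\<bar> - \<bar>et\<bar> + sa * et / d - sb * xi / d)) (at 1)"
    unfolding F_def a'_def b'_def using d0 by (auto intro!: derivative_eq_intros simp: mult_ac)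
  moreover have "\<forall>\<^sub>F l in nhds 1. F 1 \<le> F l"
  proof -
    have 1: "\<forall>\<^sub>F l in nhds 1. 0 < sa * a' l"
      by (rule ev_pos) (use d0 sa in \<open>auto intro!: continuous_intros simp: a'_def\<close>)
    have 2: "\<forall>\<^sub>F l in nhds 1. 0 < sb * b' l"
      by (rule ev_pos) (use d0 sb in \<open>auto intro!: continuous_intros simp: b'_def\<close>)
    have 3: "\<forall>\<^sub>F l in nhds 1. 0 < (l::real)"
      by (rule ev_pos) auto
    show ?thesis
      using 1 2 3
    proof eventually_elim
      case (elim l)
      let ?w = "[(al, LP), (xi, LQ), (et, LP), (be, LQ)]"
      let ?w' = "[(a' l, LP), (xi * l, LQ), (et / l, LP), (b' l, LQ)]"
      have "wmat ?w' = wmat ?w"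
        by (rule mat22_eq_pivot22, simp only: det_wmat)
          (use elim d0 in \<open>simp_all add: a'_def b'_def d_def[symmetric] field_simps, simp_all add: d_def algebra_simps\<close>)
      moreover have "profile_le ?w' ?w"
        using elim nz pos_mult_sign[OF sa(2,1)] pos_mult_sign[OF sb(2,1)]
          pos_mult_sign[OF elim(1) sa(1)] pos_mult_sign[OF elim(2) sb(1)]
        by (intro profile_le_signs) (simp add: zero_less_mult_iff zero_less_divide_iff)
      ultimately have "cost ?w \<le> cost ?w'"
        by (rule irr_cost[OF irreducible])
      moreover note pos_mult_sign(3)[OF sa(2,1)] pos_mult_sign(3)[OF sb(2,1)]
        pos_mult_sign(3)[OF elim(1) sa(1)] pos_mult_sign(3)[OF elim(2) sb(1)]
      ultimately show ?case
        using elim d0 by (simp add: F_def a'_def b'_def abs_mult)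
    qed
  qed
  ultimately have "\<bar>xi\<bar> - \<bar>et\<bar> + sa * et / d - sb * xi / d = 0"
    by (rule stationary)
  moreover have "d * (\<bar>xi\<bar> - \<bar>et\<bar> + sa * et / d - sb * xi / d)
      = d * (\<bar>xi\<bar> - \<bar>et\<bar>) + sa * et - sb * xi"
    using d0 by (simp add: algebra_simps)
  ultimately show ?thesis
    by (simp add: d_def)
qed

text \<open>
For xi et = - 1 only al xi + be et is determined by the product.
\<close>

lemma irr_window_degenerate:
  assumes irreducible: "irreducible [(al, LP), (xi, LQ), (et, LP), (be, LQ)]"
    and sa: "\<bar>sa\<bar> = 1" "0 < sa * al" and sb: "\<bar>sb\<bar> = 1" "0 < sb * be"
    and d: "1 + xi * et = 0"
  shows "sa + sb * xi\<^sup>2 = 0"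
proof -
  define a' where "a' t = al + t" for t
  define b' where "b' t = be + t * xi\<^sup>2" for t
  define F where "F t = sa * a' t + sb * b' t" for t
  have nz: "xi \<noteq> 0" "et \<noteq> 0"
    using d by auto
  have "et * xi = - 1"
    using d by (simp add: algebra_simps eq_neg_iff_add_eq_0)
  then have et: "et = - 1 / xi"
    using nz by (metis nonzero_eq_divide_eq)
  have "(F has_real_derivative (sa + sb * xi\<^sup>2)) (at 0)"
    unfolding F_def a'_def b'_def by (auto intro!: derivative_eq_intros)
  moreover have "\<forall>\<^sub>F t in nhds 0. F 0 \<le> F t"
  proof -
    have 1: "\<forall>\<^sub>F t in nhds 0. 0 < sa * a' t"
      by (rule ev_pos) (use sa in \<open>auto intro!: continuous_intros simp: a'_def\<close>)
    have 2: "\<forall>\<^sub>F t in nhds 0. 0 < sb * b' t"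
      by (rule ev_pos) (use sb in \<open>auto intro!: continuous_intros simp: b'_def\<close>)
    show ?thesis
      using 1 2
    proof eventually_elim
      case (elim t)
      let ?w = "[(al, LP), (xi, LQ), (et, LP), (be, LQ)]"
      let ?w' = "[(a' t, LP), (xi, LQ), (et, LP), (b' t, LQ)]"
      have "wmat ?w' = wmat ?w"
        using nz by (simp add: a'_def b'_def et field_simps power2_eq_square)
      moreover have "profile_le ?w' ?w"
        using elim nz pos_mult_sign[OF sa(2,1)] pos_mult_sign[OF sb(2,1)]
          pos_mult_sign[OF elim(1) sa(1)] pos_mult_sign[OF elim(2) sb(1)]
        by (intro profile_le_signs) simp
      ultimately have "cost ?w \<le> cost ?w'"
        by (rule irr_cost[OF irreducible])
      moreover note pos_mult_sign(3)[OF sa(2,1)] pos_mult_sign(3)[OF sb(2,1)]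
        pos_mult_sign(3)[OF elim(1) sa(1)] pos_mult_sign(3)[OF elim(2) sb(1)]
      ultimately show ?case
        by (simp add: F_def a'_def b'_def)
    qed
  qed
  ultimately show ?thesis
    by (rule stationary)
qed

section \<open>Replacements that lower the cost\<close>

definition improvable :: "word \<Rightarrow> bool" where
  "improvable m \<longleftrightarrow> (\<exists>m'. wmat m' = wmat m \<and> profile_le m' m \<and> cost m' < cost m)"

lemma not_irr_if_improvable:
  assumes "irreducible w" "wmat (l @ m @ r) = wmat w" "profile_le (l @ m @ r) w" "cost (l @ m @ r) \<le> cost w"
  shows "\<not> improvable m"
proof
  assume "improvable m"
  then obtain m' where m': "wmat m' = wmat m" "profile_le m' m" "cost m' < cost m"
    by (auto simp: improvable_def)
  have "cost w \<le> cost (l @ m' @ r)"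
    using m' assms(2) by (intro irr_cost[OF assms(1)] profile_le_trans[OF profile_le_context assms(3)]) simp_all
  with m' assms(4) show False
    by simp
qed

lemma not_improvable: "irreducible m \<Longrightarrow> \<not> improvable m"
  using not_irr_if_improvable[of m "[]" m "[]"] by simp

lemma improvable_context: "improvable m \<Longrightarrow> improvable (l @ m @ r)"
proof -
  assume "improvable m"
  then obtain m' where "wmat m' = wmat m" "profile_le m' m" "cost m' < cost m"
    by (auto simp: improvable_def)
  then have "wmat (l @ m' @ r) = wmat (l @ m @ r)" "profile_le (l @ m' @ r) (l @ m @ r)"
    "cost (l @ m' @ r) < cost (l @ m @ r)"
    by (simp_all add: profile_le_context)
  then show ?thesis
    unfolding improvable_def by blast
qed

text \<open>
The product is also of the form exp(y' Q) exp(- q P) exp(- w Q) exp(- x2 P), for every q and w with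
q w = a y; this is the product of a positive and a negative block as before, as long as x2 \<ge> 0.
The choice q^2 = 2 + a y minimizes the cost, and the gain is a positive multiple of (q - y)^2.
\<close>

lemma PQp_improvable_generic:
  assumes pos: "0 < a" "0 < y" "0 < x" and neq: "y * y \<noteq> 2 + a * y"
    and x: "a + sqrt (2 + a * y) \<le> x * (1 + a * y)"
  shows "improvable [(a, LP), (y, LQ), (- x, LP)]"
proof -
  define m where "m = a * y"
  define q where "q = sqrt (2 + m)"
  define w where "w = m / q"
  \<comment> \<open>the upper left entry of the product\<close>
  define p where "p = 1 + m"
  define y' where "y' = (y + w) / p"
  define x2 where "x2 = (x * p - a - q) / p"
  have m: "0 < m" and p: "0 < p" and q: "0 < q" and qq: "q * q = 2 + m"
    using pos by (simp_all add: m_def p_def q_def add_pos_pos)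
  have w: "0 < w" and wq: "w * q = m"
    using m q by (simp_all add: w_def)
  have y': "0 < y'" and yp: "y' * p = y + w"
    using pos w p by (simp_all add: y'_def)
  have x2: "0 \<le> x2" and xp: "x2 * p = x * p - a - q"
    using x p by (simp_all add: x2_def q_def p_def m_def)
  let ?w = "[(a, LP), (y, LQ), (- x, LP)]"
  let ?w' = "[(y', LQ), (- q, LP), (- w, LQ), (- x2, LP)]"
  have "wmat ?w' = wmat ?w"
  proof (rule mat22_eq_pivot11, simp only: det_wmat)
    show "wmat ?w' $ 1 $ 1 = wmat ?w $ 1 $ 1"
      using wq by (simp add: m_def mult.commute)
    show "wmat ?w $ 1 $ 1 \<noteq> 0"
      using m by (simp add: m_def)
    have "wmat ?w' $ 1 $ 2 = - (q + x2 * (1 + w * q))"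
      by (simp add: algebra_simps)
    also have "\<dots> = - (q + x2 * p)"
      by (simp only: wq p_def)
    also have "\<dots> = - (x * p - a)"
      by (simp add: xp)
    finally show "wmat ?w' $ 1 $ 2 = wmat ?w $ 1 $ 2"
      by (simp add: p_def m_def algebra_simps)
    have "wmat ?w' $ 2 $ 1 = y' * (1 + w * q) - w"
      by (simp add: algebra_simps)
    also have "\<dots> = y"
      using yp by (simp add: wq p_def)
    finally show "wmat ?w' $ 2 $ 1 = wmat ?w $ 2 $ 1"
      by simp
  qed
  moreover have "profile_le ?w' ?w"
    using pos y' q w x2 by (auto simp: profile_le_def profile_def)
  moreover have "cost ?w' < cost ?w"
  proof -
    have "q \<noteq> y"
      using neq qq by (auto simp: m_def)
    then have "0 < (q - y) * (q - y)"
      by (simp add: zero_less_mult_iff) linarith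
    then have "0 < a * ((q - y) * (q - y))"
      using pos by simp
    also have "a * ((q - y) * (q - y)) = a * (q * q) + m * y - 2 * m * q"
      by (simp add: m_def algebra_simps)
    also have "2 * m * q = 2 * w + m * (q + w)"
      using qq wq by algebra
    finally have "2 * w + m * (q + w) < a * (2 + m) + m * y"
      by (simp add: qq)
    then have "(y' + q + w + x2) * p < (a + y + x) * p"
      using yp xp by (simp add: p_def algebra_simps)
    then have "y' + q + w + x2 < a + y + x"
      using p by simp
    then show ?thesis
      using pos y' q w x2 by simp
  qed
  ultimately show ?thesis
    unfolding improvable_def by blast
qed

text \<open>
If y^2 = 2 + a y, the generic case applies to the second half of exp(aP).
\<close>

lemma PQp_improvable:
  assumes pos: "0 < a" "0 < y" and x: "sqrt 2 \<le> x" "2 \<le> x * y"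
  shows "improvable [(a, LP), (y, LQ), (- x, LP)]"
proof -
  have x0: "0 < x"
    using x(1) real_sqrt_gt_zero[of 2] by linarith
  have *: "improvable [(a', LP), (y, LQ), (- x, LP)]" if a': "0 < a'" "y * y \<noteq> 2 + a' * y" for a'
  proof (rule PQp_improvable_generic)
    have s: "sqrt 2 * sqrt 2 = 2" "0 < sqrt 2"
      by simp_all
    have "2 + a' * y \<le> (sqrt 2 + sqrt 2 / 2 * (a' * y))\<^sup>2"
      using s a' pos by (simp add: power2_eq_square algebra_simps)
    then have "sqrt (2 + a' * y) \<le> sqrt 2 + sqrt 2 / 2 * (a' * y)"
      using s a' pos by (intro real_le_lsqrt) simp_all
    moreover have "a' * 2 \<le> a' * (x * y)" "sqrt 2 * (a' * y) \<le> x * (a' * y)"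
      using x a' pos by (simp_all add: mult_right_mono)
    ultimately show "a' + sqrt (2 + a' * y) \<le> x * (1 + a' * y)"
      using x(1) by (simp add: algebra_simps)
  qed (use pos x0 that in auto)
  show ?thesis
  proof (cases "y * y = 2 + a * y")
    case True
    then have "improvable [(a / 2, LP), (y, LQ), (- x, LP)]"
      using pos by (intro *) auto
    from improvable_context[OF this, of "[(a / 2, LP)]" "[]"]
    have "improvable [(a / 2, LP), (a / 2, LP), (y, LQ), (- x, LP)]"
      by simp
    then show ?thesis
      using pos unfolding improvable_def
      by (simp add: profile_le_def profile_def algebra_simps)
  qed (use * pos in blast)
qed

lemma irr_PQp:
  "irreducible [(a, LP), (y, LQ), (- x, LP)] \<Longrightarrow> 0 < a \<Longrightarrow> 0 < y \<Longrightarrow> sqrt 2 \<le> x \<Longrightarrow> 2 \<le> x * y \<Longrightarrow> False"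
  using PQp_improvable not_improvable by blast

text \<open>
The exponent s of W is moved by t, and the other three exponents follow. In terms of x and of the lower
right entry d = 1 - x y of the remaining product, the move is a hyperbolic rotation by t.
\<close>

lemma irr_shift:
  assumes irreducible: "irreducible [(s, LW), (y, LQ), (- x, LP), (be, LQ)]" and pos: "0 < s" "0 < y" "0 < x"
    and sb: "\<bar>sb\<bar> = 1" "0 < sb * be"
  shows "x + x * (1 - x * y) - y * (1 - x * y) + sb * y = 0"
proof -
  define d where "d = 1 - x * y"
  define X where "X t = cosh t * x + sinh t * d" for t
  define D where "D t = cosh t * d + sinh t * x" for t
  define Y where "Y t = (1 - D t) / X t" for t
  define B where "B t = be + (1 - cosh t + sinh t * y) / X t" for t
  define F where "F t = 2 * (s + t) + Y t + X t + sb * B t" for t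
  have at_0: "X 0 = x" "D 0 = d" "Y 0 = y" "B 0 = be"
    using pos by (simp_all add: X_def D_def Y_def B_def d_def)
  have dX: "(X has_real_derivative d) (at 0)"
    unfolding X_def by (auto intro!: derivative_eq_intros)
  have dD: "(D has_real_derivative x) (at 0)"
    unfolding D_def by (auto intro!: derivative_eq_intros)
  have dY: "(Y has_real_derivative (- x * x - (1 - d) * d) / (x * x)) (at 0)"
    unfolding Y_def using pos by (auto intro!: derivative_eq_intros dX dD simp: at_0)
  have dB: "(B has_real_derivative y / x) (at 0)"
    unfolding B_def using pos by (auto intro!: derivative_eq_intros dX simp: at_0)
  have "(F has_real_derivative 2 + (- x * x - (1 - d) * d) / (x * x) + d + sb * (y / x)) (at 0)"
    unfolding F_def by (auto intro!: derivative_eq_intros dX dY dB)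
  moreover have "\<forall>\<^sub>F t in nhds 0. F 0 \<le> F t"
  proof -
    have 1: "\<forall>\<^sub>F t in nhds 0. 0 < X t"
      by (rule ev_pos) (use DERIV_isCont[OF dX] at_0 pos in auto)
    have 2: "\<forall>\<^sub>F t in nhds 0. 0 < Y t"
      by (rule ev_pos) (use DERIV_isCont[OF dY] at_0 pos in auto)
    have 3: "\<forall>\<^sub>F t in nhds 0. 0 < sb * B t"
      by (rule ev_pos) (use DERIV_isCont[OF dB] at_0 sb in \<open>auto intro!: continuous_intros\<close>)
    have 4: "\<forall>\<^sub>F t in nhds 0. 0 < s + t"
      by (rule ev_pos) (use pos in \<open>auto intro!: continuous_intros\<close>)
    show ?thesis
      using 1 2 3 4
    proof eventually_elim
      case (elim t)
      let ?w = "[(s, LW), (y, LQ), (- x, LP), (be, LQ)]"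
      let ?w' = "[(s + t, LW), (Y t, LQ), (- X t, LP), (B t, LQ)]"
      let ?v = "[(y, LQ), (- x, LP), (be, LQ)]"
      let ?v' = "[(t, LW), (Y t, LQ), (- X t, LP), (B t, LQ)]"
      define c where "c = cosh t"
      define h where "h = sinh t"
      have ch: "c * c = 1 + h * h"
        using cosh_square_eq[of t] by (simp add: c_def h_def power2_eq_square)
      have X: "X t = c * x + h * d" and D: "D t = c * d + h * x"
        by (simp_all add: X_def D_def c_def h_def)
      have YX: "Y t * X t = 1 - D t"
        using elim by (simp add: Y_def)
      have BX: "B t * X t = be * X t + (1 - c + h * y)"
        using elim by (simp add: B_def c_def h_def field_simps)
      have "h * (1 - Y t * X t) - c * X t = h * D t - c * X t"
        by (simp add: YX)
      also have "\<dots> = - x"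
        unfolding X D using ch by algebra
      finally have e1: "h * (1 - Y t * X t) - c * X t = - x" .
      have "wmat ?v' = wmat ?v"
      proof (rule mat22_eq_pivot12, simp only: det_wmat)
        have "wmat ?v' $ 1 $ 2 = h * (1 - Y t * X t) - c * X t"
          by (simp add: c_def[symmetric] h_def[symmetric] algebra_simps)
        also have "\<dots> = - x"
          by (rule e1)
        finally show "wmat ?v' $ 1 $ 2 = wmat ?v $ 1 $ 2"
          by simp
        show "wmat ?v $ 1 $ 2 \<noteq> 0"
          using pos by simp
        have "wmat ?v' $ 2 $ 2 = c * (1 - Y t * X t) - h * X t"
          by (simp add: c_def[symmetric] h_def[symmetric] algebra_simps)
        also have "\<dots> = c * D t - h * X t"
          by (simp add: YX)
        also have "\<dots> = d"
          unfolding X D using ch by algebra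
        finally show "wmat ?v' $ 2 $ 2 = wmat ?v $ 2 $ 2"
          by (simp add: d_def algebra_simps)
        have "(c + h * Y t - x * B t) * X t = c * X t + h * (1 - D t) - x * (be * X t + (1 - c + h * y))"
          using YX BX by algebra
        also have "\<dots> = (1 - x * be) * X t"
          unfolding X D d_def using ch by algebra
        finally have e: "c + h * Y t - x * B t = 1 - x * be"
          using elim by simp
        have "wmat ?v' $ 1 $ 1 = c + h * Y t + B t * (h * (1 - Y t * X t) - c * X t)"
          by (simp add: c_def[symmetric] h_def[symmetric] algebra_simps)
        also have "h * (1 - Y t * X t) - c * X t = - x"
          by (rule e1)
        finally show "wmat ?v' $ 1 $ 1 = wmat ?v $ 1 $ 1"
          using e by (simp add: algebra_simps)
      qed
      moreover have "wmat ?w' = flow LW s ** wmat ?v'"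
        by (simp only: wmat.simps matrix_mul_assoc flow_add)
      ultimately have "wmat ?w' = wmat ?w"
        by simp
      moreover have "profile_le ?w' ?w"
        using elim pos pos_mult_sign[OF sb(2,1)] pos_mult_sign[OF elim(3) sb(1)]
        by (intro profile_le_signs) simp
      ultimately have "cost ?w \<le> cost ?w'"
        by (rule irr_cost[OF irreducible])
      then show ?case
        using elim pos pos_mult_sign(3)[OF sb(2,1)] pos_mult_sign(3)[OF elim(3) sb(1)]
        by (simp add: F_def at_0)
    qed
  qed
  ultimately have "2 + (- x * x - (1 - d) * d) / (x * x) + d + sb * (y / x) = 0"
    by (rule stationary)
  moreover have "(- x * x - (1 - d) * d) / (x * x) = - 1 - y * d / x"
    using pos by (simp add: d_def field_simps)
  ultimately have "x * (2 + (- 1 - y * d / x) + d + sb * (y / x)) = 0"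
    by simp
  moreover have "x + x * d - y * d + sb * y = x * (2 + (- 1 - y * d / x) + d + sb * (y / x))"
    using pos by (simp add: algebra_simps)
  ultimately have "x + x * d - y * d + sb * y = 0"
    by (simp only:)
  then show ?thesis
    by (simp add: d_def)
qed

text \<open>
Perturbing the outer inner exponents to x + e and x - e changes the cost by a multiple of
1 / (x^2 - 2) of order e^2, which is negative for x^2 < 2. For x^2 = 2 the first and the last letter can be
merged, since the three inner factors multiply to - exp(- sqrt 2 P).
\<close>

lemma irr_PqPqP:
  assumes irreducible: "irreducible [(a, LP), (- x, LQ), (x, LP), (- x, LQ), (b, LP)]"
    and pos: "0 < a" "0 < x" "0 < b"
  shows "2 < x * x"
proof (rule ccontr)
  assume "\<not> 2 < x * x"
  then consider "x * x < 2" | "x * x = 2"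
    by linarith
  then show False
  proof cases
    case 1
    \<comment> \<open>the lower left entry of the product, from which the outer exponents are determined\<close>
    define c where "c = x * x * x - 2 * x"
    have "c = x * (x * x - 2)"
      by (simp add: c_def algebra_simps)
    with 1 pos have c: "c < 0"
      by (simp add: mult_pos_neg)
    \<comment> \<open>the exponent of the middle letter that keeps this entry\<close>
    define z where "z e = x * x * x / (x * x - e * e)" for e
    define A where "A e = a + ((x - e) * z e - x * x) / c" for e
    define B where "B e = b + ((x + e) * z e - x * x) / c" for e
    have cz: "isCont z 0"
      unfolding z_def using pos by (auto intro!: continuous_intros)
    have z0: "z 0 = x"
      using pos by (simp add: z_def)
    have 1: "\<forall>\<^sub>F e in at_right 0. 0 < A e"
      by (rule ev_at_right, rule ev_pos)
        (use pos c cz z0 in \<open>auto simp: A_def intro!: continuous_intros\<close>)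
    have 2: "\<forall>\<^sub>F e in at_right 0. 0 < B e"
      by (rule ev_at_right, rule ev_pos)
        (use pos c cz z0 in \<open>auto simp: B_def intro!: continuous_intros\<close>)
    have 3: "\<forall>\<^sub>F e in at_right 0. 0 < x - e"
      by (rule ev_at_right, rule ev_pos) (use pos in \<open>auto intro!: continuous_intros\<close>)
    have 4: "\<forall>\<^sub>F e in at_right 0. 0 < (e::real)"
      by (simp add: eventually_at_right_less)
    have "\<forall>\<^sub>F e in at_right 0. 0 < A e \<and> 0 < B e \<and> 0 < x - e \<and> 0 < e"
      using 1 2 3 4 by eventually_elim auto
    from eventually_happens'[OF trivial_limit_at_right_real this]
    obtain e where e: "0 < A e" "0 < B e" "e < x" "0 < e"
      by auto
    have "e * e < x * x"
      using e by (simp add: mult_strict_mono)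
    then have Pi: "0 < x * x - e * e" and ze: "z e * (x * x - e * e) = x * x * x"
      by (simp_all add: z_def)
    have "x * (x * x - e * e) < z e * (x * x - e * e)"
      using ze pos e by (simp add: algebra_simps)
    then have zx: "x < z e"
      using Pi by simp
    have Ac: "A e * c = a * c + (x - e) * z e - x * x" and Bc: "B e * c = b * c + (x + e) * z e - x * x"
      using c by (simp_all add: A_def B_def field_simps)
    let ?w = "[(a, LP), (- x, LQ), (x, LP), (- x, LQ), (b, LP)]"
    let ?w' = "[(A e, LP), (- (x + e), LQ), (z e, LP), (- (x - e), LQ), (B e, LP)]"
    have c': "- (x + e) - (x - e) + (x + e) * z e * (x - e) = c"
      using ze by (simp add: c_def algebra_simps)
    have c0: "- x - x + x * x * x = c"
      by (simp add: c_def)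
    have "wmat ?w' = wmat ?w"
    proof (rule mat22_eq_pivot21, simp only: det_wmat)
      have "wmat ?w' $ 2 $ 1 = c"
        unfolding c'[symmetric] by (simp add: algebra_simps)
      moreover have w21: "wmat ?w $ 2 $ 1 = c"
        unfolding c0[symmetric] by (simp add: algebra_simps)
      ultimately show "wmat ?w' $ 2 $ 1 = wmat ?w $ 2 $ 1"
        by simp
      show "wmat ?w $ 2 $ 1 \<noteq> 0"
        using w21 c by simp
      have "wmat ?w' $ 1 $ 1 = 1 - z e * (x - e) + A e * (- (x + e) - (x - e) + (x + e) * z e * (x - e))"
        by (simp add: algebra_simps)
      also have "\<dots> = 1 - x * x + a * (- x - x + x * x * x)"
        unfolding c' c0 Ac by (simp add: algebra_simps)
      finally show "wmat ?w' $ 1 $ 1 = wmat ?w $ 1 $ 1"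
        by (simp add: algebra_simps)
      have "wmat ?w' $ 2 $ 2 = 1 - z e * (x + e) + B e * (- (x + e) - (x - e) + (x + e) * z e * (x - e))"
        by (simp add: algebra_simps)
      also have "\<dots> = 1 - x * x + b * (- x - x + x * x * x)"
        unfolding c' c0 Bc by (simp add: algebra_simps)
      finally show "wmat ?w' $ 2 $ 2 = wmat ?w $ 2 $ 2"
        by (simp add: algebra_simps)
    qed
    then have "cost ?w \<le> cost ?w'"
      by (rule irr_cost[OF irreducible]) (use e pos zx in \<open>simp add: profile_le_def profile_def\<close>)
    then have "a + b + x \<le> A e + B e + z e"
      using e pos zx by simp
    then have "(A e + B e + z e) * c \<le> (a + b + x) * c"
      using c by (simp add: mult_right_mono_neg)
    moreover have "(A e + B e + z e) * c - (a + b + x) * c = x * x * x * (z e - x)"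
      using Ac Bc by (simp add: c_def algebra_simps)
    moreover have "0 < x * x * x * (z e - x)"
      using pos zx by simp
    ultimately show False
      by linarith
  next
    case 2
    let ?w = "[(a, LP), (- x, LQ), (x, LP), (- x, LQ), (b, LP)]"
    let ?w' = "[(- x, LQ), (x, LP), (- x, LQ), (a + b, LP)]"
    have xxx: "x * (x * y) = 2 * y" for y
      using 2 by (simp flip: mult.assoc)
    have "length ?w \<le> length ?w'"
      by (rule irr_length[OF irreducible])
        (use 2 pos in \<open>auto simp: profile_le_def profile_def xxx algebra_simps\<close>)
    then show False
      by simp
  qed
qed

text \<open>
On the curve of factorizations of the four inner letters that \<open>irr_window\<close> differentiates, the point
at which both middle exponents have changed sign has outer exponents - (x - de) and x - de.
It is cheaper when de < 2 x, that is, when x^2 > 2, which the first five letters guarantee.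
\<close>

lemma irr_PqPqPq_equal:
  assumes irreducible: "irreducible [(a, LP), (- x, LQ), (x, LP), (- x, LQ), (x, LP), (- b, LQ)]"
    and pos: "0 < a" "0 < x" "0 < b"
  shows False
proof -
  have "irreducible [(a, LP), (- x, LQ), (x, LP), (- x, LQ), (x, LP)]"
    using irr_factor[of "[]" _ "[(- b, LQ)]"] irreducible by simp
  then have x2: "2 < x * x"
    using irr_PqPqP pos by blast
  \<comment> \<open>the change of the outer exponents when the two inner exponents change sign\<close>
  define de where "de = 2 * x / (x * x - 1)"
  have de: "de * (x * x - 1) = 2 * x"
    using x2 by (simp add: de_def)
  have "0 < de"
    using x2 pos by (simp add: de_def)
  moreover have "de < 2 * x"
    using x2 pos by (simp add: de_def divide_less_eq)
  ultimately have *: "\<bar>x - de\<bar> < x"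
    by linarith
  let ?w = "[(a, LP), (- x, LQ), (x, LP), (- x, LQ), (x, LP), (- b, LQ)]"
  let ?w' = "[(a, LP), (- (x - de), LQ), (- x, LP), (x, LQ), (x - de, LP), (- b, LQ)]"
  have "wmat [(- (x - de), LQ), (- x, LP), (x, LQ), (x - de, LP)]
      = wmat [(- x, LQ), (x, LP), (- x, LQ), (x, LP)]"
    apply simp
    apply (intro conjI)
    using de apply algebra+
    done
  then have "wmat ([(a, LP)] @ [(- (x - de), LQ), (- x, LP), (x, LQ), (x - de, LP)] @ [(- b, LQ)])
      = wmat ([(a, LP)] @ [(- x, LQ), (x, LP), (- x, LQ), (x, LP)] @ [(- b, LQ)])"
    by (simp only: wmat_append)
  then have "wmat ?w' = wmat ?w"
    by (simp only: append.simps)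
  then have "cost ?w \<le> cost ?w'"
    by (rule irr_cost[OF irreducible]) (use pos in \<open>auto simp: profile_le_def profile_def\<close>)
  with * pos show False
    by simp
qed

text \<open>
The same perturbation as for five letters with alternating signs: the cost changes by a positive multiple of
(x^4 - 4) e^2.
\<close>

lemma irr_PQpqP_equal:
  assumes irreducible: "irreducible [(a, LP), (x, LQ), (- x, LP), (- x, LQ), (b, LP)]"
    and pos: "0 < a" "0 < x" "0 < b" and x2: "x * x < 2"
  shows False
proof -
  define c where "c = x * x * x"
  have c: "0 < c"
    using pos by (simp add: c_def)
  \<comment> \<open>keeps the lower left entry c of the product\<close>
  define z where "z e = (x * x * x - 2 * e) / (x * x - e * e)" for e
  define A where "A e = a + (x * x - (x - e) * z e) / c" for e
  define B where "B e = b + ((x + e) * z e - x * x) / c" for e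
  have cz: "isCont z 0"
    unfolding z_def using pos by (auto intro!: continuous_intros)
  have z0: "z 0 = x"
    using pos by (simp add: z_def)
  have 1: "\<forall>\<^sub>F e in at_right 0. 0 < A e"
    by (rule ev_at_right, rule ev_pos)
      (use pos c cz z0 in \<open>auto simp: A_def intro!: continuous_intros\<close>)
  have 2: "\<forall>\<^sub>F e in at_right 0. 0 < B e"
    by (rule ev_at_right, rule ev_pos)
      (use pos c cz z0 in \<open>auto simp: B_def intro!: continuous_intros\<close>)
  have 3: "\<forall>\<^sub>F e in at_right 0. 0 < x - e"
    by (rule ev_at_right, rule ev_pos) (use pos in \<open>auto intro!: continuous_intros\<close>)
  have 4: "\<forall>\<^sub>F e in at_right 0. 0 < (e::real)"
    by (simp add: eventually_at_right_less)
  have 5: "\<forall>\<^sub>F e in at_right 0. 0 < z e"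
    by (rule ev_at_right, rule ev_pos) (use cz z0 pos in auto)
  have "\<forall>\<^sub>F e in at_right 0. 0 < A e \<and> 0 < B e \<and> 0 < x - e \<and> 0 < e \<and> 0 < z e"
    using 1 2 3 4 5 by eventually_elim auto
  from eventually_happens'[OF trivial_limit_at_right_real this]
  obtain e where e: "0 < A e" "0 < B e" "e < x" "0 < e" "0 < z e"
    by auto
  have "e * e < x * x"
    using e by (simp add: mult_strict_mono)
  then have Pi: "0 < x * x - e * e" and ze: "z e * (x * x - e * e) = x * x * x - 2 * e"
    by (simp_all add: z_def)
  have Ac: "A e * c = a * c + x * x - (x - e) * z e" and Bc: "B e * c = b * c + (x + e) * z e - x * x"
    using c by (simp_all add: A_def B_def field_simps)
  let ?w = "[(a, LP), (x, LQ), (- x, LP), (- x, LQ), (b, LP)]"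
  let ?w' = "[(A e, LP), (x + e, LQ), (- z e, LP), (- (x - e), LQ), (B e, LP)]"
  have c': "(x + e) - (x - e) + (x + e) * z e * (x - e) = c"
    using ze by (simp add: c_def algebra_simps)
  have "wmat ?w' = wmat ?w"
  proof (rule mat22_eq_pivot21, simp only: det_wmat)
    have "wmat ?w' $ 2 $ 1 = c"
      unfolding c'[symmetric] by (simp add: algebra_simps)
    moreover have w21: "wmat ?w $ 2 $ 1 = c"
      by (simp add: c_def algebra_simps)
    ultimately show "wmat ?w' $ 2 $ 1 = wmat ?w $ 2 $ 1"
      by simp
    show "wmat ?w $ 2 $ 1 \<noteq> 0"
      using w21 c by simp
    have "wmat ?w' $ 1 $ 1 = 1 + z e * (x - e) + A e * ((x + e) - (x - e) + (x + e) * z e * (x - e))"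
      by (simp add: algebra_simps)
    also have "\<dots> = 1 + x * x + a * c"
      unfolding c' Ac by (simp add: algebra_simps)
    finally show "wmat ?w' $ 1 $ 1 = wmat ?w $ 1 $ 1"
      by (simp add: c_def algebra_simps)
    have "wmat ?w' $ 2 $ 2 = 1 - z e * (x + e) + B e * ((x + e) - (x - e) + (x + e) * z e * (x - e))"
      by (simp add: algebra_simps)
    also have "\<dots> = 1 - x * x + b * c"
      unfolding c' Bc by (simp add: algebra_simps)
    finally show "wmat ?w' $ 2 $ 2 = wmat ?w $ 2 $ 2"
      by (simp add: c_def algebra_simps)
  qed
  then have "cost ?w \<le> cost ?w'"
    by (rule irr_cost[OF irreducible]) (use e pos in \<open>simp add: profile_le_def profile_def\<close>)
  then have "a + b + x \<le> A e + B e + z e"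
    using e pos by simp
  then have "(a + b + x) * c \<le> (A e + B e + z e) * c"
    using c by simp
  moreover have "(A e + B e + z e) * c - (a + b + x) * c = z e * (c + 2 * e) - x * c"
    using Ac Bc by (simp add: algebra_simps)
  ultimately have "0 \<le> z e * (c + 2 * e) - x * c"
    by linarith
  then have "0 \<le> (z e * (c + 2 * e) - x * c) * (x * x - e * e)"
    using Pi by simp
  also have "\<dots> = (z e * (x * x - e * e)) * (c + 2 * e) - x * c * (x * x - e * e)"
    by (simp add: algebra_simps)
  also have "\<dots> = (x * x * (x * x) - 4) * (e * e)"
    unfolding ze c_def by (simp add: algebra_simps)
  finally have "0 \<le> (x * x * (x * x) - 4) * (e * e)" .
  moreover have "x * x * (x * x) < 2 * 2"
    using x2 pos by (intro mult_strict_mono) simp_all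
  moreover have "0 < e * e"
    using e by simp
  ultimately show False
    by (simp add: zero_le_mult_iff)
qed

text \<open>
The exchange of signs used for six alternating letters, with x = 2 sqrt 2 and outer exponents that need not
be equal to x.
\<close>

lemma QpQp_improvable:
  assumes "0 < e"
  shows "improvable [(sqrt 2, LQ), (- (2 * sqrt 2), LP), (2 * sqrt 2, LQ), (- e, LP)]"
proof -
  define k where "k = sqrt 2"
  have k: "k * k = 2" "0 < k"
    by (simp_all add: k_def)
  define de where "de = 4 * k / 7"
  have de: "0 < de" "de < k"
    using k by (simp_all add: de_def)
  have kk: "k * (k * y) = 2 * y" for y
    using k(1) by (simp flip: mult.assoc)
  let ?w = "[(k, LQ), (- (2 * k), LP), (2 * k, LQ), (- e, LP)]"
  let ?w' = "[(k - de, LQ), (2 * k, LP), (- (2 * k), LQ), (- (e - de), LP)]"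
  have "wmat ?w' = wmat ?w"
    by (simp add: de_def algebra_simps k kk)
  moreover have "profile_le ?w' ?w"
    using assms k de by (auto simp: profile_le_def profile_def)
  moreover have "cost ?w' < cost ?w"
    using assms k de by (simp add: abs_if)
  ultimately show ?thesis
    unfolding improvable_def k_def by blast
qed

section \<open>Rigid and forbidden factors\<close>

text \<open>
The matrix K = exp(sqrt 2 Q) exp(- sqrt 2 P) conjugates P + Q to - (P + Q). So W can be moved through K
at no cost, which identifies words that are optimal at the same time.
\<close>

lemma K_intertwines:
  "wmat [(s, LW), (sqrt 2, LQ), (- sqrt 2, LP)] = wmat [(sqrt 2, LQ), (- sqrt 2, LP), (- s, LW)]"
  by (simp add: algebra_simps)

lemma irr_mirror: "irreducible w \<Longrightarrow> irreducible (swap (negate (rev w)))"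
  by (intro irr_swap irr_neg irr_rev)

lemma flow_merge: "flow L s ** (flow L t ** g) = flow L (s + t) ** g"
  by (simp add: matrix_mul_assoc flow_add)

lemma irr_prefix: "irreducible (m @ r) \<Longrightarrow> irreducible m"
  using irr_factor[of "[]" m r] by simp

lemma irr_suffix: "irreducible (l @ m) \<Longrightarrow> irreducible m"
  using irr_factor[of l m "[]"] by simp

text \<open>
Stationarity gives (2 - x y) (x - y) = 0. If x y = 2, one of x and y is at least sqrt 2, and three of the
letters can be improved.
\<close>

lemma irr_PQpq:
  assumes irreducible: "irreducible [(a, LP), (x, LQ), (- y, LP), (- b, LQ)]"
    and pos: "0 < a" "0 < x" "0 < y" "0 < b"
  shows "x = y"
proof (cases "1 - x * y = 0")
  case True
  then have "1 + (- 1) * x\<^sup>2 = 0"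
    using irr_window_degenerate[OF irreducible, of 1 "- 1"] pos by simp
  then have "x * x = 1"
    by (simp add: power2_eq_square)
  with True have "x * x = x * y"
    by simp
  with pos show ?thesis
    by simp
next
  case False
  have "(1 - x * y) * (x - y) - y + x = 0"
    using irr_window[OF irreducible, of 1 "- 1"] pos False by simp
  then have "(2 - x * y) * (x - y) = 0"
    by (simp add: algebra_simps)
  moreover have "x * y \<noteq> 2"
  proof
    assume xy: "x * y = 2"
    consider "sqrt 2 \<le> x" | "sqrt 2 \<le> y"
    proof (atomize_elim, rule ccontr)
      assume "\<not> (sqrt 2 \<le> x \<or> sqrt 2 \<le> y)"
      then have "x * y < sqrt 2 * sqrt 2"
        using pos by (intro mult_strict_mono) simp_all
      with xy show False
        by simp
    qed
    then show False
    proof cases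
      case 1
      have "irreducible [(b, LP), (y, LQ), (- x, LP)]"
        using irr_mirror[OF irr_suffix[of "[(a, LP)]"], of "[(x, LQ), (- y, LP), (- b, LQ)]"] irreducible
        by simp
      with 1 xy pos show False
        using irr_PQp by fastforce
    next
      case 2
      have "irreducible [(a, LP), (x, LQ), (- y, LP)]"
        using irr_prefix[of _ "[(- b, LQ)]"] irreducible by simp
      with 2 xy pos show False
        using irr_PQp[of a x y] by (simp add: mult.commute)
    qed
  qed
  ultimately show ?thesis
    by simp
qed

lemma irr_PqpQ:
  assumes irreducible: "irreducible [(a, LP), (- x, LQ), (- y, LP), (b, LQ)]"
    and pos: "0 < a" "0 < x" "0 < y" "0 < b"
  shows "x = y"
proof -
  have xy: "0 < x * y"
    using pos by simp
  then have "1 + x * y \<noteq> 0"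
    by linarith
  then have "(1 + x * y) * (x - y) - y + x = 0"
    using irr_window[OF irreducible, of 1 1] pos by simp
  then have "(2 + x * y) * (x - y) = 0"
    by (simp add: algebra_simps)
  with xy show ?thesis
    by simp
qed

lemma irr_PqPq:
  assumes irreducible: "irreducible [(a, LP), (- x, LQ), (y, LP), (- b, LQ)]"
    and pos: "0 < a" "0 < x" "0 < y" "0 < b"
  shows "x = y"
proof (cases "1 - x * y = 0")
  case True
  then have "1 + (- 1) * x\<^sup>2 = 0"
    using irr_window_degenerate[OF irreducible, of 1 "- 1"] pos by simp
  then have "x * x = 1"
    by (simp add: power2_eq_square)
  with True have "x * x = x * y"
    by simp
  with pos show ?thesis
    by simp
next
  case False
  have "(1 - x * y) * (x - y) + y - x = 0"
    using irr_window[OF irreducible, of 1 "- 1"] pos False by simp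
  then have "x * y * (x - y) = 0"
    by (auto simp: algebra_simps)
  with pos show ?thesis
    by auto
qed

text \<open>
Stationarity would require x = y + 2 / y \<ge> sqrt 2, and then the first three letters can be improved.
\<close>

lemma irr_PQpQ:
  assumes irreducible: "irreducible [(a, LP), (y, LQ), (- x, LP), (b, LQ)]"
    and pos: "0 < a" "0 < y" "0 < x" "0 < b"
  shows False
proof (cases "1 - y * x = 0")
  case True
  then have "1 + y\<^sup>2 = 0"
    using irr_window_degenerate[OF irreducible, of 1 1] pos by simp
  then show False
    by (metis add_eq_0_iff le_minus_one_simps(1) not_sum_power2_lt_zero power2_less_0 zero_le_power2 zero_less_one add_pos_nonneg less_irrefl)
next
  case False
  have "(1 - y * x) * (y - x) - x - y = 0"
    using irr_window[OF irreducible, of 1 1] pos False by simp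
  then have "x * (y * x) = x * (2 + y * y)"
    by (simp add: algebra_simps)
  with pos have yx: "y * x = 2 + y * y"
    by simp
  have "sqrt 2 \<le> x"
  proof (rule ccontr)
    assume "\<not> sqrt 2 \<le> x"
    then have "x * x < 2" "x * x > 0"
      using pos mult_strict_mono[of x "sqrt 2" x "sqrt 2"] by auto
    moreover have "(x - y) * (x - y) + y * y = x * x - 2 * (y * x) + 2 * (y * y)"
      by (simp add: algebra_simps)
    moreover have "0 \<le> (x - y) * (x - y)" "0 \<le> y * y"
      by simp_all
    ultimately show False
      using yx by linarith
  qed
  moreover have "irreducible [(a, LP), (y, LQ), (- x, LP)]"
    using irr_prefix[of _ "[(b, LQ)]"] irreducible by simp
  moreover have "2 \<le> x * y"
    using yx by (simp add: mult.commute)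
  ultimately show False
    using irr_PQp pos by blast
qed

lemma irr_WQpQ:
  assumes irreducible: "irreducible [(s, LW), (v, LQ), (- x, LP), (b, LQ)]"
    and pos: "0 < s" "0 < v" "0 < x" "0 < b"
  shows "v = sqrt 2" "x = 2 * sqrt 2"
proof -
  have "irreducible [(s, LW), (v, LQ), (- x, LP)]"
    using irr_prefix[of _ "[(b, LQ)]"] irreducible by simp
  then show v: "v = sqrt 2"
    using irr_WQP pos by blast
  have "x + x * (1 - x * v) - v * (1 - x * v) + 1 * v = 0"
    by (rule irr_shift[OF irreducible]) (use pos in auto)
  then have "x * (2 - x * v + v * v) = 0"
    by (simp add: algebra_simps)
  then have "x * sqrt 2 = 2 * sqrt 2 * sqrt 2"
    using pos v by simp
  then show "x = 2 * sqrt 2"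
    by (metis mult_right_cancel real_sqrt_eq_0_iff zero_neq_numeral)
qed

lemma irr_WQpq:
  assumes irreducible: "irreducible [(s, LW), (v, LQ), (- x, LP), (- b, LQ)]"
    and pos: "0 < s" "0 < v" "0 < x" "0 < b"
  shows False
proof -
  have "irreducible [(s, LW), (v, LQ), (- x, LP)]"
    using irr_prefix[of _ "[(- b, LQ)]"] irreducible by simp
  then have v: "v = sqrt 2"
    using irr_WQP pos by blast
  have "x + x * (1 - x * v) - v * (1 - x * v) + (- 1) * v = 0"
    by (rule irr_shift[OF irreducible]) (use pos in auto)
  then have "(2 - x * v) * (x - v) = 0"
    by (simp add: algebra_simps)
  then have "x * sqrt 2 = sqrt 2 * sqrt 2 \<or> x = sqrt 2"
    using v by auto
  then have x: "x = sqrt 2"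
    by (metis mult_right_cancel real_sqrt_eq_0_iff zero_neq_numeral)
  have "irreducible [(b, LP), (x, LQ), (- v, LP)]"
    using irr_mirror[OF irr_suffix[of "[(s, LW)]"], of "[(v, LQ), (- x, LP), (- b, LQ)]"] irreducible
    by simp
  with v x pos show False
    using irr_PQp[of b x v] by simp
qed

text \<open>
Both inner exponents are sqrt 2, so the two powers of W can be merged across K.
\<close>

lemma irr_WQpw:
  assumes irreducible: "irreducible [(s, LW), (v, LQ), (- b, LP), (- s', LW)]"
    and pos: "0 < s" "0 < v" "0 < b" "0 < s'"
  shows False
proof -
  have "irreducible [(s, LW), (v, LQ), (- b, LP)]"
    using irr_prefix[of _ "[(- s', LW)]"] irreducible by simp
  then have v: "v = sqrt 2"
    using irr_WQP pos by blast
  have "irreducible [(s', LW), (b, LQ), (- v, LP)]"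
    using irr_mirror[OF irr_suffix[of "[(s, LW)]"], of "[(v, LQ), (- b, LP), (- s', LW)]"] irreducible
    by simp
  then have b: "b = sqrt 2"
    using irr_WQP pos by blast
  let ?w' = "[(s + s', LW), (sqrt 2, LQ), (- sqrt 2, LP)]"
  have "wmat ?w' = wmat ([(s, LW)] @ [(s', LW), (sqrt 2, LQ), (- sqrt 2, LP)])"
    by (simp only: append.simps wmat.simps matrix_mul_assoc flow_add)
  also have "\<dots> = wmat ([(s, LW)] @ [(sqrt 2, LQ), (- sqrt 2, LP), (- s', LW)])"
    by (simp only: wmat_append K_intertwines)
  finally have "length [(s, LW), (v, LQ), (- b, LP), (- s', LW)] \<le> length ?w'"
    by (intro irr_length[OF irreducible]) (use pos v b in \<open>simp_all add: profile_le_def profile_def\<close>)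
  then show False
    by simp
qed

lemma shift_W_through_p:
  "wmat [(s, LW), (sqrt 2, LQ), (- (2 * sqrt 2), LP)]
    = wmat [(sqrt 2, LQ), (- sqrt 2, LP), (- s, LW), (- sqrt 2, LP)]"
proof -
  have "wmat [(s, LW), (sqrt 2, LQ), (- (2 * sqrt 2), LP)]
      = wmat ([(s, LW), (sqrt 2, LQ), (- sqrt 2, LP)] @ [(- sqrt 2, LP)])"
    by (simp add: algebra_simps)
  also have "\<dots> = wmat ([(sqrt 2, LQ), (- sqrt 2, LP), (- s, LW)] @ [(- sqrt 2, LP)])"
    by (simp only: wmat_append K_intertwines)
  finally show ?thesis
    by (simp only: append.simps)
qed

text \<open>
The exponent of P is 2 sqrt 2, so W can be moved through both halves and merged.
\<close>

lemma irr_WQpQW: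
  assumes irreducible: "irreducible [(s, LW), (v, LQ), (- x, LP), (y, LQ), (s', LW)]"
    and pos: "0 < s" "0 < v" "0 < x" "0 < y" "0 < s'"
  shows False
proof -
  have "irreducible [(s, LW), (v, LQ), (- x, LP), (y, LQ)]"
    using irr_prefix[of _ "[(s', LW)]"] irreducible by simp
  from irr_WQpQ[OF this] pos have v: "v = sqrt 2" and x: "x = 2 * sqrt 2"
    by simp_all
  have "irreducible (rev [(- x, LP), (y, LQ), (s', LW)])"
    using irr_suffix[of "[(s, LW), (v, LQ)]"] irreducible by (intro irr_rev) simp
  then have y: "y = sqrt 2"
    using irr_WQP pos by simp
  let ?k = "sqrt 2"
  let ?w' = "[(s + s', LW), (?k, LQ), (- (2 * ?k), LP), (?k, LQ)]"
  have K': "wmat [(- ?k, LP), (?k, LQ), (s', LW)] = wmat [(- s', LW), (- ?k, LP), (?k, LQ)]"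
    by (simp add: algebra_simps)
  have kk: "- ?k + - ?k = - (2 * ?k)"
    by simp
  have "wmat [(s, LW), (?k, LQ), (- (2 * ?k), LP), (?k, LQ), (s', LW)]
      = wmat ([(s, LW), (?k, LQ), (- ?k, LP)] @ [(- ?k, LP), (?k, LQ), (s', LW)])"
    by (simp only: append.simps wmat.simps flow_merge kk)
  also have "\<dots> = wmat ([(s, LW), (?k, LQ), (- ?k, LP)] @ [(- s', LW), (- ?k, LP), (?k, LQ)])"
    by (simp only: wmat_append K')
  also have "\<dots> = wmat ([(s, LW)] @ [(?k, LQ), (- ?k, LP), (- s', LW)] @ [(- ?k, LP), (?k, LQ)])"
    by (simp only: append.simps)
  also have "\<dots> = wmat ([(s, LW)] @ [(s', LW), (?k, LQ), (- ?k, LP)] @ [(- ?k, LP), (?k, LQ)])"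
    by (simp only: wmat_append K_intertwines)
  also have "\<dots> = wmat ?w'"
    by (simp only: append.simps wmat.simps flow_merge kk)
  finally have "length [(s, LW), (v, LQ), (- x, LP), (y, LQ), (s', LW)] \<le> length ?w'"
    by (intro irr_length[OF irreducible]) (use pos v x y in \<open>simp_all add: profile_le_def profile_def\<close>)
  then show False
    by simp
qed

text \<open>
Moving W through K leaves the factor exp(aP) exp(sqrt 2 Q) exp(- sqrt 2 P), which is not optimal.
\<close>

lemma irr_PWQpQ:
  assumes irreducible: "irreducible [(a, LP), (s, LW), (v, LQ), (- x, LP), (b, LQ)]"
    and pos: "0 < a" "0 < s" "0 < v" "0 < x" "0 < b"
  shows False
proof -
  let ?k = "sqrt 2"
  have "irreducible [(s, LW), (v, LQ), (- x, LP), (b, LQ)]"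
    using irr_suffix[of "[(a, LP)]"] irreducible by simp
  from irr_WQpQ[OF this] pos have vx: "v = ?k" "x = 2 * ?k"
    by simp_all
  have "\<not> improvable [(a, LP), (?k, LQ), (- ?k, LP)]"
  proof (rule not_irr_if_improvable[OF irreducible, of "[]" _ "[(- s, LW), (- ?k, LP), (b, LQ)]"])
    have "wmat ([] @ [(a, LP), (?k, LQ), (- ?k, LP)] @ [(- s, LW), (- ?k, LP), (b, LQ)])
      = wmat ([(a, LP)] @ [(?k, LQ), (- ?k, LP), (- s, LW), (- ?k, LP)] @ [(b, LQ)])"
      by (simp only: append.simps)
    also have "\<dots> = wmat ([(a, LP)] @ [(s, LW), (?k, LQ), (- (2 * ?k), LP)] @ [(b, LQ)])"
      by (simp only: wmat_append shift_W_through_p)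
    finally show "wmat ([] @ [(a, LP), (?k, LQ), (- ?k, LP)] @ [(- s, LW), (- ?k, LP), (b, LQ)])
        = wmat [(a, LP), (s, LW), (v, LQ), (- x, LP), (b, LQ)]"
      by (simp only: vx append.simps)
  qed (use pos vx in \<open>simp_all add: profile_le_def profile_def\<close>)
  moreover have "improvable [(a, LP), (?k, LQ), (- ?k, LP)]"
    by (rule PQp_improvable) (use pos in simp_all)
  ultimately show False
    by blast
qed

lemma irr_WQpQp:
  assumes irreducible: "irreducible [(s, LW), (v, LQ), (- x, LP), (y, LQ), (- e, LP)]"
    and pos: "0 < s" "0 < v" "0 < x" "0 < y" "0 < e"
  shows False
proof -
  have "irreducible [(s, LW), (v, LQ), (- x, LP), (y, LQ)]"
    using irr_prefix[of _ "[(- e, LP)]"] irreducible by simp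
  from irr_WQpQ[OF this] pos have vx: "v = sqrt 2" "x = 2 * sqrt 2"
    by simp_all
  have i: "irreducible [(v, LQ), (- x, LP), (y, LQ), (- e, LP)]"
    using irr_suffix[of "[(s, LW)]"] irreducible by simp
  have "x = y"
    using irr_PqPq[of v x y e] irr_swap[OF i] pos by simp
  with i vx have "irreducible [(sqrt 2, LQ), (- (2 * sqrt 2), LP), (2 * sqrt 2, LQ), (- e, LP)]"
    by simp
  then show False
    using QpQp_improvable[OF pos(5)] not_improvable by blast
qed

lemma irr_PQpqP:
  assumes irreducible: "irreducible [(a, LP), (x, LQ), (- y, LP), (- z, LQ), (b, LP)]"
    and pos: "0 < a" "0 < x" "0 < y" "0 < z" "0 < b"
  shows False
proof -
  have xy: "x = y"
    using irr_prefix[of "[(a, LP), (x, LQ), (- y, LP), (- z, LQ)]"] irreducible pos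
    by (intro irr_PQpq[of a x y z]) simp_all
  have yz: "y = z"
    using irr_swap[OF irr_suffix[of "[(a, LP)]"], of "[(x, LQ), (- y, LP), (- z, LQ), (b, LP)]"] irreducible pos
    by (intro irr_PqpQ[of x y z b]) simp_all
  have "irreducible [(a, LP), (x, LQ), (- x, LP)]"
    using irr_prefix[of "[(a, LP), (x, LQ), (- y, LP)]"] irreducible xy by simp
  then have "\<not> (sqrt 2 \<le> x \<and> 2 \<le> x * x)"
    using irr_PQp pos by blast
  then have "x * x < 2"
    by (smt (verit) mult_mono pos(2) real_sqrt_gt_zero real_sqrt_mult_self abs_numeral real_sqrt_less_mono real_sqrt_unique zero_le_numeral power2_eq_square real_less_rsqrt real_le_lsqrt)
  then show False
    using irr_PQpqP_equal[of a x b] irreducible xy yz pos by simp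
qed

lemma irr_PqPqPq:
  assumes irreducible: "irreducible [(a, LP), (- x, LQ), (y, LP), (- z, LQ), (u, LP), (- b, LQ)]"
    and pos: "0 < a" "0 < x" "0 < y" "0 < z" "0 < u" "0 < b"
  shows False
proof -
  have "x = y"
    using irr_prefix[of "[(a, LP), (- x, LQ), (y, LP), (- z, LQ)]"] irreducible pos
    by (intro irr_PqPq[of a x y z]) simp_all
  moreover have "y = z"
    using irr_neg[OF irr_swap[OF irr_factor[of "[(a, LP)]" "[(- x, LQ), (y, LP), (- z, LQ), (u, LP)]" "[(- b, LQ)]"]]] irreducible pos
    by (intro irr_PqPq[of x y z u]) simp_all
  moreover have "z = u"
    using irr_suffix[of "[(a, LP), (- x, LQ)]" "[(y, LP), (- z, LQ), (u, LP), (- b, LQ)]"] irreducible pos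
    by (intro irr_PqPq[of y z u b]) simp_all
  ultimately show False
    using irr_PqPqPq_equal[of a x b] irreducible pos by simp
qed

text \<open>
Moving W to the left through K produces the factor of \<open>QpQp_improvable\<close>.
\<close>

lemma irr_pQpwpQp:
  assumes irreducible: "irreducible [(- e, LP), (y, LQ), (- u, LP), (- s, LW), (- v, LP), (z, LQ), (- f, LP)]"
    and pos: "0 < e" "0 < y" "0 < u" "0 < s" "0 < v" "0 < z" "0 < f"
  shows False
proof -
  let ?k = "sqrt 2"
  have "irreducible [(s, LW), (v, LQ), (- z, LP), (f, LQ)]"
    using irr_neg[OF irr_swap[OF irr_suffix[of "[(- e, LP), (y, LQ), (- u, LP)]"]],
        of "[(- s, LW), (- v, LP), (z, LQ), (- f, LP)]"] irreducible by simp
  from irr_WQpQ[OF this] pos have vz: "v = ?k" "z = 2 * ?k"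
    by simp_all
  have "irreducible [(s, LW), (u, LQ), (- y, LP), (e, LQ)]"
    using irr_mirror[OF irr_prefix[of "[(- e, LP), (y, LQ), (- u, LP), (- s, LW)]"]] irreducible by simp
  from irr_WQpQ[OF this] pos have uy: "u = ?k" "y = 2 * ?k"
    by simp_all
  let ?m = "[(?k, LQ), (- (2 * ?k), LP), (2 * ?k, LQ), (- f, LP)]"
  have "\<not> improvable ?m"
  proof (rule not_irr_if_improvable[OF irreducible, of "[(- e, LP), (?k, LQ), (s, LW)]" _ "[]"])
    have "wmat ([(- e, LP), (?k, LQ), (s, LW)] @ ?m @ [])
      = wmat ([(- e, LP), (?k, LQ)] @ [(s, LW), (?k, LQ), (- (2 * ?k), LP)] @ [(2 * ?k, LQ), (- f, LP)])"
      by (simp only: append.simps append_Nil2)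
    also have "\<dots> = wmat ([(- e, LP), (?k, LQ)] @ [(?k, LQ), (- ?k, LP), (- s, LW), (- ?k, LP)] @ [(2 * ?k, LQ), (- f, LP)])"
      by (simp only: wmat_append shift_W_through_p)
    also have "\<dots> = wmat ([(- e, LP)] @ [(?k + ?k, LQ)] @ [(- ?k, LP), (- s, LW), (- ?k, LP), (2 * ?k, LQ), (- f, LP)])"
      by (simp only: append.simps wmat.simps matrix_mul_assoc flow_add)
    finally show "wmat ([(- e, LP), (?k, LQ), (s, LW)] @ ?m @ [])
        = wmat [(- e, LP), (y, LQ), (- u, LP), (- s, LW), (- v, LP), (z, LQ), (- f, LP)]"
      by (simp only: vz uy append.simps mult_2)
  qed (use pos vz uy in \<open>simp_all add: profile_le_def profile_def\<close>)
  with QpQp_improvable[OF pos(7)] show False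
    by blast
qed

section \<open>Approximating exponentials of P + Q\<close>

definition PQ_word :: "word \<Rightarrow> bool" where
  "PQ_word w \<longleftrightarrow> (\<forall>(t, L)\<in>set w. L \<noteq> LW)"

definition nonneg_word :: "word \<Rightarrow> bool" where
  "nonneg_word w \<longleftrightarrow> (\<forall>(t, L)\<in>set w. 0 \<le> t)"

lemma wmat_power_W:
  "wmat (concat (replicate n [(tanh (h / 2), LP), (sinh h, LQ), (tanh (h / 2), LP)])) = flow LW (real n * h)"
proof (induction n)
  case 0
  then show ?case
    by (simp add: flow_zero)
next
  case (Suc n)
  have "wmat [(tanh (h / 2), LP), (sinh h, LQ), (tanh (h / 2), LP)] = flow LW h"
    using W_as_PQP by (simp only: wmat.simps one_mat22)
  with Suc show ?case
    by (simp only: replicate.simps concat.simps wmat_append flow_add) (simp add: algebra_simps)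
qed

text \<open>
The cost of n pieces exp((t/n) W) tends to 2t, as 2 tanh(h/2) + sinh h has derivative 2 at 0.
\<close>

lemma approximate_W:
  assumes "0 \<le> t" "0 < e"
  shows "\<exists>w. PQ_word w \<and> nonneg_word w \<and> wmat w = flow LW t \<and> cost w \<le> 2 * t + e"
proof (cases "t = 0")
  case True
  then show ?thesis
    using assms by (intro exI[of _ "[]"]) (simp add: PQ_word_def nonneg_word_def)
next
  case False
  with assms have t: "0 < t"
    by simp
  define f where "f h = 2 * tanh (h / 2) + sinh h - (2 + e / t) * h" for h :: real
  have "(f has_real_derivative 2 * ((1 - tanh (0 / 2) ^ 2) * (1 / 2)) + cosh 0 * 1 - (2 + e / t)) (at 0)"
    unfolding f_def by (auto intro!: derivative_eq_intros)
  then have "\<forall>\<^sub>F h in at_right 0. f h < f 0"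
    using ev_less_right[of f _ 0] assms t by simp
  then obtain d where d: "d > 0" "\<And>h. 0 < h \<Longrightarrow> h < d \<Longrightarrow> f h < 0"
    by (auto simp: eventually_at_right_field f_def)
  obtain n :: nat where n: "t / d < real n"
    using reals_Archimedean2 by blast
  have n0: "0 < real n"
    using n d t by (smt (verit) divide_pos_pos)
  define h where "h = t / real n"
  have h: "0 < h" "h < d" "real n * h = t"
    using n n0 d t by (simp_all add: h_def field_simps)
  let ?m = "[(tanh (h / 2), LP), (sinh h, LQ), (tanh (h / 2), LP)]"
  let ?w = "concat (replicate n ?m)"
  have c: "cost (concat (replicate k ?m)) = real k * (2 * tanh (h / 2) + sinh h)" for k
    using h by (induction k) (simp_all add: algebra_simps)
  have "2 * tanh (h / 2) + sinh h < (2 + e / t) * h"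
    using d(2)[OF h(1,2)] by (simp add: f_def)
  then have "cost ?w \<le> real n * ((2 + e / t) * h)"
    using n0 by (simp add: c)
  also have "\<dots> = 2 * t + e"
    using t h(1) n0 unfolding h(3)[symmetric] by (simp add: field_simps)
  finally show ?thesis
    using h wmat_power_W[of n h]
    by (intro exI[of _ ?w]) (auto simp: PQ_word_def nonneg_word_def)
qed

lemma approximate_by_PQ:
  assumes "0 < e"
  shows "\<exists>w'. PQ_word w' \<and> (nonneg_word w \<longrightarrow> nonneg_word w') \<and> wmat w' = wmat w \<and> cost w' \<le> cost w + e"
  using assms
proof (induction w arbitrary: e rule: wmat.induct)
  case 1
  then show ?case
    by (intro exI[of _ "[]"]) (simp add: PQ_word_def)
next
  case (2 t L w)
  have "0 < e / 2"
    using 2 by simp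
  from "2.IH"[OF this] obtain w' where w': "PQ_word w'" "nonneg_word w \<longrightarrow> nonneg_word w'"
    "wmat w' = wmat w" "cost w' \<le> cost w + e / 2"
    by blast
  obtain m where m: "PQ_word m" "0 \<le> t \<longrightarrow> nonneg_word m" "wmat m = flow L t"
    "cost m \<le> rate L * \<bar>t\<bar> + e / 2"
  proof (cases L)
    case LP
    then show ?thesis
      using 2 by (intro that[of "[(t, LP)]"]) (auto simp: PQ_word_def nonneg_word_def)
  next
    case LQ
    then show ?thesis
      using 2 by (intro that[of "[(t, LQ)]"]) (auto simp: PQ_word_def nonneg_word_def)
  next
    case LW
    obtain m where m: "PQ_word m" "nonneg_word m" "wmat m = flow LW \<bar>t\<bar>" "cost m \<le> 2 * \<bar>t\<bar> + e / 2"
      using approximate_W[of "\<bar>t\<bar>" "e / 2"] 2 by auto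
    show ?thesis
    proof (cases "0 \<le> t")
      case True
      then show ?thesis
        using m LW by (intro that[of m]) auto
    next
      case False
      have "wmat (negate m) = flow LW t"
        using False m(3) by (simp add: negM_def)
      moreover have "PQ_word (negate m)"
        using m(1) by (auto simp: PQ_word_def negate_def)
      ultimately show ?thesis
        using m LW False by (intro that[of "negate m"]) auto
    qed
  qed
  show ?case
    using w' m by (intro exI[of _ "m @ w'"]) (auto simp: PQ_word_def nonneg_word_def)
qed

section \<open>Products of nonnegative factors\<close>

text \<open>
The cost of exp(uP) exp(sW) exp(vQ) in terms of the matrix: the lower right entry is cosh s, and u and
v are read off from the other two.
\<close>

definition phiD :: "real^2^2 \<Rightarrow> real" where
  "phiD g = (let d = g $ 2 $ 2 in
     (g $ 1 $ 2 + g $ 2 $ 1 - 2 * sqrt (d\<^sup>2 - 1)) / d + 2 * arcosh d)"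

text \<open>
The cost of exp(uP) exp(sW) exp(vP), whose lower left entry is sinh s.
\<close>

definition phiC :: "real^2^2 \<Rightarrow> real" where
  "phiC g = (let c = g $ 2 $ 1 in
     (g $ 1 $ 1 + g $ 2 $ 2 - 2 * sqrt (1 + c\<^sup>2)) / c + 2 * arsinh c)"

lemma DERIV_sqrt_compose:
  assumes "(g has_real_derivative D) (at x)" "0 < g x"
  shows "((\<lambda>x. sqrt (g x)) has_real_derivative D / (2 * sqrt (g x))) (at x)"
proof -
  have "((\<lambda>x. sqrt (g x)) has_real_derivative inverse (sqrt (g x)) / 2 * D) (at x)"
    by (rule DERIV_chain2[where f = sqrt and g = g, OF DERIV_real_sqrt[OF assms(2)] assms(1)])
  moreover have "inverse q / 2 * D = D / (2 * q)" for q :: real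
    by (cases "q = 0") (simp_all add: field_simps)
  ultimately show ?thesis
    by (simp only:)
qed

lemma rearrange_D: "x + y - h \<le> x' + y' - h' \<Longrightarrow> h' - h \<le> (x' - x) + (y' - y)" for x :: real
  by simp

lemma rearrange_C: "x - y - h \<le> x' - y' - h' \<Longrightarrow> h' - h \<le> (x' - x) - (y' - y)" for x :: real
  by simp

text \<open>
The derivative of the difference of the two sides is (S - b)^2 / (b d^2), where S^2 = d^2 - 1.
\<close>

lemma phiD_step:
  assumes b: "0 < b" and d: "1 \<le> d" "d \<le> d'"
  shows "(2 * arcosh d' - 2 * sqrt (d'\<^sup>2 - 1) / d') - (2 * arcosh d - 2 * sqrt (d\<^sup>2 - 1) / d)
    \<le> (d' - d) / b + (1 - b * b) / b * (1 / d' - 1 / d)"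
proof -
  define G where "G x = x / b + (1 - b * b) / b * (1 / x) - (2 * arcosh x - 2 * sqrt (x\<^sup>2 - 1) / x)" for x
  have "G d \<le> G d'"
  proof (rule DERIV_nonneg_imp_increasing_open[OF d(2)])
    fix x
    assume x: "d < x" "x < d'"
    then have x1: "1 < x"
      using d by simp
    then have "1 < x * x"
      using mult_strict_mono[of 1 x 1 x] by simp
    then have x2: "0 < x\<^sup>2 - 1"
      by (simp add: power2_eq_square)
    define S where "S = sqrt (x\<^sup>2 - 1)"
    have S: "0 < S" "S * S = x * x - 1"
      using x2 by (simp_all add: S_def power2_eq_square)
    have dS: "((\<lambda>x. sqrt (x\<^sup>2 - 1)) has_real_derivative x / S) (at x)"
    proof -
      have "((\<lambda>x. x\<^sup>2 - 1) has_real_derivative 2 * x) (at x)"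
        by (auto intro!: derivative_eq_intros)
      from DERIV_sqrt_compose[OF this x2] show ?thesis
        by (simp add: S_def)
    qed
    have dA: "(arcosh has_real_derivative 1 / S) (at x)"
      using arcosh_real_has_field_derivative[OF x1, of UNIV] by (simp add: S_def)
    have dI: "((\<lambda>x. (1 - b * b) / b * (1 / x)) has_real_derivative (1 - b * b) / b * (- 1 / (x * x))) (at x)"
      using x1 b by (auto intro!: derivative_eq_intros)
    have dQ: "((\<lambda>x. 2 * sqrt (x\<^sup>2 - 1) / x) has_real_derivative (2 * (x / S) * x - 2 * S) / (x * x)) (at x)"
    proof -
      have "((\<lambda>x. 2 * sqrt (x\<^sup>2 - 1) / x) has_real_derivative
          (2 * (x / S) * x - 2 * sqrt (x\<^sup>2 - 1) * 1) / (x * x)) (at x)"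
        by (rule DERIV_divide[OF DERIV_cmult[OF dS] DERIV_ident]) (use x1 in simp)
      then show ?thesis
        by (simp only: mult_1_right S_def)
    qed
    have dB: "((\<lambda>x. x / b) has_real_derivative 1 / b) (at x)"
      using b by (auto intro!: derivative_eq_intros)
    have "(G has_real_derivative (1 / b + (1 - b * b) / b * (- 1 / (x * x))
        - (2 * (1 / S) - (2 * (x / S) * x - 2 * S) / (x * x)))) (at x)"
      unfolding G_def by (intro DERIV_diff DERIV_add dB dI dQ DERIV_cmult dA)
    moreover have "1 / b + (1 - b * b) / b * (- 1 / (x * x)) - (2 * (1 / S) - (2 * (x / S) * x - 2 * S) / (x * x))
        = (S - b) * (S - b) / (b * (x * x))"
    proof -
      have e: "2 * (x / S) * x - 2 * S = 2 / S"
        using S by (simp add: field_simps)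
      have "2 * (1 / S) - (2 / S) / (x * x) = 2 * (x * x - 1) / (S * (x * x))"
        using S(1) x1 by (simp add: field_simps)
      also have "\<dots> = 2 * S / (x * x)"
        unfolding S(2)[symmetric] using S(1) x1 by simp
      finally have br: "2 * (1 / S) - (2 * (x / S) * x - 2 * S) / (x * x) = 2 * S / (x * x)"
        unfolding e .
      have "1 / b + (1 - b * b) / b * (- 1 / (x * x)) - 2 * S / (x * x)
          = (x * x - 1 + b * b - 2 * b * S) / (b * (x * x))"
        using b x1 by (simp add: field_simps)
      also have "(x * x - 1 + b * b - 2 * b * S) = (S - b) * (S - b)"
        using S(2) by (simp add: algebra_simps)
      finally show ?thesis
        unfolding br .
    qed
    ultimately have "(G has_real_derivative ((S - b) * (S - b) / (b * (x * x)))) (at x)"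
      by simp
    moreover have "0 \<le> (S - b) * (S - b) / (b * (x * x))"
      using b by (simp add: zero_le_divide_iff zero_le_mult_iff)
    ultimately show "\<exists>y. (G has_real_derivative y) (at x) \<and> 0 \<le> y"
      by blast
  next
    show "continuous_on {d..d'} G"
      unfolding G_def using d b
      by (auto intro!: continuous_intros continuous_on_arcosh' simp: power2_eq_square)
  qed
  then show ?thesis
    unfolding G_def diff_divide_distrib[of d' d] right_diff_distrib[of _ "1 / d'"]
    by (rule rearrange_D)
qed

text \<open>
The derivative of the difference of the two sides is (C - a)^2 / (a c^2), where C^2 = 1 + c^2.
\<close>

lemma phiC_step:
  assumes a: "0 < a" and c: "0 < c" "c \<le> c'"
  shows "(2 * arsinh c' - 2 * sqrt (1 + c'\<^sup>2) / c') - (2 * arsinh c - 2 * sqrt (1 + c\<^sup>2) / c)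
    \<le> (c' - c) / a - (1 + a * a) / a * (1 / c' - 1 / c)"
proof -
  define G where "G x = x / a - (1 + a * a) / a * (1 / x) - (2 * arsinh x - 2 * sqrt (1 + x\<^sup>2) / x)" for x
  have "G c \<le> G c'"
  proof (rule DERIV_nonneg_imp_nondecreasing[OF c(2)])
    fix x
    assume "c \<le> x" "x \<le> c'"
    then have x: "0 < x"
      using c by simp
    then have x2: "0 < 1 + x\<^sup>2"
      by (simp add: add_pos_nonneg)
    define C where "C = sqrt (1 + x\<^sup>2)"
    have C: "0 < C" "C * C = 1 + x * x"
      using x2 by (simp_all add: C_def power2_eq_square)
    have C': "sqrt (x\<^sup>2 + 1) = C"
      by (simp add: C_def add.commute)
    have dS: "((\<lambda>x. sqrt (1 + x\<^sup>2)) has_real_derivative x / C) (at x)"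
    proof -
      have "((\<lambda>x. 1 + x\<^sup>2) has_real_derivative 2 * x) (at x)"
        by (auto intro!: derivative_eq_intros)
      from DERIV_sqrt_compose[OF this x2] show ?thesis
        by (simp add: C_def)
    qed
    have dA: "(arsinh has_real_derivative 1 / C) (at x)"
      using arsinh_real_has_field_derivative[of x UNIV] by (simp add: C')
    have dI: "((\<lambda>x. (1 + a * a) / a * (1 / x)) has_real_derivative (1 + a * a) / a * (- 1 / (x * x))) (at x)"
      using x a by (auto intro!: derivative_eq_intros)
    have dQ: "((\<lambda>x. 2 * sqrt (1 + x\<^sup>2) / x) has_real_derivative (2 * (x / C) * x - 2 * C) / (x * x)) (at x)"
    proof -
      have "((\<lambda>x. 2 * sqrt (1 + x\<^sup>2) / x) has_real_derivative
          (2 * (x / C) * x - 2 * sqrt (1 + x\<^sup>2) * 1) / (x * x)) (at x)"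
        by (rule DERIV_divide[OF DERIV_cmult[OF dS] DERIV_ident]) (use x in simp)
      then show ?thesis
        by (simp only: mult_1_right C_def)
    qed
    have dB: "((\<lambda>x. x / a) has_real_derivative 1 / a) (at x)"
      using a by (auto intro!: derivative_eq_intros)
    have "(G has_real_derivative (1 / a - (1 + a * a) / a * (- 1 / (x * x))
        - (2 * (1 / C) - (2 * (x / C) * x - 2 * C) / (x * x)))) (at x)"
      unfolding G_def by (intro DERIV_diff dB dI dQ DERIV_cmult dA)
    moreover have "1 / a - (1 + a * a) / a * (- 1 / (x * x)) - (2 * (1 / C) - (2 * (x / C) * x - 2 * C) / (x * x))
        = (C - a) * (C - a) / (a * (x * x))"
    proof -
      have "2 * (x / C) * x - 2 * C = 2 * (x * x - C * C) / C"
        using C(1) by (simp add: field_simps)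
      then have e: "2 * (x / C) * x - 2 * C = - 2 / C"
        by (simp add: C(2))
      have "2 * (1 / C) - (- 2 / C) / (x * x) = 2 * (1 + x * x) / (C * (x * x))"
        using C(1) x by (simp add: field_simps)
      also have "\<dots> = 2 * C / (x * x)"
        unfolding C(2)[symmetric] using C(1) x by simp
      finally have br: "2 * (1 / C) - (2 * (x / C) * x - 2 * C) / (x * x) = 2 * C / (x * x)"
        unfolding e .
      have "1 / a - (1 + a * a) / a * (- 1 / (x * x)) - 2 * C / (x * x)
          = (1 + x * x + a * a - 2 * a * C) / (a * (x * x))"
        using a x by (simp add: field_simps)
      also have "(1 + x * x + a * a - 2 * a * C) = (C - a) * (C - a)"
        using C(2) by (simp add: algebra_simps)
      finally show ?thesis
        unfolding br .
    qed
    ultimately have "(G has_real_derivative ((C - a) * (C - a) / (a * (x * x)))) (at x)"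
      by simp
    moreover have "0 \<le> (C - a) * (C - a) / (a * (x * x))"
      using a by (simp add: zero_le_divide_iff zero_le_mult_iff)
    ultimately show "\<exists>y. (G has_real_derivative y) (at x) \<and> 0 \<le> y"
      by blast
  qed
  then show ?thesis
    unfolding G_def diff_divide_distrib[of c' c] right_diff_distrib[of _ "1 / c'"]
    by (rule rearrange_C)
qed

lemma double_le_tanh_sinh:
  fixes s :: real
  assumes "0 \<le> s"
  shows "2 * s \<le> 2 * tanh (s / 2) + sinh s"
proof -
  define G where "G x = 2 * tanh (x / 2) + sinh x - 2 * x" for x :: real
  have "G 0 \<le> G s"
  proof (rule DERIV_nonneg_imp_nondecreasing[OF assms])
    fix x :: real
    define T where "T = tanh (x / 2)"
    define C where "C = cosh (x / 2)"
    have C: "1 \<le> C"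
      by (simp add: C_def cosh_real_ge_1)
    have "(G has_real_derivative (1 - T\<^sup>2) + cosh x - 2) (at x)"
      unfolding G_def by (auto intro!: derivative_eq_intros simp: T_def)
    moreover have "0 \<le> (1 - T\<^sup>2) + cosh x - 2"
    proof -
      have u: "1 \<le> C\<^sup>2"
        using C by simp
      have "T\<^sup>2 = (C\<^sup>2 - 1) / C\<^sup>2"
        using cosh_square_eq[of "x / 2"] unfolding T_def C_def tanh_def
        by (simp add: power_divide)
      then have t: "1 - T\<^sup>2 = 1 / C\<^sup>2"
        using u C by (simp add: diff_divide_distrib)
      have c: "cosh x = 2 * C\<^sup>2 - 1"
        using cosh_double_cosh[of "x / 2"] by (simp add: C_def)
      have "(1 - T\<^sup>2) + cosh x - 2 = (2 * C\<^sup>2 - 1) * (C\<^sup>2 - 1) / C\<^sup>2"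
        unfolding t c using u C by (simp add: field_simps power2_eq_square)
      with u show ?thesis
        by simp
    qed
    ultimately show "\<exists>y. (G has_real_derivative y) (at x) \<and> 0 \<le> y"
      by blast
  qed
  then show ?thesis
    by (simp add: G_def)
qed

text \<open>
The limit case of \<open>phiC_step\<close> in which the lower left entry starts at 0.
\<close>

lemma phiC_start:
  assumes "0 < c"
  shows "2 * arsinh c - 2 * (sqrt (1 + c\<^sup>2) - 1) / c \<le> c"
proof -
  have *: "2 * s - 2 * (cosh s - 1) / sinh s \<le> sinh s" if "0 < s" for s :: real
  proof -
    have "2 * (cosh s - 1) / sinh s = 2 * tanh (s / 2)"
      unfolding tanh_half(1)[of s, symmetric] using that by simp
    then show ?thesis
      using double_le_tanh_sinh[of s] that by linarith
  qed
  have "cosh (arsinh c) = sqrt (1 + c\<^sup>2)"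
    using cosh_square_eq[of "arsinh c"] by (intro real_sqrt_unique[symmetric]) simp_all
  moreover have "0 < arsinh c"
    using assms by simp
  ultimately show ?thesis
    using *[of "arsinh c"] unfolding sinh_arsinh_real by (simp only:)
qed

text \<open>
Multiplying by exp(tP) on the left adds exactly t to \<open>phiD\<close> and \<open>phiC\<close>, multiplying by exp(tQ) adds
at most t. Where the lower left entry vanishes, the matrix is exp(bP), and b takes the place of \<open>phiC\<close>.
\<close>

lemma phi_le_cost:
  assumes "PQ_word w" "nonneg_word w"
  shows "0 \<le> wmat w $ i $ j \<and> 1 \<le> wmat w $ 1 $ 1 \<and> 1 \<le> wmat w $ 2 $ 2 \<and> phiD (wmat w) \<le> cost w
    \<and> (if wmat w $ 2 $ 1 = 0 then wmat w $ 1 $ 2 else phiC (wmat w)) \<le> cost w"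
  using assms
proof (induction w arbitrary: i j rule: wmat.induct)
  case 1
  show ?case
    using exhaust_2[of i] exhaust_2[of j] by (auto simp: phiD_def)
next
  case (2 t L w)
  define g where "g = wmat w"
  define a b c d where "a = g $ 1 $ 1" and "b = g $ 1 $ 2" and "c = g $ 2 $ 1" and "d = g $ 2 $ 2"
  have g: "g = mat22 a b c d"
    unfolding a_def b_def c_def d_def by (rule mat22_entries)
  have t: "0 \<le> t" and L: "L \<noteq> LW" and w: "PQ_word w" "nonneg_word w"
    using "2.prems" by (auto simp: PQ_word_def nonneg_word_def)
  note IH = "2.IH"[OF w, folded g_def]
  have ent: "0 \<le> a" "0 \<le> b" "0 \<le> c" "0 \<le> d" "1 \<le> a" "1 \<le> d"
    using IH by (auto simp: a_def b_def c_def d_def)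
  have D: "phiD g \<le> cost w" and C: "(if c = 0 then b else phiC g) \<le> cost w"
    using IH by (auto simp: b_def c_def)
  have det: "a * d - b * c = 1"
    using det_wmat[of w] by (simp add: g flip: g_def)
  show ?case
  proof (cases L)
    case LP
    have m: "wmat ((t, L) # w) = mat22 (a + t * c) (b + t * d) c d"
      by (simp add: LP g flip: g_def)
    have "phiD (mat22 (a + t * c) (b + t * d) c d) = phiD g + t"
      using ent by (simp add: phiD_def g Let_def field_simps)
    moreover have "phiC (mat22 (a + t * c) (b + t * d) c d) = phiC g + t" if "c \<noteq> 0"
      using that by (simp add: phiC_def g Let_def field_simps)
    moreover have "d = 1" if "c = 0"
    proof -
      have "d * 1 \<le> d * a"
        using ent by (intro mult_left_mono) simp_all
      with det that ent show ?thesis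
        by (simp add: mult.commute)
    qed
    ultimately show ?thesis
      unfolding m using ent t D C LP exhaust_2[of i] exhaust_2[of j]
      by (auto simp: add_increasing2 split: if_splits)
  next
    case LQ
    have m: "wmat ((t, L) # w) = mat22 a b (c + t * a) (d + t * b)"
      by (simp add: LQ g add.commute flip: g_def)
    define c' d' where "c' = c + t * a" and "d' = d + t * b"
    have cd: "c \<le> c'" "d \<le> d'" "0 < d'"
      using ent t by (simp_all add: c'_def d'_def add_increasing2 add_pos_nonneg)
    have D': "phiD (mat22 a b c' d') \<le> phiD g + t"
    proof (cases "b = 0")
      case True
      have "a * 1 \<le> a * d"
        using ent by (intro mult_left_mono) simp_all
      with True det ent have "a = 1" "d = 1"
        by auto
      with True show ?thesis
        by (simp add: phiD_def g c'_def d'_def)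
    next
      case False
      with ent have b: "0 < b"
        by simp
      have "(c' * d - c * d') = t"
        using det unfolding c'_def d'_def by algebra
      then have e: "c' / d' - c / d = t / (d * d')"
        using ent cd by (simp add: field_simps)
      have t': "t = (d' - d) / b"
        using b by (simp add: d'_def)
      have "t / (d * d') = - (1 / b) * (1 / d' - 1 / d)"
        unfolding t' using ent cd b by (simp add: field_simps)
      moreover have "(1 - b * b) / b * (1 / d' - 1 / d) = 1 / b * (1 / d' - 1 / d) - (b / d' - b / d)"
      proof -
        have "(1 - b * b) / b = 1 / b - b"
          using b by (simp add: field_simps)
        then have "(1 - b * b) / b * (1 / d' - 1 / d) = 1 / b * (1 / d' - 1 / d) - b * (1 / d' - 1 / d)"
          by (simp only: left_diff_distrib)
        moreover have "b * (1 / d' - 1 / d) = b / d' - b / d"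
          by (simp add: right_diff_distrib)
        ultimately show ?thesis
          by (simp only:)
      qed
      ultimately show ?thesis
        using phiD_step[OF b _ cd(2)] ent e t'
        by (simp add: phiD_def g Let_def add_divide_distrib diff_divide_distrib)
    qed
    have C': "(if c' = 0 then b else phiC (mat22 a b c' d')) \<le> (if c = 0 then b else phiC g) + t"
    proof (cases "c = 0")
      case True
      have "a * 1 \<le> a * d"
        using ent by (intro mult_left_mono) simp_all
      with True det ent have ad: "a = 1" "d = 1"
        by auto
      show ?thesis
      proof (cases "t = 0")
        case False
        with t have "0 < t"
          by simp
        from phiC_start[OF this] show ?thesis
          using True ad \<open>0 < t\<close> by (simp add: phiC_def c'_def d'_def Let_def field_simps)
      qed (use True in \<open>simp add: c'_def\<close>)
    next
      case False
      with ent have c: "0 < c"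
        by simp
      have a: "0 < a"
        using ent by simp
      have "(d' * c - d * c') = - t"
        using det unfolding c'_def d'_def by algebra
      then have e: "d' / c' - d / c = - t / (c * c')"
        using c cd by (simp add: diff_frac_eq mult.commute)
      have t': "t = (c' - c) / a"
        using a by (simp add: c'_def)
      have "- t / (c * c') = (1 / a) * (1 / c' - 1 / c)"
        unfolding t' using c cd a by (simp add: field_simps)
      moreover have "(1 + a * a) / a * (1 / c' - 1 / c) = 1 / a * (1 / c' - 1 / c) + (a / c' - a / c)"
      proof -
        have "(1 + a * a) / a = 1 / a + a"
          using a by (simp add: field_simps)
        then have "(1 + a * a) / a * (1 / c' - 1 / c) = 1 / a * (1 / c' - 1 / c) + a * (1 / c' - 1 / c)"
          by (simp only: distrib_right)
        moreover have "a * (1 / c' - 1 / c) = a / c' - a / c"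
          by (simp add: right_diff_distrib)
        ultimately show ?thesis
          by (simp only:)
      qed
      ultimately show ?thesis
        using phiC_step[OF a c cd(1)] c cd e t'
        by (simp add: phiC_def g Let_def add_divide_distrib diff_divide_distrib)
    qed
    show ?thesis
      unfolding m c'_def[symmetric] d'_def[symmetric]
      using ent t D C D' C' LQ cd exhaust_2[of i] exhaust_2[of j]
      by (auto split: if_splits)
  qed (use L in simp)
qed

text \<open>
If d^2 - 1 or a^2 - 1 is at most min(b, c)^2, the middle part is determined by that diagonal entry and the outer
letters differ; otherwise it is determined by min(b, c), and the outer letters agree.
\<close>

lemma normal_form_exists:
  assumes det: "a * d - b * c = 1" and nn: "0 \<le> b" "0 \<le> c" "1 \<le> a" "1 \<le> d"
    and D: "phiD (mat22 a b c d) \<le> k" "phiD (swapM (mat22 a b c d)) \<le> k"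
    and C: "c \<noteq> 0 \<Longrightarrow> phiC (mat22 a b c d) \<le> k" "b \<noteq> 0 \<Longrightarrow> phiC (swapM (mat22 a b c d)) \<le> k"
  shows "\<exists>X Y u s v. X \<noteq> LW \<and> Y \<noteq> LW \<and> 0 \<le> u \<and> 0 \<le> s \<and> 0 \<le> v
    \<and> wmat [(u, X), (s, LW), (v, Y)] = mat22 a b c d \<and> u + 2 * s + v \<le> k"
proof -
  have caseD: "\<exists>u s v. 0 \<le> u \<and> 0 \<le> s \<and> 0 \<le> v
    \<and> wmat [(u, LP), (s, LW), (v, LQ)] = mat22 a b c d \<and> u + 2 * s + v = phiD (mat22 a b c d)"
    if "a * d - b * c = 1" "0 \<le> b" "0 \<le> c" "1 \<le> d" "d\<^sup>2 - 1 \<le> b\<^sup>2" "d\<^sup>2 - 1 \<le> c\<^sup>2" for a b c d :: real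
  proof -
    define s where "s = arcosh d"
    define S where "S = sinh s"
    have s: "0 \<le> s" "cosh s = d"
      using that by (simp_all add: s_def)
    have d1: "0 \<le> d\<^sup>2 - 1"
      using that by simp
    have S0: "0 \<le> S"
      using s by (simp add: S_def)
    have SS: "S\<^sup>2 = d\<^sup>2 - 1"
      using cosh_square_eq[of s] by (simp add: S_def s)
    have Sq: "sqrt (d\<^sup>2 - 1) = S"
      using S0 by (simp flip: SS)
    have Sb: "S \<le> b" "S \<le> c"
      using that SS by (auto intro: power2_le_imp_le)
    have ad: "a = (1 + b * c) / d"
      using that by (simp add: field_simps)
    define u v where "u = (b - S) / d" and "v = (c - S) / d"
    have uv: "0 \<le> u" "0 \<le> v" "u * d = b - S" "v * d = c - S"
      using Sb that by (simp_all add: u_def v_def)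
    have "wmat [(u, LP), (s, LW), (v, LQ)] = mat22 a b c d"
    proof (rule mat22_eq_pivot22)
      show "det (wmat [(u, LP), (s, LW), (v, LQ)]) = det (mat22 a b c d)"
        by (simp only: det_wmat) (use that in simp)
    qed (use that uv s in \<open>simp_all add: S_def[symmetric] algebra_simps\<close>)
    moreover have "u + 2 * s + v = phiD (mat22 a b c d)"
      using that by (simp add: phiD_def Let_def Sq s_def[symmetric] u_def v_def add_divide_distrib diff_divide_distrib)
    ultimately show ?thesis
      using uv s by blast
  qed
  have caseC: "\<exists>u s v. 0 \<le> u \<and> 0 \<le> s \<and> 0 \<le> v
    \<and> wmat [(u, LP), (s, LW), (v, LP)] = mat22 a b c d \<and> u + 2 * s + v = phiC (mat22 a b c d)"
    if "a * d - b * c = 1" "0 < c" "0 \<le> a" "0 \<le> d" "1 + c\<^sup>2 \<le> a\<^sup>2" "1 + c\<^sup>2 \<le> d\<^sup>2" for a b c d :: real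
  proof -
    define s where "s = arsinh c"
    define C where "C = cosh s"
    have sc: "sinh s = c"
      by (simp add: s_def)
    then have s: "0 \<le> s" "sinh s = c"
      using that sinh_real_nonneg_iff[of s] by simp_all
    have C0: "0 \<le> C"
      by (simp add: C_def)
    have CC: "C\<^sup>2 = 1 + c\<^sup>2"
      using cosh_square_eq[of s] by (simp add: C_def s)
    have Cq: "sqrt (1 + c\<^sup>2) = C"
      using C0 by (simp flip: CC)
    have Cb: "C \<le> a" "C \<le> d"
      using that CC by (auto intro: power2_le_imp_le)
    define u v where "u = (a - C) / c" and "v = (d - C) / c"
    have uv: "0 \<le> u" "0 \<le> v" "u * c = a - C" "v * c = d - C"
      using Cb that by (simp_all add: u_def v_def)
    have "wmat [(u, LP), (s, LW), (v, LP)] = mat22 a b c d"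
    proof (rule mat22_eq_pivot21)
      show "det (wmat [(u, LP), (s, LW), (v, LP)]) = det (mat22 a b c d)"
        by (simp only: det_wmat) (use that in simp)
    qed (use that uv s in \<open>simp_all add: C_def[symmetric] algebra_simps\<close>)
    moreover have "u + 2 * s + v = phiC (mat22 a b c d)"
      using that by (simp add: phiC_def Let_def Cq s_def[symmetric] u_def v_def add_divide_distrib diff_divide_distrib)
    ultimately show ?thesis
      using uv s by blast
  qed
  have swapped: "wmat [(u, swapL X), (s, LW), (v, swapL Y)] = mat22 a b c d"
    if "wmat [(u, X), (s, LW), (v, Y)] = mat22 d c b a" for u s v X Y
    using arg_cong[OF that, of swapM] wmat_swap[of "[(u, X), (s, LW), (v, Y)]"]
    by (simp add: swapM_def)
  have sw: "swapM (mat22 a b c d) = mat22 d c b a"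
    by (simp add: swapM_def)
  have *: ?thesis if "X \<noteq> LW" "Y \<noteq> LW" "0 \<le> u" "0 \<le> s" "0 \<le> v"
    "wmat [(u, X), (s, LW), (v, Y)] = mat22 a b c d" "u + 2 * s + v \<le> k" for X Y u s v
    using that by blast
  note D = D[unfolded sw] and C = C[unfolded sw]
  consider (1) "d\<^sup>2 - 1 \<le> b\<^sup>2" "d\<^sup>2 - 1 \<le> c\<^sup>2" | (2) "a\<^sup>2 - 1 \<le> b\<^sup>2" "a\<^sup>2 - 1 \<le> c\<^sup>2"
    | (3) "c \<noteq> 0" "1 + c\<^sup>2 \<le> a\<^sup>2" "1 + c\<^sup>2 \<le> d\<^sup>2" | (4) "b \<noteq> 0" "1 + b\<^sup>2 \<le> a\<^sup>2" "1 + b\<^sup>2 \<le> d\<^sup>2"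
  proof -
    have z: "d = 1" if "b * c = 0"
    proof -
      have "d * 1 \<le> d * a"
        using nn by (intro mult_left_mono) simp_all
      with det that nn show ?thesis
        by (simp add: mult.commute)
    qed
    show thesis
    proof (cases "b * c = 0")
      case True
      with z that(1) show ?thesis
        by simp
    next
      case False
      then have bc: "b \<noteq> 0" "c \<noteq> 0"
        by auto
      show ?thesis
      proof (cases "b\<^sup>2 \<le> c\<^sup>2")
        case True
        consider "d\<^sup>2 - 1 \<le> b\<^sup>2" | "a\<^sup>2 - 1 \<le> b\<^sup>2" | "b\<^sup>2 < d\<^sup>2 - 1" "b\<^sup>2 < a\<^sup>2 - 1"
          by linarith
        then show ?thesis
        proof cases
          case 1
          with True show ?thesis by (intro that(1)) linarith+
        next
          case 2
          with True show ?thesis by (intro that(2)) linarith+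
        next
          case 3
          with bc show ?thesis by (intro that(4)) (simp, linarith+)
        qed
      next
        case False
        consider "d\<^sup>2 - 1 \<le> c\<^sup>2" | "a\<^sup>2 - 1 \<le> c\<^sup>2" | "c\<^sup>2 < d\<^sup>2 - 1" "c\<^sup>2 < a\<^sup>2 - 1"
          by linarith
        then show ?thesis
        proof cases
          case 1
          with False show ?thesis by (intro that(1)) linarith+
        next
          case 2
          with False show ?thesis by (intro that(2)) linarith+
        next
          case 3
          with bc show ?thesis by (intro that(3)) (simp, linarith+)
        qed
      qed
    qed
  qed
  then show ?thesis
  proof cases
    case 1
    then obtain u s v where w: "0 \<le> u" "0 \<le> s" "0 \<le> v"
      "wmat [(u, LP), (s, LW), (v, LQ)] = mat22 a b c d" and k: "u + 2 * s + v = phiD (mat22 a b c d)"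
      using caseD[of a d b c] det nn by blast
    show ?thesis
      by (rule *[OF _ _ w]) (use D(1) k in auto)
  next
    case 2
    then obtain u s v where w: "0 \<le> u" "0 \<le> s" "0 \<le> v"
      and m: "wmat [(u, LP), (s, LW), (v, LQ)] = mat22 d c b a"
      and k: "u + 2 * s + v = phiD (mat22 d c b a)"
      using caseD[of d a c b] det nn by (auto simp: mult.commute)
    show ?thesis
      by (rule *[OF _ _ w swapped[OF m]]) (use D(2) k in auto)
  next
    case 3
    then obtain u s v where w: "0 \<le> u" "0 \<le> s" "0 \<le> v"
      "wmat [(u, LP), (s, LW), (v, LP)] = mat22 a b c d" and k: "u + 2 * s + v = phiC (mat22 a b c d)"
      using caseC[of a d b c] det nn by auto
    show ?thesis
      by (rule *[OF _ _ w]) (use C(1) 3 k in auto)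
  next
    case 4
    then obtain u s v where w: "0 \<le> u" "0 \<le> s" "0 \<le> v"
      and m: "wmat [(u, LP), (s, LW), (v, LP)] = mat22 d c b a"
      and k: "u + 2 * s + v = phiC (mat22 d c b a)"
      using caseC[of d a c b] det nn by (auto simp: mult.commute)
    show ?thesis
      by (rule *[OF _ _ w swapped[OF m]]) (use C(2) 4 k in auto)
  qed
qed

lemma nonneg_normal_form:
  assumes "nonneg_word w"
  shows "\<exists>X Y u s v. X \<noteq> LW \<and> Y \<noteq> LW \<and> 0 \<le> u \<and> 0 \<le> s \<and> 0 \<le> v
    \<and> wmat [(u, X), (s, LW), (v, Y)] = wmat w \<and> u + 2 * s + v \<le> cost w"
proof -
  define g where "g = wmat w"
  define a b c d where "a = g $ 1 $ 1" and "b = g $ 1 $ 2" and "c = g $ 2 $ 1" and "d = g $ 2 $ 2"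
  have g: "g = mat22 a b c d"
    unfolding a_def b_def c_def d_def by (rule mat22_entries)
  have *: "0 \<le> g $ i $ j" "1 \<le> a" "1 \<le> d" "phiD g \<le> cost w + e" "phiD (swapM g) \<le> cost w + e"
    "c \<noteq> 0 \<longrightarrow> phiC g \<le> cost w + e" "b \<noteq> 0 \<longrightarrow> phiC (swapM g) \<le> cost w + e" if e: "0 < e" for e i j
  proof -
    obtain w' where w': "PQ_word w'" "nonneg_word w'" "wmat w' = g" "cost w' \<le> cost w + e"
      using approximate_by_PQ[OF e, of w] assms by (auto simp: g_def)
    have "swapL L \<noteq> LW" if "L \<noteq> LW" for L
      using that by (cases L) auto
    then have sw: "PQ_word (swap w')" "nonneg_word (swap w')"
      using w'(1,2) by (auto simp: PQ_word_def nonneg_word_def swap_def)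
    note 1 = phi_le_cost[OF w'(1,2), unfolded w'(3)]
    note 2 = phi_le_cost[OF sw, unfolded wmat_swap w'(3) cost_swap]
    have 11: "0 \<le> g $ i $ j" "1 \<le> a" "1 \<le> d" "phiD g \<le> cost w'"
      "(if c = 0 then b else phiC g) \<le> cost w'"
      using 1[of i j] unfolding a_def b_def c_def d_def by simp_all
    have 22: "phiD (swapM g) \<le> cost w'" "(if swapM g $ 2 $ 1 = 0 then swapM g $ 1 $ 2 else phiC (swapM g)) \<le> cost w'"
      using 2[of i j] by simp_all
    have "swapM g $ 2 $ 1 = b"
      by (simp add: b_def swapM_def)
    with 22(2) have 23: "b \<noteq> 0 \<longrightarrow> phiC (swapM g) \<le> cost w'"
      by (simp split: if_splits)
    show "0 \<le> g $ i $ j" "1 \<le> a" "1 \<le> d"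
      by (fact 11)+
    show "phiD g \<le> cost w + e"
      by (rule order_trans[OF 11(4) w'(4)])
    show "phiD (swapM g) \<le> cost w + e"
      by (rule order_trans[OF 22(1) w'(4)])
    show "c \<noteq> 0 \<longrightarrow> phiC g \<le> cost w + e"
      using 11(5) w'(4) by (simp split: if_splits)
    show "b \<noteq> 0 \<longrightarrow> phiC (swapM g) \<le> cost w + e"
      using 23 order_trans[OF _ w'(4)] by blast
  qed
  have "a * d - b * c = 1"
    using det_wmat[of w] unfolding g_def[symmetric] g by simp
  moreover have "0 \<le> b" "0 \<le> c" "1 \<le> a" "1 \<le> d"
    using *(1)[of 1 1 2] *(1)[of 1 2 1] *(2,3)[of 1] by (simp_all add: b_def c_def)
  moreover have "phiD g \<le> cost w" "phiD (swapM g) \<le> cost w"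
    using *(4,5) field_le_epsilon by blast+
  moreover have "phiC g \<le> cost w" if "c \<noteq> 0"
    using *(6) that field_le_epsilon by blast
  moreover have "phiC (swapM g) \<le> cost w" if "b \<noteq> 0"
    using *(7) that field_le_epsilon by blast
  ultimately show ?thesis
    unfolding g_def[symmetric] g by (rule normal_form_exists)
qed

section \<open>Normal words\<close>

text \<open>
The letters of X^u W^s Y^v with zero exponents left out and equal neighbours merged.
\<close>

definition normal_patterns :: "letter list set" where
  "normal_patterns = {[LP], [LQ], [LW], [LP, LQ], [LQ, LP], [LP, LW], [LQ, LW], [LW, LP], [LW, LQ],
     [LP, LW, LP], [LP, LW, LQ], [LQ, LW, LP], [LQ, LW, LQ]}"

definition signed :: "bool \<Rightarrow> word \<Rightarrow> bool" where
  "signed \<sigma> m \<longleftrightarrow> (\<forall>(t, L)\<in>set m. t \<noteq> 0 \<and> (0 < t \<longleftrightarrow> \<sigma>))"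

inductive normal :: "word \<Rightarrow> bool" where
  Nil: "normal []"
| run: "map snd m \<in> normal_patterns \<Longrightarrow> signed \<sigma> m \<Longrightarrow> normal w \<Longrightarrow> w = [] \<or> (0 < fst (hd w)) \<noteq> \<sigma> \<Longrightarrow> normal (m @ w)"

lemma reduce_pair:
  assumes "0 \<le> s" "0 \<le> t"
  shows "\<exists>m. wmat m = wmat [(s, L), (t, M)] \<and> cost m \<le> cost [(s, L), (t, M)] \<and> length m \<le> 2
    \<and> signed True m \<and> (m = [] \<or> map snd m \<in> normal_patterns)"
proof -
  let ?R = "\<lambda>m. wmat m = wmat [(s, L), (t, M)] \<and> cost m \<le> cost [(s, L), (t, M)] \<and> length m \<le> 2
    \<and> signed True m \<and> (m = [] \<or> map snd m \<in> normal_patterns)"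
  have one: "[K] \<in> normal_patterns" for K
    by (cases K) (simp_all add: normal_patterns_def)
  consider "s = 0" "t = 0" | "s = 0" "0 < t" | "0 < s" "t = 0" | "0 < s" "0 < t" "L = M" | "0 < s" "0 < t" "L \<noteq> M"
    using assms by linarith
  then show ?thesis
  proof cases
    case 1
    then have "?R []"
      by (simp add: flow_zero signed_def)
    then show ?thesis by blast
  next
    case 2
    then have "?R [(t, M)]"
      by (simp add: flow_zero signed_def one)
    then show ?thesis by blast
  next
    case 3
    then have "?R [(s, L)]"
      by (simp add: flow_zero signed_def one)
    then show ?thesis by blast
  next
    case 4
    have "wmat [(s + t, M)] = wmat [(s, M), (t, M)]"
      by (simp only: wmat.simps flow_merge)
    with 4 have "?R [(s + t, M)]"
      by (simp add: signed_def one algebra_simps)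
    then show ?thesis by blast
  next
    case 5
    then have "[L, M] \<in> normal_patterns"
      by (cases L; cases M) (simp_all add: normal_patterns_def)
    with 5 have "?R [(s, L), (t, M)]"
      by (simp add: signed_def)
    then show ?thesis by blast
  qed
qed

text \<open>
The bound on the length matters for blocks with fewer than three letters, where the normal form X^u W^s Y^v
could be longer.
\<close>

lemma positive_run:
  assumes "nonneg_word m"
  shows "\<exists>m'. wmat m' = wmat m \<and> cost m' \<le> cost m \<and> length m' \<le> length m
    \<and> signed True m' \<and> (m' = [] \<or> map snd m' \<in> normal_patterns)"
proof -
  consider "length m = 0" | "length m = 1" | "length m = 2" | "3 \<le> length m"
    by linarith
  then show ?thesis
  proof cases
    case 1
    then show ?thesis
      by (intro exI[of _ "[]"]) (simp add: signed_def)
  next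
    case 2
    then obtain t L where m: "m = [(t, L)]"
      by (metis One_nat_def length_0_conv length_Suc_conv prod.exhaust)
    show ?thesis
    proof (cases "t = 0")
      case True
      then show ?thesis
        using m by (intro exI[of _ "[]"]) (simp add: signed_def flow_zero)
    next
      case False
      then show ?thesis
        using m assms by (intro exI[of _ m], cases L) (auto simp: signed_def nonneg_word_def normal_patterns_def)
    qed
  next
    case 3
    then obtain s L t M where m: "m = [(s, L), (t, M)]"
      by (metis (no_types, lifting) One_nat_def Suc_1 length_0_conv length_Suc_conv prod.exhaust)
    then show ?thesis
      using reduce_pair[of s t L M] assms by (auto simp: nonneg_word_def)
  next
    case 4
    obtain X Y u s v where nf: "X \<noteq> LW" "Y \<noteq> LW" "0 \<le> u" "0 \<le> s" "0 \<le> v"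
      "wmat [(u, X), (s, LW), (v, Y)] = wmat m" "u + 2 * s + v \<le> cost m"
      using nonneg_normal_form[OF assms] by blast
    have rate1: "rate Z = 1" if "Z \<noteq> LW" for Z
      using that by (cases Z) simp_all
    note rate = rate1[OF nf(1)] rate1[OF nf(2)]
    show ?thesis
    proof (cases "s = 0")
      case True
      obtain m' where "wmat m' = wmat [(u, X), (v, Y)]" "cost m' \<le> cost [(u, X), (v, Y)]" "length m' \<le> 2"
        "signed True m'" "m' = [] \<or> map snd m' \<in> normal_patterns"
        using reduce_pair[OF nf(3,5), of X Y] by blast
      moreover have "wmat [(u, X), (v, Y)] = wmat m"
        using nf(6) True by (simp only: wmat.simps flow_zero one_mat22)
      ultimately show ?thesis
        using 4 nf rate True by (intro exI[of _ m']) auto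
    next
      case False
      with nf have s: "0 < s"
        by simp
      let ?m = "(if u = 0 then [] else [(u, X)]) @ [(s, LW)] @ (if v = 0 then [] else [(v, Y)])"
      have "wmat ?m = wmat m"
        using nf(6) by (auto simp only: if_True if_False append.simps wmat.simps flow_zero one_mat22 split: if_splits)
      moreover have "cost ?m = u + 2 * s + v"
        using nf(3-5) rate by simp
      moreover have "signed True ?m"
        using nf(3,5) s by (auto simp: signed_def)
      moreover have "map snd ?m \<in> normal_patterns"
        using nf(1,2) by (cases X; cases Y) (auto simp: normal_patterns_def)
      moreover have "length ?m \<le> 3"
        by simp
      ultimately show ?thesis
        using 4 nf(7) by (intro exI[of _ ?m]) auto
    qed
  qed
qed

lemma signed_neg: "signed \<sigma> (negate m) \<longleftrightarrow> signed (\<not> \<sigma>) m"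
  by (auto simp: signed_def negate_def)

lemma signed_run:
  assumes "signed \<sigma> m"
  shows "\<exists>m'. wmat m' = wmat m \<and> cost m' \<le> cost m \<and> length m' \<le> length m
    \<and> signed \<sigma> m' \<and> (m' = [] \<or> map snd m' \<in> normal_patterns)"
proof (cases \<sigma>)
  case True
  then have "nonneg_word m"
    using assms by (auto simp: signed_def nonneg_word_def)
  from positive_run[OF this] show ?thesis
    using True by simp
next
  case False
  then have "nonneg_word (negate m)"
    using assms by (auto simp: signed_def nonneg_word_def negate_def)
  from positive_run[OF this] obtain m' where m': "wmat m' = negM (wmat m)" "cost m' \<le> cost m"
    "length m' \<le> length m" "signed True m'" "m' = [] \<or> map snd m' \<in> normal_patterns"
    by auto
  have "map snd (negate m') = map snd m'"
    by (simp add: negate_def case_prod_unfold)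
  with m' False show ?thesis
    by (intro exI[of _ "negate m'"]) (auto simp: signed_neg)
qed

lemma signed_signs: "signed \<sigma> m \<Longrightarrow> signs m = replicate (length m) \<sigma>"
  by (induction m) (auto simp: signed_def)

lemma profile_signed: "signed \<sigma> m \<Longrightarrow> profile m = (if m = [] then [] else [\<sigma>])"
  by (simp add: profile_def signed_signs remdups_adj_replicate)

lemma normal_word_exists:
  "\<exists>w'. normal w' \<and> wmat w' = wmat w \<and> cost w' \<le> cost w \<and> length w' \<le> length w \<and> profile_le w' w"
proof (induction w rule: wmat.induct)
  case 1
  then show ?case
    by (intro exI[of _ "[]"]) (simp add: normal.Nil)
next
  case (2 t L r)
  then obtain r' where r': "normal r'" "wmat r' = wmat r" "cost r' \<le> cost r" "length r' \<le> length r" "profile_le r' r"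
    by blast
  have profile_le: "profile_le ((t, L) # r') ((t, L) # r)"
    using profile_le_context[OF r'(5), of "[(t, L)]" "[]"] by simp
  have c: "cost r' \<le> cost ((t, L) # r)"
    using r'(3) rate_pos[of L] by (simp add: add_increasing)
  show ?case
  proof (cases "t = 0")
    case True
    have "profile_le r' ((t, L) # r)"
      using r'(5) True by (simp add: profile_le_def profile_def)
    then show ?thesis
      using True r' c by (intro exI[of _ r']) (simp add: flow_zero)
  next
    case False
    define \<sigma> where "\<sigma> \<longleftrightarrow> 0 < t"
    have s1: "signed \<sigma> [(t, L)]"
      using False by (simp add: signed_def \<sigma>_def)
    show ?thesis
    proof (cases "r' = [] \<or> (0 < fst (hd r')) \<noteq> \<sigma>")
      case True
      have "map snd [(t, L)] \<in> normal_patterns"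
        by (cases L) (simp_all add: normal_patterns_def)
      from normal.run[OF this s1 r'(1) True] show ?thesis
        using r' profile_le by (intro exI[of _ "(t, L) # r'"]) simp
    next
      case F: False
      from r'(1) F obtain m \<tau> r'' where m: "r' = m @ r''" "map snd m \<in> normal_patterns" "signed \<tau> m" "normal r''"
        "r'' = [] \<or> (0 < fst (hd r'')) \<noteq> \<tau>"
        by (cases rule: normal.cases) auto
      have "m \<noteq> []"
        using m(2) by (auto simp: normal_patterns_def)
      then have "\<tau> = \<sigma>"
        using m(1,3) F by (cases m) (auto simp: signed_def)
      then have "signed \<sigma> ((t, L) # m)"
        using m(3) s1 by (simp add: signed_def)
      from signed_run[OF this] obtain m' where m': "wmat m' = wmat ((t, L) # m)"
        "cost m' \<le> cost ((t, L) # m)" "length m' \<le> length ((t, L) # m)" "signed \<sigma> m'"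
        "m' = [] \<or> map snd m' \<in> normal_patterns"
        by blast
      have "normal (m' @ r'')"
        using m'(5) normal.run[OF _ m'(4) m(4)] m(4,5) \<open>\<tau> = \<sigma>\<close> by auto
      moreover have "wmat (m' @ r'') = wmat ((t, L) # r)"
        using m'(1) r'(2) m(1) by (simp add: matrix_mul_assoc[symmetric])
      moreover have "cost (m' @ r'') \<le> cost ((t, L) # r)"
        using m'(2) r'(3) m(1) by simp
      moreover have "length (m' @ r'') \<le> length ((t, L) # r)"
        using m'(3) r'(4) m(1) by simp
      moreover have "profile_le m' ((t, L) # m)"
        using profile_signed[OF m'(4)] profile_signed[OF \<open>signed \<sigma> ((t, L) # m)\<close>] by (simp add: profile_le_def)
      then have "profile_le (m' @ r'') ((t, L) # r)"
        using profile_le_context[of m' "(t, L) # m" "[]" r''] profile_le_trans[OF _ profile_le] m(1) by simp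
      ultimately show ?thesis
        by blast
    qed
  qed
qed

lemma remdups_adj_replicate_append:
  "xs = [] \<or> hd xs \<noteq> a \<Longrightarrow> 0 < n \<Longrightarrow> remdups_adj (replicate n a @ xs) = a # remdups_adj xs"
proof (induction n)
  case (Suc n)
  then show ?case
    by (cases n) (auto simp: remdups_adj_hd)
qed simp

lemma normal_nonzero: "normal w \<Longrightarrow> (t, L) \<in> set w \<Longrightarrow> t \<noteq> 0"
  by (induction rule: normal.induct) (auto simp: signed_def)

lemma normal_length: "normal w \<Longrightarrow> length w \<le> 3 * length (profile w)"
proof (induction rule: normal.induct)
  case (run m \<sigma> w)
  have "w = [] \<or> signs w \<noteq> [] \<and> hd (signs w) = (0 < fst (hd w))"
  proof (cases w)
    case (Cons a r)
    with normal_nonzero[OF run.hyps(3), of "fst a" "snd a"] show ?thesis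
      by (cases a) auto
  qed simp
  then have "signs w = [] \<or> hd (signs w) \<noteq> \<sigma>"
    using run.hyps(4) by auto
  moreover have "0 < length m" "length m \<le> 3"
    using run.hyps(1) by (auto simp: normal_patterns_def)
  ultimately have "profile (m @ w) = \<sigma> # profile w"
    using run.hyps(2) remdups_adj_replicate_append[of "signs w" \<sigma> "length m"]
    by (simp add: profile_def signed_signs)
  with run.IH \<open>length m \<le> 3\<close> show ?case
    by simp
qed simp

section \<open>Existence of irreducible words\<close>

text \<open>
Zero exponents are allowed, so that the exponents with a given pattern form a closed set.
\<close>

definition matches :: "word \<Rightarrow> (bool \<times> letter) list \<Rightarrow> bool" where
  "matches = list_all2 (\<lambda>(t, L) (b, M). L = M \<and> (if b then 0 \<le> t else t \<le> 0))"

definition attained :: "(bool \<times> letter) list \<Rightarrow> real \<Rightarrow> ((real^2^2) \<times> real) set" where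
  "attained ls B = {(wmat w, cost w) | w. matches w ls \<and> cost w \<le> B}"

lemma continuous_on_mat22 [continuous_intros]:
  assumes "continuous_on S a" "continuous_on S b" "continuous_on S c" "continuous_on S d"
  shows "continuous_on S (\<lambda>x. mat22 (a x) (b x) (c x) (d x))"
  unfolding continuous_on_def
proof (intro ballI vec_tendstoI)
  fix x i j
  assume "x \<in> S"
  then show "((\<lambda>x. mat22 (a x) (b x) (c x) (d x) $ i $ j) \<longlongrightarrow> mat22 (a x) (b x) (c x) (d x) $ i $ j) (at x within S)"
    using assms exhaust_2[of i] exhaust_2[of j] by (auto simp: continuous_on_def)
qed

lemma flow_mult: "flow L t ** g = (case L of
    LP \<Rightarrow> mat22 (g $ 1 $ 1 + t * g $ 2 $ 1) (g $ 1 $ 2 + t * g $ 2 $ 2) (g $ 2 $ 1) (g $ 2 $ 2)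
  | LQ \<Rightarrow> mat22 (g $ 1 $ 1) (g $ 1 $ 2) (t * g $ 1 $ 1 + g $ 2 $ 1) (t * g $ 1 $ 2 + g $ 2 $ 2)
  | LW \<Rightarrow> mat22 (cosh t * g $ 1 $ 1 + sinh t * g $ 2 $ 1) (cosh t * g $ 1 $ 2 + sinh t * g $ 2 $ 2)
      (sinh t * g $ 1 $ 1 + cosh t * g $ 2 $ 1) (sinh t * g $ 1 $ 2 + cosh t * g $ 2 $ 2))"
  by (subst (1) mat22_entries[of g]) (cases L; simp)

text \<open>
By induction on the pattern, as the continuous image of a closed subset of the product of an interval with the
compact set for the remaining letters.
\<close>

lemma compact_attained: "compact (attained ls B)"
proof (induction ls)
  case Nil
  have "attained [] B \<subseteq> {(wmat [], 0)}"
    by (auto simp: attained_def matches_def)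
  then show ?case
    using finite_subset finite_imp_compact by blast
next
  case (Cons l ls)
  obtain b L where l: "l = (b, L)"
    by (cases l)
  define f where "f = (\<lambda>(t, g :: real^2^2, c). (flow L t ** g, rate L * \<bar>t\<bar> + c :: real))"
  define I where "I = (if b then {0..B} else {- B..0})"
  define K where "K = (I \<times> attained ls B) \<inter> {(t, g, c). rate L * \<bar>t\<bar> + c \<le> B}"
  have "closed {(t::real, g::real^2^2, c::real). rate L * \<bar>t\<bar> + c \<le> B}"
    unfolding case_prod_unfold by (intro closed_Collect_le continuous_intros)
  then have "compact K"
    unfolding K_def by (intro compact_Int_closed compact_Times Cons) (auto simp: I_def)
  moreover have "continuous_on K f"
    unfolding f_def flow_mult case_prod_unfold
    by (cases L) (auto intro!: continuous_intros)
  ultimately have "compact (f ` K)"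
    by (rule compact_continuous_image[rotated])
  moreover have "attained (l # ls) B = f ` K"
  proof (intro equalityI subsetI)
    fix p
    assume "p \<in> attained (l # ls) B"
    then obtain t w where w: "p = (flow L t ** wmat w, rate L * \<bar>t\<bar> + cost w)" "if b then 0 \<le> t else t \<le> 0"
      "matches w ls" "rate L * \<bar>t\<bar> + cost w \<le> B"
      by (auto simp: attained_def matches_def l list_all2_Cons2)
    have "\<bar>t\<bar> \<le> rate L * \<bar>t\<bar>"
      by (cases L) auto
    then have "\<bar>t\<bar> \<le> B" "cost w \<le> B"
      using w(4) cost_nonneg[of w] rate_pos[of L] by (auto intro: order_trans[rotated] simp: add_increasing)
    then have "(t, wmat w, cost w) \<in> K"
      using w by (auto simp: K_def I_def attained_def split: if_splits)
    then show "p \<in> f ` K"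
      using w(1) by (force simp: f_def)
  next
    fix p
    assume "p \<in> f ` K"
    then obtain t h c where "(t, h, c) \<in> K" "p = (flow L t ** h, rate L * \<bar>t\<bar> + c)"
      by (auto simp: f_def)
    moreover from this obtain w where "matches w ls" "h = wmat w" "c = cost w"
      by (auto simp: K_def attained_def)
    ultimately have "t \<in> I" "matches w ls" "rate L * \<bar>t\<bar> + cost w \<le> B"
      "p = (flow L t ** wmat w, rate L * \<bar>t\<bar> + cost w)"
      by (auto simp: K_def)
    then show "p \<in> attained (l # ls) B"
      unfolding attained_def
      by (intro CollectI exI[of _ "(t, L) # w"]) (auto simp: matches_def l I_def split: if_splits)
  qed
  ultimately show ?case
    by simp
qed

lemma matches_signs: "matches w ls \<Longrightarrow> subseq (signs w) (map fst ls)"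
proof (induction w arbitrary: ls)
  case (Cons a w)
  obtain t L where a: "a = (t, L)"
    by (cases a)
  from Cons.prems obtain b ls' where ls: "ls = (b, L) # ls'" "if b then 0 \<le> t else t \<le> 0" "matches w ls'"
    by (auto simp: matches_def list_all2_Cons1 a)
  from Cons.IH[OF ls(3)] have "subseq (signs w) (map fst ls')" .
  with ls(1,2) show ?case
    by (cases "t = 0") (auto simp: a split: if_splits)
qed simp

lemma matches_self:
  "\<forall>(t, L)\<in>set w. t \<noteq> 0 \<Longrightarrow> matches w (map (\<lambda>(t, L). (0 < t, L)) w)
    \<and> map fst (map (\<lambda>(t, L). (0 < t, L)) w) = signs w"
  by (induction w) (auto simp: matches_def)

text \<open>
Normal words with at most n blocks have at most 3n letters and hence finitely many patterns, so the costs
they attain for a given matrix form a compact set.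
\<close>

lemma irreducible_word_exists:
  assumes w0: "length (profile w0) \<le> n"
  shows "\<exists>w. normal w \<and> irreducible w \<and> wmat w = wmat w0 \<and> length (profile w) \<le> n
    \<and> (\<forall>w'. wmat w' = wmat w0 \<and> length (profile w') \<le> n \<longrightarrow> cost w \<le> cost w')"
proof -
  define g where "g = wmat w0"
  define B where "B = cost w0"
  define A where "A = {w. wmat w = g \<and> length (profile w) \<le> n}"
  define LS where "LS = {ls :: (bool \<times> letter) list. length ls \<le> 3 * n \<and> length (remdups_adj (map fst ls)) \<le> n}"
  define K where "K = (\<Union>ls\<in>LS. snd ` (attained ls B \<inter> {g} \<times> UNIV))"
  have leq_len: "length (profile u) \<le> length (profile v)" if "profile_le u v" for u v
    using that list_emb_length by (auto simp: profile_le_def)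
  have "finite {ls :: (bool \<times> letter) list. set ls \<subseteq> UNIV \<and> length ls \<le> 3 * n}"
  proof (rule finite_lists_length_le)
    have "(UNIV :: letter set) = {LP, LQ, LW}"
      using letter.exhaust by auto
    then have "finite (UNIV :: letter set)"
      by (metis finite.emptyI finite.insertI)
    then show "finite (UNIV :: (bool \<times> letter) set)"
      by (simp add: finite_prod)
  qed
  then have "finite LS"
    by (rule finite_subset[rotated]) (auto simp: LS_def)
  moreover have "compact (snd ` (attained ls B \<inter> {g} \<times> UNIV))" for ls
    by (intro compact_continuous_image continuous_intros compact_Int_closed compact_attained closed_Times)
  ultimately have K: "compact K"
    unfolding K_def by (intro compact_UN) auto
  have inK: "cost w \<in> K" if "w \<in> A" "normal w" "cost w \<le> B" for w
  proof -
    let ?ls = "map (\<lambda>(t, L). (0 < t, L)) w"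
    have "matches w ?ls" "map fst ?ls = signs w"
      using matches_self[of w] normal_nonzero[OF that(2)] by auto
    moreover have "?ls \<in> LS"
      using normal_length[OF that(2)] that(1) \<open>map fst ?ls = signs w\<close> by (simp add: LS_def A_def profile_def)
    moreover have "(g, cost w) \<in> attained ?ls B"
      using that \<open>matches w ?ls\<close> by (auto simp: attained_def A_def)
    ultimately show ?thesis
      unfolding K_def by force
  qed
  have normalA: "\<exists>w'\<in>A. normal w' \<and> cost w' \<le> cost w \<and> length w' \<le> length w" if w: "w \<in> A" for w
  proof -
    obtain w' where "normal w'" "wmat w' = wmat w" "cost w' \<le> cost w" "length w' \<le> length w" "profile_le w' w"
      using normal_word_exists by blast
    with w leq_len show ?thesis
      by (force simp: A_def)
  qed
  have "w0 \<in> A"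
    using w0 by (simp add: A_def g_def)
  from normalA[OF this] inK have "K \<noteq> {}"
    by (auto simp: B_def)
  with K obtain c where c: "c \<in> K" "\<And>k. k \<in> K \<Longrightarrow> c \<le> k"
    using compact_attains_inf by metis
  from c(1) obtain ls w1 where w1: "ls \<in> LS" "matches w1 ls" "wmat w1 = g" "cost w1 = c" "c \<le> B"
    by (auto simp: K_def attained_def)
  have "length (profile w1) \<le> length (remdups_adj (map fst ls))"
    using subseq_remdups_adj[OF matches_signs[OF w1(2)]] list_emb_length by (auto simp: profile_def)
  then have "w1 \<in> A"
    using w1 by (simp add: A_def LS_def)
  have low: "c \<le> cost w" if w: "w \<in> A" for w
  proof -
    obtain w' where "w' \<in> A" "normal w'" "cost w' \<le> cost w"
      using normalA[OF w] by blast
    then show ?thesis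
      using inK[of w'] c(2)[of "cost w'"] w1(5) by (cases "cost w' \<le> B") auto
  qed
  obtain w2 where w2: "w2 \<in> A" "cost w2 = c" "\<And>w. w \<in> A \<Longrightarrow> cost w = c \<Longrightarrow> length w2 \<le> length w"
    using ex_has_least_nat[of "\<lambda>w. w \<in> A \<and> cost w = c" w1 length] \<open>w1 \<in> A\<close> w1(4) by blast
  obtain w where w: "w \<in> A" "normal w" "cost w \<le> cost w2" "length w \<le> length w2"
    using normalA[OF w2(1)] by blast
  then have wc: "cost w = c"
    using low[OF w(1)] w2(2) by simp
  have "irreducible w"
    unfolding irreducible_def
  proof (intro allI impI)
    fix w'
    assume "wmat w' = wmat w \<and> profile_le w' w"
    then have "w' \<in> A"
      using w(1) leq_len[of w' w] by (auto simp: A_def)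
    then show "cost w < cost w' \<or> cost w = cost w' \<and> length w \<le> length w'"
      using low[of w'] w2(3)[of w'] wc w(4) by fastforce
  qed
  with w low wc show ?thesis
    by (intro exI[of _ w]) (auto simp: A_def g_def)
qed

section \<open>Sign patterns\<close>

type_synonym symbol = "bool \<times> letter"

text \<open>
Signs together with letters; the profile forgets the letters and merges equal neighbours.
\<close>

definition pattern :: "word \<Rightarrow> symbol list" where
  "pattern w = map (\<lambda>(t, L). (0 < t, L)) w"

abbreviation (input) "pP \<equiv> (True, LP)"
abbreviation (input) "nP \<equiv> (False, LP)"
abbreviation (input) "pQ \<equiv> (True, LQ)"
abbreviation (input) "nQ \<equiv> (False, LQ)"
abbreviation (input) "pW \<equiv> (True, LW)"
abbreviation (input) "nW \<equiv> (False, LW)"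

definition symbols :: "symbol list" where
  "symbols = [pP, nP, pQ, nQ, pW, nW]"

definition negS :: "symbol list \<Rightarrow> symbol list" where
  "negS = map (\<lambda>(b, L). (\<not> b, L))"

definition swapS :: "symbol list \<Rightarrow> symbol list" where
  "swapS = map (\<lambda>(b, L). (b, swapL L))"

text \<open>
The shortest letter sequences that do not occur within a normal block.
\<close>

definition run_bad_letters :: "letter list list" where
  "run_bad_letters = [[LP, LP], [LQ, LQ], [LW, LW], [LP, LQ, LP], [LQ, LP, LQ], [LP, LQ, LW],
     [LQ, LP, LW], [LW, LP, LQ], [LW, LQ, LP], [LW, LP, LW], [LW, LQ, LW]]"

definition run_bad :: "symbol list list" where
  "run_bad = concat (map (\<lambda>b. map (map (Pair b)) run_bad_letters) [True, False])"

text \<open>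
The patterns excluded by the facts about irreducible words, one from each class under change of sign, exchange
of P and Q, and reversal.
\<close>

definition irreducible_bad :: "symbol list list" where
  "irreducible_bad = [[pP, nP], [pW, nW], [pW, nP], [pW, pQ, nP, nQ], [pW, pQ, nP, nW], [pP, pQ, nP, pQ],
     [pW, pQ, nP, pQ, pW], [pP, pW, pQ, nP, pQ], [pW, pQ, nP, pQ, nP], [pP, pQ, nP, nQ, pP],
     [pP, nQ, pP, nQ, pP, nQ], [nP, pQ, nP, nW, nP, pQ, nP]]"

definition forbidden :: "symbol list list" where
  "forbidden = run_bad @ concat (map (\<lambda>f. concat (map (\<lambda>g. [g, negS g, swapS g, negS (swapS g)]) [f, rev f])) irreducible_bad)"

definition admissible :: "symbol list \<Rightarrow> bool" where
  "admissible v \<longleftrightarrow> (\<forall>l m r. v = l @ m @ r \<longrightarrow> m \<notin> set forbidden)"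

fun starts :: "symbol list \<Rightarrow> symbol list \<Rightarrow> bool" where
  "starts [] v = True"
| "starts (x # f) [] = False"
| "starts (x # f) (y # v) = (if x = y then starts f v else False)"

fun starts_with_some :: "symbol list list \<Rightarrow> symbol list \<Rightarrow> bool" where
  "starts_with_some [] v = False"
| "starts_with_some (f # F) v = (if starts f v then True else starts_with_some F v)"

text \<open>
Patterns grow at the front, so only initial segments need to be compared with the forbidden factors.
\<close>

definition extend :: "symbol list list \<Rightarrow> symbol list list" where
  "extend V = (let F = forbidden in
     filter (\<lambda>v. \<not> starts_with_some F v) (concat (map (\<lambda>v. map (\<lambda>x. x # v) symbols) V)))"

lemma starts_prefix: "starts f v \<Longrightarrow> prefix f v"
  by (induction f v rule: starts.induct) (auto split: if_splits)

lemma starts_with_some_prefix: "starts_with_some F v \<Longrightarrow> \<exists>f\<in>set F. prefix f v"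
  by (induction F) (auto dest: starts_prefix split: if_splits)

lemma admissible_Cons:
  assumes "admissible (x # v)"
  shows "admissible v" "v \<in> set V \<Longrightarrow> x # v \<in> set (extend V)"
proof -
  show "admissible v"
    unfolding admissible_def
  proof (intro allI impI)
    fix l m r
    assume "v = l @ m @ r"
    then have "x # v = (x # l) @ m @ r"
      by simp
    then show "m \<notin> set forbidden"
      using assms unfolding admissible_def by blast
  qed
  have "\<not> prefix f (x # v)" if "f \<in> set forbidden" for f
  proof
    assume "prefix f (x # v)"
    then obtain r where "x # v = [] @ f @ r"
      by (auto elim: prefixE)
    with that assms show False
      unfolding admissible_def by blast
  qed
  moreover have "x \<in> set symbols"
    by (cases x; cases "snd x") (auto simp: symbols_def)
  ultimately show "v \<in> set V \<Longrightarrow> x # v \<in> set (extend V)"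
    by (auto simp: extend_def Let_def dest: starts_with_some_prefix)
qed

text \<open>
The patterns that end in P or W with a positive exponent, by length. No pattern with seven symbols is left.
\<close>

lemma extend_1:
  "extend [[pP],
     [pW]]
    = [[pQ, pP],
     [nQ, pP],
     [pW, pP],
     [pP, pW],
     [pQ, pW]]"
  by code_simp

lemma extend_2:
  "extend [[pQ, pP],
     [nQ, pP],
     [pW, pP],
     [pP, pW],
     [pQ, pW]]
    = [[nP, pQ, pP],
     [pP, nQ, pP],
     [nP, nQ, pP],
     [nW, nQ, pP],
     [pP, pW, pP],
     [pQ, pW, pP],
     [nQ, pP, pW],
     [nP, pQ, pW]]"
  by code_simp

lemma extend_3:
  "extend [[nP, pQ, pP],
     [pP, nQ, pP],
     [nP, nQ, pP],
     [nW, nQ, pP],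
     [pP, pW, pP],
     [pQ, pW, pP],
     [nQ, pP, pW],
     [nP, pQ, pW]]
    = [[nQ, nP, pQ, pP],
     [nQ, pP, nQ, pP],
     [pW, pP, nQ, pP],
     [pQ, nP, nQ, pP],
     [nP, nW, nQ, pP],
     [nQ, nW, nQ, pP],
     [nQ, pP, pW, pP],
     [nP, pQ, pW, pP],
     [pP, nQ, pP, pW],
     [pQ, nP, pQ, pW]]"
  by code_simp

lemma extend_4:
  "extend [[nQ, nP, pQ, pP],
     [nQ, pP, nQ, pP],
     [pW, pP, nQ, pP],
     [pQ, nP, nQ, pP],
     [nP, nW, nQ, pP],
     [nQ, nW, nQ, pP],
     [nQ, pP, pW, pP],
     [nP, pQ, pW, pP],
     [pP, nQ, pP, pW],
     [pQ, nP, pQ, pW]]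
    = [[pP, nQ, pP, nQ, pP],
     [pP, pW, pP, nQ, pP],
     [pQ, nP, nW, nQ, pP],
     [pP, nQ, nW, nQ, pP],
     [pP, nQ, pP, pW, pP]]"
  by code_simp

lemma extend_5:
  "extend [[pP, nQ, pP, nQ, pP],
     [pP, pW, pP, nQ, pP],
     [pQ, nP, nW, nQ, pP],
     [pP, nQ, nW, nQ, pP],
     [pP, nQ, pP, pW, pP]]
    = [[nQ, pP, pW, pP, nQ, pP],
     [nQ, pP, nQ, nW, nQ, pP]]"
  by code_simp

lemma extend_6:
  "extend [[nQ, pP, pW, pP, nQ, pP],
     [nQ, pP, nQ, nW, nQ, pP]]
    = []"
  by code_simp

section \<open>The families\<close>

type_synonym affine_form = "real \<times> real \<times> real \<times> real"

text \<open>
One representative of each family under change of sign and exchange of P and Q; an exponent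
a + b r + c s + d t is encoded as (a, b, c, d).
\<close>

definition bases :: "(affine_form \<times> letter) list list" where
  "bases = (let
      r = (0, 1, 0, 0); s = (0, 0, 1, 0); t = (0, 0, 0, 1);
      r' = (0, - 1, 0, 0); s' = (0, 0, - 1, 0); t' = (0, 0, 0, - 1);
      k = (sqrt 2, 0, 0, 0); k' = (- sqrt 2, 0, 0, 0); kk = (2 * sqrt 2, 0, 0, 0)
    in
     [[(r, LP), (s, LW), (t, LP)],
      [(r, LP), (s, LW), (t, LQ)],
      [(r', LQ), (k, LP), (s, LW), (t, LP)],
      [(r', LQ), (k, LP), (s, LW), (t, LQ)],
      [(r, LP), (s, LW), (k, LP), (t', LQ)],
      [(r, LQ), (s, LW), (k, LP), (t', LQ)],
      [(r', LQ), (k, LP), (s, LW), (k, LP), (t', LQ)],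
      [(r', LQ), (k, LP), (s, LW), (k, LQ), (t', LP)],
      [(r, LP), (s, LQ), (t', LP)],
      [(r, LP), (s', LQ), (t', LP)],
      [(r, LP), (s, LQ), (s', LP), (t', LQ)],
      [(r, LP), (s', LQ), (s', LP), (t, LQ)],
      [(r, LP), (s', LQ), (t, LP)],
      [(r, LP), (s', LQ), (s, LP), (t', LQ)],
      [(r, LP), (s', LQ), (s, LP), (s', LQ), (t, LP)],
      [(r', LP), (kk, LQ), (k', LP), (s', LW), (k', LP), (t, LQ)]])"

definition instantiate :: "(affine_form \<times> letter) list \<Rightarrow> real \<Rightarrow> real \<Rightarrow> real \<Rightarrow> word" where
  "instantiate B r s t = map (\<lambda>((a, b, c, d), L). (a + b * r + c * s + d * t, L)) B"

definition act :: "bool \<Rightarrow> bool \<Rightarrow> word \<Rightarrow> word" where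
  "act n x w = (if n then negate else id) ((if x then swap else id) w)"

definition covered :: "word \<Rightarrow> bool" where
  "covered w \<longleftrightarrow> (\<exists>B\<in>set bases. \<exists>n x r s t. 0 \<le> r \<and> 0 \<le> s \<and> 0 \<le> t
     \<and> wmat (instantiate B r s t) = wmat (act n x w) \<and> cost (instantiate B r s t) = cost w)"

lemma length_bases: "length bases = 16"
  by (simp add: bases_def Let_def)

lemma instantiate_bases:
  "instantiate (bases ! 0) r s t = [(r, LP), (s, LW), (t, LP)]"
  "instantiate (bases ! 1) r s t = [(r, LP), (s, LW), (t, LQ)]"
  "instantiate (bases ! 2) r s t = [(- r, LQ), (sqrt 2, LP), (s, LW), (t, LP)]"
  "instantiate (bases ! 3) r s t = [(- r, LQ), (sqrt 2, LP), (s, LW), (t, LQ)]"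
  "instantiate (bases ! 4) r s t = [(r, LP), (s, LW), (sqrt 2, LP), (- t, LQ)]"
  "instantiate (bases ! 5) r s t = [(r, LQ), (s, LW), (sqrt 2, LP), (- t, LQ)]"
  "instantiate (bases ! 6) r s t = [(- r, LQ), (sqrt 2, LP), (s, LW), (sqrt 2, LP), (- t, LQ)]"
  "instantiate (bases ! 7) r s t = [(- r, LQ), (sqrt 2, LP), (s, LW), (sqrt 2, LQ), (- t, LP)]"
  "instantiate (bases ! 8) r s t = [(r, LP), (s, LQ), (- t, LP)]"
  "instantiate (bases ! 9) r s t = [(r, LP), (- s, LQ), (- t, LP)]"
  "instantiate (bases ! 10) r s t = [(r, LP), (s, LQ), (- s, LP), (- t, LQ)]"
  "instantiate (bases ! 11) r s t = [(r, LP), (- s, LQ), (- s, LP), (t, LQ)]"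
  "instantiate (bases ! 12) r s t = [(r, LP), (- s, LQ), (t, LP)]"
  "instantiate (bases ! 13) r s t = [(r, LP), (- s, LQ), (s, LP), (- t, LQ)]"
  "instantiate (bases ! 14) r s t = [(r, LP), (- s, LQ), (s, LP), (- s, LQ), (t, LP)]"
  "instantiate (bases ! 15) r s t = [(- r, LP), (2 * sqrt 2, LQ), (- sqrt 2, LP), (- s, LW), (- sqrt 2, LP), (t, LQ)]"
  by (simp_all add: instantiate_def bases_def Let_def)

lemmas cover_simps = instantiate_bases instantiate_bases(2)[unfolded One_nat_def] act_def length_bases

lemma coveredI:
  assumes "i < length bases" "0 \<le> r" "0 \<le> s" "0 \<le> t"
    "wmat (instantiate (bases ! i) r s t) = wmat (act n x w)" "cost (instantiate (bases ! i) r s t) = cost w"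
  shows "covered w"
  unfolding covered_def using assms nth_mem by blast

lemma abs_neg_sqrt2: "0 < x \<Longrightarrow> \<bar>- x - sqrt 2\<bar> = x + sqrt 2"
  using real_sqrt_ge_zero[of 2] by linarith

lemma sqrt2_cancel: "sqrt 2 * (sqrt 2 * x) = 2 * x"
  by (simp flip: mult.assoc)

section \<open>Classification of irreducible words\<close>

lemma pattern_simps:
  "pattern [] = []" "pattern ((t, L) # w) = (0 < t, L) # pattern w" "pattern (l @ r) = pattern l @ pattern r"
  by (simp_all add: pattern_def)

definition clean :: "symbol list \<Rightarrow> bool" where
  "clean v \<longleftrightarrow> (\<forall>l m r. v = l @ m @ r \<longrightarrow> m \<notin> set run_bad)"

lemma clean_Cons: "clean (x # v) \<longleftrightarrow> clean v \<and> (\<forall>f\<in>set run_bad. \<not> prefix f (x # v))"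
proof
  assume c: "clean (x # v)"
  have "clean v"
    unfolding clean_def
  proof (intro allI impI)
    fix l m r
    assume "v = l @ m @ r"
    then have "x # v = (x # l) @ m @ r"
      by simp
    then show "m \<notin> set run_bad"
      using c unfolding clean_def by blast
  qed
  moreover have "\<not> prefix f (x # v)" if "f \<in> set run_bad" for f
  proof
    assume "prefix f (x # v)"
    then obtain r where "x # v = [] @ f @ r"
      by (auto elim: prefixE)
    with that c show False
      unfolding clean_def by blast
  qed
  ultimately show "clean v \<and> (\<forall>f\<in>set run_bad. \<not> prefix f (x # v))"
    by blast
next
  assume c: "clean v \<and> (\<forall>f\<in>set run_bad. \<not> prefix f (x # v))"
  show "clean (x # v)"
    unfolding clean_def
  proof (intro allI impI)
    fix l m r
    assume e: "x # v = l @ m @ r"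
    show "m \<notin> set run_bad"
    proof (cases l)
      case Nil
      with e c show ?thesis
        by (metis append_Nil prefixI)
    next
      case (Cons y l')
      with e have "v = l' @ m @ r"
        by simp
      with c show ?thesis
        unfolding clean_def by blast
    qed
  qed
qed

fun clean_letters :: "letter list \<Rightarrow> bool" where
  "clean_letters [] = True"
| "clean_letters (K # Ls) \<longleftrightarrow> list_all (\<lambda>k. \<not> prefix k (K # Ls)) run_bad_letters \<and> clean_letters Ls"

lemma normal_patterns_clean: "Ls \<in> normal_patterns \<Longrightarrow> clean_letters Ls"
  by (auto simp: normal_patterns_def run_bad_letters_def)

lemma prefix_same_sign:
  "prefix (map (Pair b) k) (map (Pair \<sigma>) Ls @ v) \<Longrightarrow> v = [] \<or> fst (hd v) \<noteq> \<sigma> \<Longrightarrow> Ls \<noteq> [] \<Longrightarrow> prefix k Ls"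
proof (induction k arbitrary: Ls)
  case (Cons K k)
  then obtain Ls' where Ls: "Ls = K # Ls'" and b: "b = \<sigma>"
    by (cases Ls) auto
  show ?case
  proof (cases "Ls' = []")
    case True
    have "k = []"
    proof (rule ccontr)
      assume "k \<noteq> []"
      with Cons.prems Ls True b show False
        by (cases k; cases v) auto
    qed
    with Ls show ?thesis
      by simp
  next
    case False
    with Cons.IH[of Ls'] Cons.prems Ls b show ?thesis
      by simp
  qed
qed simp

lemma clean_run:
  assumes "clean v" "v = [] \<or> fst (hd v) \<noteq> \<sigma>"
  shows "clean_letters Ls \<Longrightarrow> clean (map (Pair \<sigma>) Ls @ v)"
proof (induction Ls)
  case (Cons K Ls)
  have "\<not> prefix f (map (Pair \<sigma>) (K # Ls) @ v)" if f: "f \<in> set run_bad" for f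
  proof
    assume p: "prefix f (map (Pair \<sigma>) (K # Ls) @ v)"
    obtain b k where "k \<in> set run_bad_letters" "f = map (Pair b) k"
      using f by (auto simp: run_bad_def)
    with prefix_same_sign[of b k \<sigma> "K # Ls" v] p assms(2) Cons.prems show False
      by (simp add: list_all_iff)
  qed
  with Cons show ?case
    by (simp add: clean_Cons)
qed (simp add: assms)

lemma normal_clean: "normal w \<Longrightarrow> clean (pattern w)"
proof (induction rule: normal.induct)
  case Nil
  then show ?case
    by (auto simp: clean_def pattern_def run_bad_def run_bad_letters_def)
next
  case (run m \<sigma> w)
  have m: "pattern m = map (Pair \<sigma>) (map snd m)"
    using run.hyps(2) by (auto simp: pattern_def signed_def)
  have "pattern w = [] \<or> fst (hd (pattern w)) \<noteq> \<sigma>"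
    using run.hyps(4) by (cases w) (auto simp: pattern_def)
  then show ?case
    using clean_run[OF run.IH _ normal_patterns_clean[OF run.hyps(1)]] by (simp add: pattern_simps m)
qed

definition patterns :: "symbol list set" where
  "patterns = {
     [pP],
     [pW],
     [pP, pQ],
     [pP, nQ],
     [pP, pW],
     [pW, pP],
     [pW, pQ],
     [pP, pQ, nP],
     [pP, nQ, pP],
     [pP, nQ, nP],
     [pP, nQ, nW],
     [pP, pW, pP],
     [pP, pW, pQ],
     [pW, pP, nQ],
     [pW, pQ, nP],
     [pP, pQ, nP, nQ],
     [pP, nQ, pP, nQ],
     [pP, nQ, pP, pW],
     [pP, nQ, nP, pQ],
     [pP, nQ, nW, nP],
     [pP, nQ, nW, nQ],
     [pP, pW, pP, nQ],
     [pP, pW, pQ, nP],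
     [pW, pP, nQ, pP],
     [pW, pQ, nP, pQ],
     [pP, nQ, pP, nQ, pP],
     [pP, nQ, pP, pW, pP],
     [pP, nQ, nW, nP, pQ],
     [pP, nQ, nW, nQ, pP],
     [pP, pW, pP, nQ, pP],
     [pP, nQ, pP, pW, pP, nQ],
     [pP, nQ, nW, nQ, pP, nQ]}"

text \<open>
Turns an equation for the pattern into positive absolute values of the exponents.
\<close>

lemma decode_pattern:
  assumes "pattern w = v" "\<forall>(t, L)\<in>set w. t \<noteq> 0"
  shows "\<exists>as. length as = length v \<and> (\<forall>a\<in>set as. 0 < a)
    \<and> w = map2 (\<lambda>(b, L) a. (if b then a else - a, L)) v as"
  using assms
proof (induction w arbitrary: v)
  case Nil
  then show ?case
    by (simp add: pattern_def)
next
  case (Cons y w)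
  obtain t L where y: "y = (t, L)"
    by (cases y)
  obtain as where "length as = length (pattern w)" "\<forall>a\<in>set as. 0 < a"
    "w = map2 (\<lambda>(b, L) a. (if b then a else - a, L)) (pattern w) as"
    using Cons.IH[OF refl] Cons.prems(2) by auto
  then show ?case
    using Cons.prems y by (intro exI[of _ "\<bar>t\<bar> # as"]) (auto simp: pattern_simps)
qed

lemma irr_not_bad:
  assumes irreducible: "irreducible m" and nz: "\<forall>(t, L)\<in>set m. t \<noteq> 0" and bad: "pattern m \<in> set irreducible_bad"
  shows False
proof -
  obtain as where as: "length as = length (pattern m)" "\<forall>a\<in>set as. 0 < a"
    "m = map2 (\<lambda>(b, L) a. (if b then a else - a, L)) (pattern m) as"
    using decode_pattern[OF refl nz] by blast
  from bad consider
    (Pp) "pattern m = [pP, nP]"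
    | (Ww) "pattern m = [pW, nW]"
    | (Wp) "pattern m = [pW, nP]"
    | (WQpq) "pattern m = [pW, pQ, nP, nQ]"
    | (WQpw) "pattern m = [pW, pQ, nP, nW]"
    | (PQpQ) "pattern m = [pP, pQ, nP, pQ]"
    | (WQpQW) "pattern m = [pW, pQ, nP, pQ, pW]"
    | (PWQpQ) "pattern m = [pP, pW, pQ, nP, pQ]"
    | (WQpQp) "pattern m = [pW, pQ, nP, pQ, nP]"
    | (PQpqP) "pattern m = [pP, pQ, nP, nQ, pP]"
    | (PqPqPq) "pattern m = [pP, nQ, pP, nQ, pP, nQ]"
    | (pQpwpQp) "pattern m = [nP, pQ, nP, nW, nP, pQ, nP]"
    unfolding irreducible_bad_def by auto
  then show False
  proof cases
    case Pp
    with as obtain a b where "m = [(a, LP), (- b, LP)]" "0 < a" "0 < b"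
      by (auto simp: length_Suc_conv)
    with irreducible show False
      using irr_cancel[of a LP "- b"] by (simp add: mult_pos_neg)
  next
    case Ww
    with as obtain a b where "m = [(a, LW), (- b, LW)]" "0 < a" "0 < b"
      by (auto simp: length_Suc_conv)
    with irreducible show False
      using irr_cancel[of a LW "- b"] by (simp add: mult_pos_neg)
  next
    case Wp
    with as obtain a b where "m = [(a, LW), (- b, LP)]" "0 < a" "0 < b"
      by (auto simp: length_Suc_conv)
    with irreducible show False
      using irr_WP_opposite by blast
  next
    case WQpq
    with as obtain a b c d where "m = [(a, LW), (b, LQ), (- c, LP), (- d, LQ)]" "0 < a" "0 < b" "0 < c" "0 < d"
      by (auto simp: length_Suc_conv)
    with irreducible show False
      using irr_WQpq by blast
  next
    case WQpw
    with as obtain a b c d where "m = [(a, LW), (b, LQ), (- c, LP), (- d, LW)]" "0 < a" "0 < b" "0 < c" "0 < d"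
      by (auto simp: length_Suc_conv)
    with irreducible show False
      using irr_WQpw by blast
  next
    case PQpQ
    with as obtain a b c d where "m = [(a, LP), (b, LQ), (- c, LP), (d, LQ)]" "0 < a" "0 < b" "0 < c" "0 < d"
      by (auto simp: length_Suc_conv)
    with irreducible show False
      using irr_PQpQ by blast
  next
    case WQpQW
    with as obtain a b c d e where "m = [(a, LW), (b, LQ), (- c, LP), (d, LQ), (e, LW)]" "0 < a" "0 < b" "0 < c" "0 < d" "0 < e"
      by (auto simp: length_Suc_conv)
    with irreducible show False
      using irr_WQpQW by blast
  next
    case PWQpQ
    with as obtain a b c d e where "m = [(a, LP), (b, LW), (c, LQ), (- d, LP), (e, LQ)]" "0 < a" "0 < b" "0 < c" "0 < d" "0 < e"
      by (auto simp: length_Suc_conv)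
    with irreducible show False
      using irr_PWQpQ by blast
  next
    case WQpQp
    with as obtain a b c d e where "m = [(a, LW), (b, LQ), (- c, LP), (d, LQ), (- e, LP)]" "0 < a" "0 < b" "0 < c" "0 < d" "0 < e"
      by (auto simp: length_Suc_conv)
    with irreducible show False
      using irr_WQpQp by blast
  next
    case PQpqP
    with as obtain a b c d e where "m = [(a, LP), (b, LQ), (- c, LP), (- d, LQ), (e, LP)]" "0 < a" "0 < b" "0 < c" "0 < d" "0 < e"
      by (auto simp: length_Suc_conv)
    with irreducible show False
      using irr_PQpqP by blast
  next
    case PqPqPq
    with as obtain a b c d e f where "m = [(a, LP), (- b, LQ), (c, LP), (- d, LQ), (e, LP), (- f, LQ)]" "0 < a" "0 < b" "0 < c" "0 < d" "0 < e" "0 < f"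
      by (auto simp: length_Suc_conv)
    with irreducible show False
      using irr_PqPqPq by blast
  next
    case pQpwpQp
    with as obtain a b c d e f g where "m = [(- a, LP), (b, LQ), (- c, LP), (- d, LW), (- e, LP), (f, LQ), (- g, LP)]" "0 < a" "0 < b" "0 < c" "0 < d" "0 < e" "0 < f" "0 < g"
      by (auto simp: length_Suc_conv)
    with irreducible show False
      using irr_pQpwpQp by blast
  qed
qed

lemma pattern_negate: "\<forall>(t, L)\<in>set w. t \<noteq> 0 \<Longrightarrow> pattern (negate w) = negS (pattern w)"
  by (auto simp: pattern_def negate_def negS_def)

lemma pattern_swap: "pattern (swap w) = swapS (pattern w)"
  by (auto simp: pattern_def swap_def swapS_def)

lemma pattern_rev: "pattern (rev w) = rev (pattern w)"
  by (simp add: pattern_def rev_map)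

lemma negS_negS [simp]: "negS (negS v) = v"
  by (simp add: negS_def comp_def case_prod_unfold)

lemma swapS_swapS [simp]: "swapS (swapS v) = v"
  by (simp add: swapS_def comp_def case_prod_unfold)

lemma nonzero_neg: "\<forall>(t, L)\<in>set w. t \<noteq> 0 \<Longrightarrow> \<forall>(t, L)\<in>set (negate w). t \<noteq> 0"
  and nonzero_swap: "\<forall>(t, L)\<in>set w. t \<noteq> 0 \<Longrightarrow> \<forall>(t, L)\<in>set (swap w). t \<noteq> 0"
  by (auto simp: negate_def swap_def)

lemma irr_not_forbidden:
  assumes irreducible: "irreducible m" and nz: "\<forall>(t, L)\<in>set m. t \<noteq> 0" and run: "pattern m \<notin> set run_bad"
  shows "pattern m \<notin> set forbidden"
proof
  assume "pattern m \<in> set forbidden"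
  with run obtain f g where f: "f \<in> set irreducible_bad" "g = f \<or> g = rev f"
    "pattern m = g \<or> pattern m = negS g \<or> pattern m = swapS g \<or> pattern m = negS (swapS g)"
    by (auto simp: forbidden_def)
  have rev: False if "irreducible u" "\<forall>(t, L)\<in>set u. t \<noteq> 0" "pattern u = g" for u
    using f(1,2) that irr_not_bad[of u] irr_not_bad[of "rev u"] irr_rev[of u] pattern_rev[of u] by auto
  from f(3) show False
  proof (elim disjE)
    assume "pattern m = g"
    then show False
      using rev irreducible nz by blast
  next
    assume "pattern m = negS g"
    then show False
      using rev[of "negate m"] irr_neg[OF irreducible] nonzero_neg[OF nz] pattern_negate[OF nz] by simp
  next
    assume "pattern m = swapS g"
    then show False
      using rev[of "swap m"] irr_swap[OF irreducible] nonzero_swap[OF nz] pattern_swap[of m] by simp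
  next
    assume "pattern m = negS (swapS g)"
    then show False
      using rev[of "swap (negate m)"] irr_swap[OF irr_neg[OF irreducible]] nonzero_swap[OF nonzero_neg[OF nz]]
        pattern_swap[of "negate m"] pattern_negate[OF nz] by simp
  qed
qed

lemma irr_admissible:
  assumes irreducible: "irreducible w" and nz: "\<forall>(t, L)\<in>set w. t \<noteq> 0" and clean: "clean (pattern w)"
  shows "admissible (pattern w)"
  unfolding admissible_def
proof (intro allI impI)
  fix l m r
  assume e: "pattern w = l @ m @ r"
  then obtain l' m' r' where w: "w = l' @ m' @ r'" "pattern m' = m"
    unfolding pattern_def by (auto simp: map_eq_append_conv append_eq_map_conv)
  have "m \<notin> set run_bad"
    using clean e unfolding clean_def by blast
  then show "m \<notin> set forbidden"
    using irr_not_forbidden[of m'] irr_factor[of l' m' r'] irreducible nz w by auto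
qed

lemma run_bad_closed: "m \<in> set run_bad \<Longrightarrow> negS m \<in> set run_bad \<and> swapS m \<in> set run_bad \<and> rev m \<in> set run_bad"
  by (auto simp: run_bad_def run_bad_letters_def negS_def swapS_def)

lemma clean_image:
  assumes "clean v" "\<And>m. m \<in> set run_bad \<Longrightarrow> h m \<in> set run_bad"
    and "\<And>l m r. u = l @ m @ r \<Longrightarrow> \<exists>l' r'. v = l' @ h m @ r'"
  shows "clean u"
  using assms unfolding clean_def by metis

lemma clean_neg: "clean v \<Longrightarrow> clean (negS v)"
proof (rule clean_image[where h = negS])
  fix l m r
  assume "negS v = l @ m @ r"
  then have "negS (negS v) = negS (l @ m @ r)"
    by simp
  then have "v = negS l @ negS m @ negS r"
    by (simp only: negS_negS) (simp add: negS_def)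
  then show "\<exists>l' r'. v = l' @ negS m @ r'"
    by blast
qed (use run_bad_closed in blast)+

lemma clean_swap: "clean v \<Longrightarrow> clean (swapS v)"
proof (rule clean_image[where h = swapS])
  fix l m r
  assume "swapS v = l @ m @ r"
  then have "swapS (swapS v) = swapS (l @ m @ r)"
    by simp
  then have "v = swapS l @ swapS m @ swapS r"
    by (simp only: swapS_swapS) (simp add: swapS_def)
  then show "\<exists>l' r'. v = l' @ swapS m @ r'"
    by blast
qed (use run_bad_closed in blast)+

lemma clean_rev: "clean v \<Longrightarrow> clean (rev v)"
proof (rule clean_image[where h = rev])
  fix l m r
  assume "rev v = l @ m @ r"
  then have "rev (rev v) = rev (l @ m @ r)"
    by simp
  then have "v = rev r @ rev m @ rev l"
    by simp
  then show "\<exists>l' r'. v = l' @ rev m @ r'"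
    by blast
qed (use run_bad_closed in blast)+

lemma admissible_extend:
  "admissible v \<Longrightarrow> length v = Suc n \<Longrightarrow> last v \<in> {pP, pW} \<Longrightarrow> v \<in> set ((extend ^^ n) [[pP], [pW]])"
proof (induction n arbitrary: v)
  case 0
  then obtain x where "v = [x]"
    by (auto simp: length_Suc_conv)
  with 0 show ?case
    by auto
next
  case (Suc n)
  then obtain x v' where v: "v = x # v'" "length v' = Suc n"
    by (auto simp: length_Suc_conv)
  have adm: "admissible (x # v')"
    using Suc.prems(1) v(1) by (simp only:)
  moreover have "last v' \<in> {pP, pW}"
    using Suc.prems(3) v by (cases v') simp_all
  ultimately have "v' \<in> set ((extend ^^ n) [[pP], [pW]])"
    using Suc.IH v(2) admissible_Cons(1) by blast
  from admissible_Cons(2)[OF adm this] show ?case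
    by (simp add: v(1))
qed

lemma admissible_cases:
  assumes "admissible v" "v \<noteq> []" "last v \<in> {pP, pW}"
  shows "rev v \<in> patterns"
proof -
  have short: "length v \<le> 6"
  proof (rule ccontr)
    assume "\<not> length v \<le> 6"
    then obtain l u where u: "v = l @ u" "length u = 7"
      by (metis append_take_drop_id diff_diff_cancel length_drop not_less_eq_eq eval_nat_numeral(3) semiring_norm(26-28) le_less not_le)
    have "admissible u"
      using assms(1) u(1) by (induction l arbitrary: v) (auto dest: admissible_Cons)
    moreover have "last u \<in> {pP, pW}"
      using assms(3) u by (cases "u = []") auto
    ultimately have "u \<in> set ((extend ^^ 6) [[pP], [pW]])"
      using u(2) by (intro admissible_extend) simp_all
    then show False
      by (simp add: eval_nat_numeral extend_1 extend_2 extend_3 extend_4 extend_5 extend_6)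
  qed
  obtain n where n: "length v = Suc n"
    using assms(2) by (cases v) auto
  with short have "n \<in> {0, 1, 2, 3, 4, 5}"
    by auto
  moreover have "v \<in> set ((extend ^^ n) [[pP], [pW]])"
    using assms n by (intro admissible_extend)
  ultimately show ?thesis
    by (elim insertE)
      (auto simp: patterns_def eval_nat_numeral extend_1 extend_2 extend_3 extend_4 extend_5)
qed

lemma covered_act:
  assumes "covered (act n x w)"
  shows "covered w"
proof -
  have "act n' x' (act n x w) = act (n \<noteq> n') (x \<noteq> x') w" for n' x'
  proof -
    have "swap (negate u) = negate (swap u)" for u
      by (simp add: swap_def negate_def comp_def case_prod_unfold)
    then show ?thesis
      by (simp add: act_def)
  qed
  moreover have "cost (act n x w) = cost w"
    by (simp add: act_def)
  ultimately show ?thesis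
    using assms unfolding covered_def by metis
qed

text \<open>
A letter between W and a change of sign has exponent sqrt 2,
an inner block of one letter next to it has exponent 2 sqrt 2, and other inner exponents agree up to sign. Where 2 sqrt 2 occurs, W is moved through K to reach the representative.
\<close>

lemma covered_if_pattern:
  assumes irreducible: "irreducible w" and nz: "\<forall>(t, L)\<in>set w. t \<noteq> 0" and pattern: "pattern w \<in> patterns"
  shows "covered w"
proof -
  obtain as where as: "length as = length (pattern w)" "\<forall>a\<in>set as. 0 < a"
    "w = map2 (\<lambda>(b, L) a. (if b then a else - a, L)) (pattern w) as"
    using decode_pattern[OF refl nz] by blast
  from pattern consider
    (P) "pattern w = [pP]"
    | (W) "pattern w = [pW]"
    | (PQ) "pattern w = [pP, pQ]"
    | (Pq) "pattern w = [pP, nQ]"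
    | (PW) "pattern w = [pP, pW]"
    | (WP) "pattern w = [pW, pP]"
    | (WQ) "pattern w = [pW, pQ]"
    | (PQp) "pattern w = [pP, pQ, nP]"
    | (PqP) "pattern w = [pP, nQ, pP]"
    | (Pqp) "pattern w = [pP, nQ, nP]"
    | (Pqw) "pattern w = [pP, nQ, nW]"
    | (PWP) "pattern w = [pP, pW, pP]"
    | (PWQ) "pattern w = [pP, pW, pQ]"
    | (WPq) "pattern w = [pW, pP, nQ]"
    | (WQp) "pattern w = [pW, pQ, nP]"
    | (PQpq) "pattern w = [pP, pQ, nP, nQ]"
    | (PqPq) "pattern w = [pP, nQ, pP, nQ]"
    | (PqPW) "pattern w = [pP, nQ, pP, pW]"
    | (PqpQ) "pattern w = [pP, nQ, nP, pQ]"
    | (Pqwp) "pattern w = [pP, nQ, nW, nP]"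
    | (Pqwq) "pattern w = [pP, nQ, nW, nQ]"
    | (PWPq) "pattern w = [pP, pW, pP, nQ]"
    | (PWQp) "pattern w = [pP, pW, pQ, nP]"
    | (WPqP) "pattern w = [pW, pP, nQ, pP]"
    | (WQpQ) "pattern w = [pW, pQ, nP, pQ]"
    | (PqPqP) "pattern w = [pP, nQ, pP, nQ, pP]"
    | (PqPWP) "pattern w = [pP, nQ, pP, pW, pP]"
    | (PqwpQ) "pattern w = [pP, nQ, nW, nP, pQ]"
    | (PqwqP) "pattern w = [pP, nQ, nW, nQ, pP]"
    | (PWPqP) "pattern w = [pP, pW, pP, nQ, pP]"
    | (PqPWPq) "pattern w = [pP, nQ, pP, pW, pP, nQ]"
    | (PqwqPq) "pattern w = [pP, nQ, nW, nQ, pP, nQ]"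
    unfolding patterns_def by auto
  then show ?thesis
  proof cases
    case P
    with as obtain a where w: "w = [(a, LP)]" and pos: "0 < a"
      by (auto simp: length_Suc_conv)
    show ?thesis
      unfolding w by (rule coveredI[of 0 a 0 0 False False])
        (use pos in \<open>simp_all add: cover_simps\<close>)
  next
    case W
    with as obtain a where w: "w = [(a, LW)]" and pos: "0 < a"
      by (auto simp: length_Suc_conv)
    show ?thesis
      unfolding w by (rule coveredI[of 0 0 a 0 False False])
        (use pos in \<open>simp_all add: cover_simps\<close>)
  next
    case PQ
    with as obtain a b where w: "w = [(a, LP), (b, LQ)]" and pos: "0 < a" "0 < b"
      by (auto simp: length_Suc_conv)
    show ?thesis
      unfolding w by (rule coveredI[of 1 a 0 b False False])
        (use pos in \<open>simp_all add: cover_simps\<close>)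
  next
    case Pq
    with as obtain a b where w: "w = [(a, LP), (- b, LQ)]" and pos: "0 < a" "0 < b"
      by (auto simp: length_Suc_conv)
    show ?thesis
      unfolding w by (rule coveredI[of 12 a b 0 False False])
        (use pos in \<open>simp_all add: cover_simps\<close>)
  next
    case PW
    with as obtain a b where w: "w = [(a, LP), (b, LW)]" and pos: "0 < a" "0 < b"
      by (auto simp: length_Suc_conv)
    show ?thesis
      unfolding w by (rule coveredI[of 0 a b 0 False False])
        (use pos in \<open>simp_all add: cover_simps\<close>)
  next
    case WP
    with as obtain a b where w: "w = [(a, LW), (b, LP)]" and pos: "0 < a" "0 < b"
      by (auto simp: length_Suc_conv)
    show ?thesis
      unfolding w by (rule coveredI[of 0 0 a b False False])
        (use pos in \<open>simp_all add: cover_simps\<close>)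
  next
    case WQ
    with as obtain a b where w: "w = [(a, LW), (b, LQ)]" and pos: "0 < a" "0 < b"
      by (auto simp: length_Suc_conv)
    show ?thesis
      unfolding w by (rule coveredI[of 1 0 a b False False])
        (use pos in \<open>simp_all add: cover_simps\<close>)
  next
    case PQp
    with as obtain a b c where w: "w = [(a, LP), (b, LQ), (- c, LP)]" and pos: "0 < a" "0 < b" "0 < c"
      by (auto simp: length_Suc_conv)
    show ?thesis
      unfolding w by (rule coveredI[of 8 a b c False False])
        (use pos in \<open>simp_all add: cover_simps\<close>)
  next
    case PqP
    with as obtain a b c where w: "w = [(a, LP), (- b, LQ), (c, LP)]" and pos: "0 < a" "0 < b" "0 < c"
      by (auto simp: length_Suc_conv)
    show ?thesis
      unfolding w by (rule coveredI[of 12 a b c False False])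
        (use pos in \<open>simp_all add: cover_simps\<close>)
  next
    case Pqp
    with as obtain a b c where w: "w = [(a, LP), (- b, LQ), (- c, LP)]" and pos: "0 < a" "0 < b" "0 < c"
      by (auto simp: length_Suc_conv)
    show ?thesis
      unfolding w by (rule coveredI[of 9 a b c False False])
        (use pos in \<open>simp_all add: cover_simps\<close>)
  next
    case Pqw
    with as obtain a b c where w: "w = [(a, LP), (- b, LQ), (- c, LW)]" and pos: "0 < a" "0 < b" "0 < c"
      by (auto simp: length_Suc_conv)
    have e1: "b = sqrt 2"
      using irr_neg[OF irr_rev[OF irr_factor[of "[]" "[(a, LP), (- b, LQ), (- c, LW)]" "[]"]]]
        irreducible w pos irr_WQP[of c b a] by simp
    show ?thesis
      unfolding w by (rule coveredI[of 2 a c 0 True True])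
        (use pos e1 in \<open>simp_all add: cover_simps\<close>)
  next
    case PWP
    with as obtain a b c where w: "w = [(a, LP), (b, LW), (c, LP)]" and pos: "0 < a" "0 < b" "0 < c"
      by (auto simp: length_Suc_conv)
    show ?thesis
      unfolding w by (rule coveredI[of 0 a b c False False])
        (use pos in \<open>simp_all add: cover_simps\<close>)
  next
    case PWQ
    with as obtain a b c where w: "w = [(a, LP), (b, LW), (c, LQ)]" and pos: "0 < a" "0 < b" "0 < c"
      by (auto simp: length_Suc_conv)
    show ?thesis
      unfolding w by (rule coveredI[of 1 a b c False False])
        (use pos in \<open>simp_all add: cover_simps\<close>)
  next
    case WPq
    with as obtain a b c where w: "w = [(a, LW), (b, LP), (- c, LQ)]" and pos: "0 < a" "0 < b" "0 < c"
      by (auto simp: length_Suc_conv)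
    have e1: "b = sqrt 2"
      using irr_swap[OF irr_factor[of "[]" "[(a, LW), (b, LP), (- c, LQ)]" "[]"]]
        irreducible w pos irr_WQP[of a b c] by simp
    show ?thesis
      unfolding w by (rule coveredI[of 4 0 a c False False])
        (use pos e1 in \<open>simp_all add: cover_simps\<close>)
  next
    case WQp
    with as obtain a b c where w: "w = [(a, LW), (b, LQ), (- c, LP)]" and pos: "0 < a" "0 < b" "0 < c"
      by (auto simp: length_Suc_conv)
    have e1: "b = sqrt 2"
      using irr_factor[of "[]" "[(a, LW), (b, LQ), (- c, LP)]" "[]"]
        irreducible w pos irr_WQP[of a b c] by simp
    show ?thesis
      unfolding w by (rule coveredI[of 5 0 a c False True])
        (use pos e1 in \<open>simp_all add: cover_simps\<close>)
  next
    case PQpq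
    with as obtain a b c d where w: "w = [(a, LP), (b, LQ), (- c, LP), (- d, LQ)]" and pos: "0 < a" "0 < b" "0 < c" "0 < d"
      by (auto simp: length_Suc_conv)
    have e1: "b = c"
      using irr_factor[of "[]" "[(a, LP), (b, LQ), (- c, LP), (- d, LQ)]" "[]"]
        irreducible w pos irr_PQpq[of a b c d] by simp
    show ?thesis
      unfolding w by (rule coveredI[of 10 a b d False False])
        (use pos e1 in \<open>simp_all add: cover_simps\<close>)
  next
    case PqPq
    with as obtain a b c d where w: "w = [(a, LP), (- b, LQ), (c, LP), (- d, LQ)]" and pos: "0 < a" "0 < b" "0 < c" "0 < d"
      by (auto simp: length_Suc_conv)
    have e1: "b = c"
      using irr_factor[of "[]" "[(a, LP), (- b, LQ), (c, LP), (- d, LQ)]" "[]"]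
        irreducible w pos irr_PqPq[of a b c d] by simp
    show ?thesis
      unfolding w by (rule coveredI[of 13 a b d False False])
        (use pos e1 in \<open>simp_all add: cover_simps\<close>)
  next
    case PqPW
    with as obtain a b c d where w: "w = [(a, LP), (- b, LQ), (c, LP), (d, LW)]" and pos: "0 < a" "0 < b" "0 < c" "0 < d"
      by (auto simp: length_Suc_conv)
    have e1: "c = sqrt 2"
      using irr_swap[OF irr_rev[OF irr_factor[of "[(a, LP)]" "[(- b, LQ), (c, LP), (d, LW)]" "[]"]]]
        irreducible w pos irr_WQP[of d c b] by simp
    have e2: "b = 2 * sqrt 2"
      using irr_swap[OF irr_rev[OF irr_factor[of "[]" "[(a, LP), (- b, LQ), (c, LP), (d, LW)]" "[]"]]]
        irreducible w pos irr_WQpQ(2)[of d c b a] by simp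
    show ?thesis
      unfolding w by (rule coveredI[of 6 a d "sqrt 2" True True])
        (use pos e1 e2 in \<open>simp_all add: cover_simps algebra_simps sqrt2_cancel abs_neg_sqrt2\<close>)
  next
    case PqpQ
    with as obtain a b c d where w: "w = [(a, LP), (- b, LQ), (- c, LP), (d, LQ)]" and pos: "0 < a" "0 < b" "0 < c" "0 < d"
      by (auto simp: length_Suc_conv)
    have e1: "b = c"
      using irr_factor[of "[]" "[(a, LP), (- b, LQ), (- c, LP), (d, LQ)]" "[]"]
        irreducible w pos irr_PqpQ[of a b c d] by simp
    show ?thesis
      unfolding w by (rule coveredI[of 11 a b d False False])
        (use pos e1 in \<open>simp_all add: cover_simps\<close>)
  next
    case Pqwp
    with as obtain a b c d where w: "w = [(a, LP), (- b, LQ), (- c, LW), (- d, LP)]" and pos: "0 < a" "0 < b" "0 < c" "0 < d"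
      by (auto simp: length_Suc_conv)
    have e1: "b = sqrt 2"
      using irr_neg[OF irr_rev[OF irr_factor[of "[]" "[(a, LP), (- b, LQ), (- c, LW)]" "[(- d, LP)]"]]]
        irreducible w pos irr_WQP[of c b a] by simp
    show ?thesis
      unfolding w by (rule coveredI[of 3 a c d True True])
        (use pos e1 in \<open>simp_all add: cover_simps\<close>)
  next
    case Pqwq
    with as obtain a b c d where w: "w = [(a, LP), (- b, LQ), (- c, LW), (- d, LQ)]" and pos: "0 < a" "0 < b" "0 < c" "0 < d"
      by (auto simp: length_Suc_conv)
    have e1: "b = sqrt 2"
      using irr_neg[OF irr_rev[OF irr_factor[of "[]" "[(a, LP), (- b, LQ), (- c, LW)]" "[(- d, LQ)]"]]]
        irreducible w pos irr_WQP[of c b a] by simp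
    show ?thesis
      unfolding w by (rule coveredI[of 2 a c d True True])
        (use pos e1 in \<open>simp_all add: cover_simps\<close>)
  next
    case PWPq
    with as obtain a b c d where w: "w = [(a, LP), (b, LW), (c, LP), (- d, LQ)]" and pos: "0 < a" "0 < b" "0 < c" "0 < d"
      by (auto simp: length_Suc_conv)
    have e1: "c = sqrt 2"
      using irr_swap[OF irr_factor[of "[(a, LP)]" "[(b, LW), (c, LP), (- d, LQ)]" "[]"]]
        irreducible w pos irr_WQP[of b c d] by simp
    show ?thesis
      unfolding w by (rule coveredI[of 4 a b d False False])
        (use pos e1 in \<open>simp_all add: cover_simps\<close>)
  next
    case PWQp
    with as obtain a b c d where w: "w = [(a, LP), (b, LW), (c, LQ), (- d, LP)]" and pos: "0 < a" "0 < b" "0 < c" "0 < d"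
      by (auto simp: length_Suc_conv)
    have e1: "c = sqrt 2"
      using irr_factor[of "[(a, LP)]" "[(b, LW), (c, LQ), (- d, LP)]" "[]"]
        irreducible w pos irr_WQP[of b c d] by simp
    show ?thesis
      unfolding w by (rule coveredI[of 5 a b d False True])
        (use pos e1 in \<open>simp_all add: cover_simps\<close>)
  next
    case WPqP
    with as obtain a b c d where w: "w = [(a, LW), (b, LP), (- c, LQ), (d, LP)]" and pos: "0 < a" "0 < b" "0 < c" "0 < d"
      by (auto simp: length_Suc_conv)
    have e1: "b = sqrt 2"
      using irr_swap[OF irr_factor[of "[]" "[(a, LW), (b, LP), (- c, LQ)]" "[(d, LP)]"]]
        irreducible w pos irr_WQP[of a b c] by simp
    have e2: "c = 2 * sqrt 2"
      using irr_swap[OF irr_factor[of "[]" "[(a, LW), (b, LP), (- c, LQ), (d, LP)]" "[]"]]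
        irreducible w pos irr_WQpQ(2)[of a b c d] by simp
    show ?thesis
      unfolding w by (rule coveredI[of 6 "sqrt 2" a d True True])
        (use pos e1 e2 in \<open>simp_all add: cover_simps algebra_simps sqrt2_cancel abs_neg_sqrt2\<close>)
  next
    case WQpQ
    with as obtain a b c d where w: "w = [(a, LW), (b, LQ), (- c, LP), (d, LQ)]" and pos: "0 < a" "0 < b" "0 < c" "0 < d"
      by (auto simp: length_Suc_conv)
    have e1: "b = sqrt 2"
      using irr_factor[of "[]" "[(a, LW), (b, LQ), (- c, LP)]" "[(d, LQ)]"]
        irreducible w pos irr_WQP[of a b c] by simp
    have e2: "c = 2 * sqrt 2"
      using irr_factor[of "[]" "[(a, LW), (b, LQ), (- c, LP), (d, LQ)]" "[]"]
        irreducible w pos irr_WQpQ(2)[of a b c d] by simp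
    show ?thesis
      unfolding w by (rule coveredI[of 6 "sqrt 2" a d True False])
        (use pos e1 e2 in \<open>simp_all add: cover_simps algebra_simps sqrt2_cancel abs_neg_sqrt2\<close>)
  next
    case PqPqP
    with as obtain a b c d e where w: "w = [(a, LP), (- b, LQ), (c, LP), (- d, LQ), (e, LP)]" and pos: "0 < a" "0 < b" "0 < c" "0 < d" "0 < e"
      by (auto simp: length_Suc_conv)
    have e1: "b = c"
      using irr_factor[of "[]" "[(a, LP), (- b, LQ), (c, LP), (- d, LQ)]" "[(e, LP)]"]
        irreducible w pos irr_PqPq[of a b c d] by simp
    have e2: "c = d"
      using irr_swap[OF irr_neg[OF irr_factor[of "[(a, LP)]" "[(- b, LQ), (c, LP), (- d, LQ), (e, LP)]" "[]"]]]
        irreducible w pos irr_PqPq[of b c d e] by simp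
    show ?thesis
      unfolding w by (rule coveredI[of 14 a b e False False])
        (use pos e1 e2 in \<open>simp_all add: cover_simps\<close>)
  next
    case PqPWP
    with as obtain a b c d e where w: "w = [(a, LP), (- b, LQ), (c, LP), (d, LW), (e, LP)]" and pos: "0 < a" "0 < b" "0 < c" "0 < d" "0 < e"
      by (auto simp: length_Suc_conv)
    have e1: "b = 2 * sqrt 2"
      using irr_swap[OF irr_rev[OF irr_factor[of "[]" "[(a, LP), (- b, LQ), (c, LP), (d, LW)]" "[(e, LP)]"]]]
        irreducible w pos irr_WQpQ(2)[of d c b a] by simp
    have e2: "c = sqrt 2"
      using irr_swap[OF irr_rev[OF irr_factor[of "[(a, LP)]" "[(- b, LQ), (c, LP), (d, LW)]" "[(e, LP)]"]]]
        irreducible w pos irr_WQP[of d c b] by simp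
    show ?thesis
      unfolding w by (rule coveredI[of 6 a d "sqrt 2 + e" True True])
        (use pos e1 e2 in \<open>simp_all add: cover_simps algebra_simps sqrt2_cancel abs_neg_sqrt2\<close>)
  next
    case PqwpQ
    with as obtain a b c d e where w: "w = [(a, LP), (- b, LQ), (- c, LW), (- d, LP), (e, LQ)]" and pos: "0 < a" "0 < b" "0 < c" "0 < d" "0 < e"
      by (auto simp: length_Suc_conv)
    have e1: "b = sqrt 2"
      using irr_neg[OF irr_rev[OF irr_factor[of "[]" "[(a, LP), (- b, LQ), (- c, LW)]" "[(- d, LP), (e, LQ)]"]]]
        irreducible w pos irr_WQP[of c b a] by simp
    have e2: "d = sqrt 2"
      using irr_swap[OF irr_neg[OF irr_factor[of "[(a, LP), (- b, LQ)]" "[(- c, LW), (- d, LP), (e, LQ)]" "[]"]]]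
        irreducible w pos irr_WQP[of c d e] by simp
    show ?thesis
      unfolding w by (rule coveredI[of 7 a c e True True])
        (use pos e1 e2 in \<open>simp_all add: cover_simps\<close>)
  next
    case PqwqP
    with as obtain a b c d e where w: "w = [(a, LP), (- b, LQ), (- c, LW), (- d, LQ), (e, LP)]" and pos: "0 < a" "0 < b" "0 < c" "0 < d" "0 < e"
      by (auto simp: length_Suc_conv)
    have e1: "b = sqrt 2"
      using irr_neg[OF irr_rev[OF irr_factor[of "[]" "[(a, LP), (- b, LQ), (- c, LW)]" "[(- d, LQ), (e, LP)]"]]]
        irreducible w pos irr_WQP[of c b a] by simp
    have e2: "d = sqrt 2"
      using irr_neg[OF irr_factor[of "[(a, LP), (- b, LQ)]" "[(- c, LW), (- d, LQ), (e, LP)]" "[]"]]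
        irreducible w pos irr_WQP[of c d e] by simp
    show ?thesis
      unfolding w by (rule coveredI[of 6 a c e True True])
        (use pos e1 e2 in \<open>simp_all add: cover_simps\<close>)
  next
    case PWPqP
    with as obtain a b c d e where w: "w = [(a, LP), (b, LW), (c, LP), (- d, LQ), (e, LP)]" and pos: "0 < a" "0 < b" "0 < c" "0 < d" "0 < e"
      by (auto simp: length_Suc_conv)
    have e1: "c = sqrt 2"
      using irr_swap[OF irr_factor[of "[(a, LP)]" "[(b, LW), (c, LP), (- d, LQ)]" "[(e, LP)]"]]
        irreducible w pos irr_WQP[of b c d] by simp
    have e2: "d = 2 * sqrt 2"
      using irr_swap[OF irr_factor[of "[(a, LP)]" "[(b, LW), (c, LP), (- d, LQ), (e, LP)]" "[]"]]
        irreducible w pos irr_WQpQ(2)[of b c d e] by simp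
    show ?thesis
      unfolding w by (rule coveredI[of 6 "a + sqrt 2" b e True True])
        (use pos e1 e2 in \<open>simp_all add: cover_simps algebra_simps sqrt2_cancel abs_neg_sqrt2\<close>)
  next
    case PqPWPq
    with as obtain a b c d e f where w: "w = [(a, LP), (- b, LQ), (c, LP), (d, LW), (e, LP), (- f, LQ)]" and pos: "0 < a" "0 < b" "0 < c" "0 < d" "0 < e" "0 < f"
      by (auto simp: length_Suc_conv)
    have e1: "b = 2 * sqrt 2"
      using irr_swap[OF irr_rev[OF irr_factor[of "[]" "[(a, LP), (- b, LQ), (c, LP), (d, LW)]" "[(e, LP), (- f, LQ)]"]]]
        irreducible w pos irr_WQpQ(2)[of d c b a] by simp
    have e2: "c = sqrt 2"
      using irr_swap[OF irr_rev[OF irr_factor[of "[(a, LP)]" "[(- b, LQ), (c, LP), (d, LW)]" "[(e, LP), (- f, LQ)]"]]]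
        irreducible w pos irr_WQP[of d c b] by simp
    have e3: "e = sqrt 2"
      using irr_swap[OF irr_factor[of "[(a, LP), (- b, LQ), (c, LP)]" "[(d, LW), (e, LP), (- f, LQ)]" "[]"]]
        irreducible w pos irr_WQP[of d e f] by simp
    show ?thesis
      unfolding w by (rule coveredI[of 15 a d f True False])
        (use pos e1 e2 e3 in \<open>simp_all add: cover_simps\<close>)
  next
    case PqwqPq
    with as obtain a b c d e f where w: "w = [(a, LP), (- b, LQ), (- c, LW), (- d, LQ), (e, LP), (- f, LQ)]" and pos: "0 < a" "0 < b" "0 < c" "0 < d" "0 < e" "0 < f"
      by (auto simp: length_Suc_conv)
    have e1: "b = sqrt 2"
      using irr_neg[OF irr_rev[OF irr_factor[of "[]" "[(a, LP), (- b, LQ), (- c, LW)]" "[(- d, LQ), (e, LP), (- f, LQ)]"]]]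
        irreducible w pos irr_WQP[of c b a] by simp
    have e2: "d = sqrt 2"
      using irr_neg[OF irr_factor[of "[(a, LP), (- b, LQ)]" "[(- c, LW), (- d, LQ), (e, LP)]" "[(- f, LQ)]"]]
        irreducible w pos irr_WQP[of c d e] by simp
    have e3: "e = 2 * sqrt 2"
      using irr_neg[OF irr_factor[of "[(a, LP), (- b, LQ)]" "[(- c, LW), (- d, LQ), (e, LP), (- f, LQ)]" "[]"]]
        irreducible w pos irr_WQpQ(2)[of c d e f] by simp
    show ?thesis
      unfolding w by (rule coveredI[of 15 a c f True False])
        (use pos e1 e2 e3 in \<open>simp_all add: cover_simps algebra_simps sqrt2_cancel abs_neg_sqrt2\<close>)
  qed
qed

lemma signs_pattern: "\<forall>(t, L)\<in>set w. t \<noteq> 0 \<Longrightarrow> signs w = map fst (pattern w)"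
  by (induction w) (auto simp: pattern_def)

lemma length_profile_act: "length (profile (act n x w)) = length (profile w)"
  by (simp add: act_def profile_def signs_negate signs_swap remdups_adj_map_injective inj_on_def)

lemma act_preserves:
  assumes irreducible: "irreducible w" and nz: "\<forall>(t, L)\<in>set w. t \<noteq> 0" and clean: "clean (pattern w)"
  shows "irreducible (act n x w)" "\<forall>(t, L)\<in>set (act n x w). t \<noteq> 0" "clean (pattern (act n x w))"
proof -
  define u where "u = (if x then swap w else w)"
  have u: "irreducible u" "\<forall>(t, L)\<in>set u. t \<noteq> 0" "clean (pattern u)"
    using irreducible irr_swap[OF irreducible] nz nonzero_swap[OF nz] clean clean_swap[OF clean]
    by (cases x; simp add: u_def pattern_swap)+
  have "act n x w = (if n then negate u else u)"
    by (simp add: act_def u_def)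
  then show "irreducible (act n x w)" "\<forall>(t, L)\<in>set (act n x w). t \<noteq> 0" "clean (pattern (act n x w))"
    using u irr_neg[OF u(1)] nonzero_neg[OF u(2)] clean_neg[OF u(3)] pattern_negate[OF u(2)]
    by (cases n; simp)+
qed

lemma irreducible_covered:
  assumes nf: "normal w" and irreducible: "irreducible w"
  shows "covered w" "length (profile w) \<le> 5"
proof -
  have nz: "\<forall>(t, L)\<in>set w. t \<noteq> 0"
    using normal_nonzero[OF nf] by auto
  have "covered w \<and> length (profile w) \<le> 5"
  proof (cases "w = []")
    case True
    have "covered []"
      by (rule coveredI[of 0 0 0 0 False False])
        (simp_all add: cover_simps)
    with True show ?thesis
      by (simp add: profile_def)
  next
    case False
    then obtain t L r where w: "w = (t, L) # r" "t \<noteq> 0"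
      using nz by (cases w) auto
    \<comment> \<open>the image of w under a symmetry that begins with P or W and a positive exponent\<close>
    define u where "u = act (t < 0) (L = LQ) w"
    note act = act_preserves[OF irreducible nz normal_clean[OF nf], of "t < 0" "L = LQ", folded u_def]
    note irr_u = act(1) and nz_u = act(2) and clean_u = act(3)
    have hd_u: "pattern u \<noteq> []" "hd (pattern u) \<in> {pP, pW}"
      using w by (cases L; cases "t < 0"; simp add: u_def act_def pattern_def)+
    have "admissible (pattern (rev u))"
    proof (rule irr_admissible)
      show "irreducible (rev u)"
        using irr_u by (rule irr_rev)
      show "\<forall>(t, L)\<in>set (rev u). t \<noteq> 0"
        using nz_u by simp
      show "clean (pattern (rev u))"
        using clean_rev[OF clean_u] by (simp add: pattern_rev)
    qed
    then have "admissible (rev (pattern u))"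
      by (simp add: pattern_rev)
    from admissible_cases[OF this] have p: "pattern u \<in> patterns"
      using hd_u by (simp add: last_rev)
    then have "covered u"
      by (rule covered_if_pattern[OF irr_u nz_u])
    then have "covered w"
      unfolding u_def by (rule covered_act)
    moreover have "length (profile u) \<le> 5"
      using p by (auto simp: profile_def signs_pattern[OF nz_u] patterns_def)
    ultimately show ?thesis
      by (simp add: u_def length_profile_act)
  qed
  then show "covered w" "length (profile w) \<le> 5"
    by blast+
qed

lemma length_profile_Cons: "length (profile ((t, L) # w)) \<le> Suc (length (profile w))"
  by (simp add: profile_def remdups_adj_hd)

text \<open>
A further letter creates at most a sixth block, and normal irreducible words with at most six blocks have at most five.
\<close>

lemma short_word_exists: "\<exists>w'. wmat w' = wmat w \<and> cost w' \<le> cost w \<and> length (profile w') \<le> 5"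
proof (induction w rule: wmat.induct)
  case 1
  then show ?case
    by (intro exI[of _ "[]"]) (simp add: profile_def)
next
  case (2 t L w)
  then obtain w' where w': "wmat w' = wmat w" "cost w' \<le> cost w" "length (profile w') \<le> 5"
    by blast
  then have "length (profile ((t, L) # w')) \<le> 6"
    using length_profile_Cons[of t L w'] by linarith
  from irreducible_word_exists[OF this] obtain v where v: "normal v" "irreducible v" "wmat v = wmat ((t, L) # w')"
    "\<And>u. wmat u = wmat ((t, L) # w') \<Longrightarrow> length (profile u) \<le> 6 \<Longrightarrow> cost v \<le> cost u"
    by blast
  have "cost v \<le> cost ((t, L) # w')"
    by (rule v(4)) (use \<open>length (profile ((t, L) # w')) \<le> 6\<close> in simp_all)
  with w'(2) have "cost v \<le> cost ((t, L) # w)"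
    by simp
  moreover have "wmat v = wmat ((t, L) # w)"
    by (simp only: v(3) wmat.simps w'(1))
  ultimately show ?case
    using irreducible_covered(2)[OF v(1,2)] by blast
qed

lemma optimal_covered_word_exists:
  "\<exists>w. covered w \<and> wmat w = wmat w0 \<and> (\<forall>w'. wmat w' = wmat w0 \<longrightarrow> cost w \<le> cost w')"
proof -
  obtain w1 where w1: "wmat w1 = wmat w0" "length (profile w1) \<le> 6"
  proof -
    obtain u where "wmat u = wmat w0" "length (profile u) \<le> 5"
      using short_word_exists by blast
    then show ?thesis
      by (intro that[of u]) simp_all
  qed
  from irreducible_word_exists[OF w1(2)] obtain w where w: "normal w" "irreducible w" "wmat w = wmat w0"
    "\<And>u. wmat u = wmat w0 \<Longrightarrow> length (profile u) \<le> 6 \<Longrightarrow> cost w \<le> cost u"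
    unfolding w1(1) by blast
  have "cost w \<le> cost w'" if "wmat w' = wmat w0" for w'
  proof -
    obtain w'' where "wmat w'' = wmat w'" "cost w'' \<le> cost w'" "length (profile w'') \<le> 5"
      using short_word_exists by blast
    with w(4)[of w''] that show ?thesis
      by simp
  qed
  with irreducible_covered[OF w(1,2)] w(3) show ?thesis
    by blast
qed

section \<open>Words and exponential products\<close>

definition realize :: "word \<Rightarrow> (real \<times> (real^2^2)) list" where
  "realize = map (\<lambda>(t, L). (t, gen L))"

lemma PQ_nonzero [simp]: "P \<noteq> 0" "Q \<noteq> 0"
  by (simp_all add: P_def Q_def vec_eq_iff forall_2)

lemma exp_product_realize: "exp_product (realize w) = wmat w"
  by (induction w) (auto simp: exp_product_def realize_def matrix_exp_gen mat22_one)

lemma product_cost_realize: "product_cost (realize w) = cost w"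
proof (induction w)
  case (Cons y w)
  obtain t L where "y = (t, L)"
    by (cases y)
  with Cons show ?case
    by (cases L) (auto simp: product_cost_def realize_def)
qed (simp add: product_cost_def realize_def)

lemma PQ_product_realize:
  assumes "snd ` set w \<subseteq> {P, Q}"
  shows "\<exists>w'. PQ_word w' \<and> realize w' = w \<and> cost w' = (\<Sum>(t, A)\<leftarrow>w. \<bar>t\<bar>)"
  using assms
proof (induction w)
  case (Cons y w)
  obtain t A where y: "y = (t, A)"
    by (cases y)
  obtain w' where "PQ_word w'" "realize w' = w" "cost w' = (\<Sum>(t, A)\<leftarrow>w. \<bar>t\<bar>)"
    using Cons by auto
  moreover have "A = P \<or> A = Q"
    using Cons.prems y by auto
  ultimately show ?case
    using y by (intro exI[of _ "(t, if A = P then LP else LQ) # w'"]) (auto simp: PQ_word_def realize_def)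
qed (auto simp: PQ_word_def realize_def intro!: exI[of _ "[]"])

lemma realize_PQ_word:
  assumes "PQ_word w"
  shows "snd ` set (realize w) \<subseteq> {P, Q}" "(\<Sum>(t, A)\<leftarrow>realize w. \<bar>t\<bar>) = cost w"
proof -
  have "snd ` set (realize w) \<subseteq> {P, Q} \<and> (\<Sum>(t, A)\<leftarrow>realize w. \<bar>t\<bar>) = cost w"
    using assms
  proof (induction w)
    case (Cons y w)
    obtain t L where "y = (t, L)"
      by (cases y)
    with Cons show ?case
      by (cases L) (auto simp: PQ_word_def realize_def)
  qed (simp add: realize_def)
  then show "snd ` set (realize w) \<subseteq> {P, Q}" "(\<Sum>(t, A)\<leftarrow>realize w. \<bar>t\<bar>) = cost w"
    by blast+
qed

lemma factorization_cost_eq: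
  assumes opt: "\<And>w'. wmat w' = wmat w \<Longrightarrow> cost w \<le> cost w'"
  shows "factorization_cost (wmat w) = cost w"
proof -
  let ?A = "{(\<Sum>(t, A)\<leftarrow>v. \<bar>t\<bar>) | v. snd ` set v \<subseteq> {P, Q} \<and> wmat w = exp_product v}"
  have low: "cost w \<le> a" if a: "a \<in> ?A" for a
  proof -
    obtain v where v: "a = (\<Sum>(t, A)\<leftarrow>v. \<bar>t\<bar>)" "snd ` set v \<subseteq> {P, Q}" "wmat w = exp_product v"
      using a by blast
    obtain w' where "realize w' = v" "cost w' = a"
      using PQ_product_realize[OF v(2)] v(1) by blast
    then show ?thesis
      using opt[of w'] v(3) exp_product_realize[of w'] by simp
  qed
  have up: "\<exists>a\<in>?A. a \<le> cost w + e" if e: "0 < e" for e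
  proof -
    obtain w' where w': "PQ_word w'" "wmat w' = wmat w" "cost w' \<le> cost w + e"
      using approximate_by_PQ[OF e] by blast
    then have "cost w' \<in> ?A"
      using realize_PQ_word[OF w'(1)] exp_product_realize[of w']
      by (intro CollectI exI[of _ "realize w'"]) auto
    with w'(3) show ?thesis
      by blast
  qed
  have "Inf ?A \<le> cost w"
  proof (rule field_le_epsilon)
    fix e :: real
    assume "0 < e"
    with up obtain a where "a \<in> ?A" "a \<le> cost w + e"
      by blast
    moreover have "Inf ?A \<le> a"
      using low \<open>a \<in> ?A\<close> by (intro cInf_lower bdd_belowI)
    ultimately show "Inf ?A \<le> cost w + e"
      by linarith
  qed
  moreover have "cost w \<le> Inf ?A"
    using up[of 1] low by (intro cInf_greatest) auto
  ultimately show ?thesis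
    by (simp add: factorization_cost_def)
qed

text \<open>
If the lower left entry c is not 0, the matrix is exp(xP) exp(cQ) exp(zP); otherwise this
applies after multiplication by exp(Q).
\<close>

lemma SL2_word_exists:
  assumes "g \<in> SL2"
  shows "\<exists>w. wmat w = g"
proof -
  have generic: "\<exists>w. wmat w = g" if "det g = 1" "g $ 2 $ 1 \<noteq> 0" for g :: "real^2^2"
  proof -
    let ?w = "[((g $ 1 $ 1 - 1) / g $ 2 $ 1, LP), (g $ 2 $ 1, LQ), ((g $ 2 $ 2 - 1) / g $ 2 $ 1, LP)]"
    have "wmat ?w = g"
    proof (rule mat22_eq_pivot21)
      show "det (wmat ?w) = det g"
        by (simp only: det_wmat that)
    qed (use that in simp_all)
    then show ?thesis
      by blast
  qed
  have det: "det g = 1"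
    using assms by (simp add: SL2_def)
  show ?thesis
  proof (cases "g $ 2 $ 1 = 0")
    case True
    let ?h = "flow LQ 1 ** g"
    have "g $ 1 $ 1 \<noteq> 0"
      using det True by (auto simp: det_2)
    then have "?h $ 2 $ 1 \<noteq> 0"
      using True by (simp add: mult_entry)
    moreover have "det ?h = 1"
      using det by (simp add: det_mul)
    ultimately obtain w where "wmat w = ?h"
      using generic by blast
    then have "wmat ((- 1, LQ) # w) = g"
      by (simp only: wmat.simps flow_merge) (simp add: flow_zero)
    then show ?thesis
      by blast
  qed (use generic det in blast)
qed

section \<open>The sixty-four factorization maps\<close>

definition transform :: "bool \<Rightarrow> bool \<Rightarrow> (affine_form \<times> letter) list \<Rightarrow> (affine_form \<times> letter) list" where
  "transform n x = map (\<lambda>((a, b, c, d), L).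
     (if n then (- a, - b, - c, - d) else (a, b, c, d), if x then swapL L else L))"

definition families :: "(affine_form \<times> letter) list list" where
  "families = concat (map (\<lambda>B. [transform False False B, transform False True B,
     transform True False B, transform True True B]) bases)"

definition expression_of :: "(affine_form \<times> letter) list \<Rightarrow> expression" where
  "expression_of = map (\<lambda>((a, b, c, d), L). (\<lambda>x. b * x $ 1 + c * x $ 2 + d * x $ 3 + a, gen L))"

lemma length_families: "length families = 64"
  by (simp add: families_def length_concat comp_def sum_list_triv length_bases)

lemma negM_swapM: "negM (swapM g) = swapM (negM g)"
  by (simp add: negM_def swapM_def)

lemma transform_in_families: "B \<in> set bases \<Longrightarrow> transform n x B \<in> set families"
  by (cases n; cases x) (auto simp: families_def)

lemma instantiate_transform: "instantiate (transform n x B) r s t = act n x (instantiate B r s t)"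
  by (induction B) (auto simp: instantiate_def transform_def act_def algebra_simps)

lemma factorization_expression_of: "factorization_expression (expression_of B)"
proof -
  have "affine_function (\<lambda>x. b * x $ 1 + c * x $ 2 + d * x $ 3 + a)" for a b c d :: real
    unfolding affine_function_def
    by (intro exI[of _ "\<lambda>x. b * x $ 1 + c * x $ 2 + d * x $ 3"] exI[of _ a] conjI refl linearI)
      (simp_all add: algebra_simps)
  moreover have "gen L \<in> {P, Q, P + Q}" for L
    by (cases L) auto
  ultimately show ?thesis
    unfolding factorization_expression_def expression_of_def by (induction B) force+
qed

lemma product_at_expression_of:
  "product_at (expression_of B) (vector [r, s, t]) = realize (instantiate B r s t)"
  by (auto simp: product_at_def expression_of_def realize_def instantiate_def)

theorem theorem1p2:
  shows "\<exists>f :: nat \<Rightarrow> expression.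
    (\<forall>k\<in>{1..64}. factorization_expression (f k)) \<and>
    (\<forall>g\<in>SL2. \<exists>k\<in>{1..64}. \<exists>r s t :: real. 0 \<le> r \<and> 0 \<le> s \<and> 0 \<le> t \<and>
       provides_optimal_factorization (f k) (vector [r, s, t]) g)"
proof (intro exI conjI ballI)
  let ?f = "\<lambda>k. expression_of (families ! (k - 1))"
  show "factorization_expression (?f k)" for k
    by (rule factorization_expression_of)
  fix g
  assume "g \<in> SL2"
  then obtain w0 where w0: "wmat w0 = g"
    using SL2_word_exists by blast
  obtain w where w: "covered w" "wmat w = g" "\<And>w'. wmat w' = g \<Longrightarrow> cost w \<le> cost w'"
    using optimal_covered_word_exists[of w0] w0 by auto
  have T: "factorization_cost g = cost w"
    using factorization_cost_eq[of w] w(2,3) by simp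
  obtain B n x r s t where B: "B \<in> set bases" and rst: "0 \<le> r" "0 \<le> s" "0 \<le> t"
    and m: "wmat (instantiate B r s t) = wmat (act n x w)" and c: "cost (instantiate B r s t) = cost w"
    using w(1) unfolding covered_def by blast
  obtain i where i: "i < 64" "families ! i = transform n x B"
    using transform_in_families[OF B, of n x] length_families by (auto simp: in_set_conv_nth)
  have "wmat (act n x (instantiate B r s t)) = g"
    using m w(2) by (cases n; cases x) (simp_all add: act_def negM_swapM)
  moreover have "cost (act n x (instantiate B r s t)) = cost w"
    using c by (simp add: act_def)
  ultimately have "provides_optimal_factorization (?f (Suc i)) (vector [r, s, t]) g"
    unfolding provides_optimal_factorization_def factorization_map_def
    by (simp add: i product_at_expression_of instantiate_transform exp_product_realize product_cost_realize T)
  then show "\<exists>k\<in>{1..64}. \<exists>r s t. 0 \<le> r \<and> 0 \<le> s \<and> 0 \<le> t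
      \<and> provides_optimal_factorization (?f k) (vector [r, s, t]) g"
    using i(1) rst by (intro bexI[of _ "Suc i"]) auto
qed

end
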